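(* Let $V\in C^\infty(\mathbb T^2;\mathbb R^2)$ be divergence free with mean zero and let $p\in\mathbb R^2$. Let $\Lambda$ be the collection of all Borel probability measures on $\mathbb T^2$ invariant under the flow $\dot\xi=V(\xi)$, and let $$\hat\Lambda=\left\{\sigma=w^2\,dx:\ w\in H^1(\mathbb T^2),\ \int_{\mathbb T^2}w^2\,dx=1,\ V(x)\cdot Dw=0\right\}.$$ Then $$\sup_{\sigma\in\hat\Lambda}\int_{\mathbb T^2}p\cdot V(x)\,d\sigma=\max_{\sigma\in\Lambda}\int_{\mathbb T^2}p\cdot V(x)\,d\sigma.$$
   Context: $\mathbb T^2=\mathbb R^2/\mathbb Z^2$ is the flat torus; functions on it are identified with $\mathbb Z^2$-periodic functions on $\mathbb R^2$. *)

theory Defs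
  imports "HOL-Probability.Probability"
begin

definition lattice_rel :: "real^2 \<Rightarrow> real^2 \<Rightarrow> bool" where
  "lattice_rel x y \<longleftrightarrow> (\<forall>i. x $ i - y $ i \<in> \<int>)"

text \<open>The torus is the quotient of the plane by the integer lattice; \<open>abs_torus\<close> is the canonical
  projection.\<close>

quotient_type torus = "real^2" / lattice_rel
proof (rule equivpI)
  show "reflp lattice_rel"
    by (simp add: reflp_def lattice_rel_def)
  show "symp lattice_rel"
    unfolding symp_def lattice_rel_def by (metis Ints_minus minus_diff_eq)
  show "transp lattice_rel"
    unfolding transp_def lattice_rel_def
    by (metis Ints_add add_diff_eq diff_add_cancel)
qed

instantiation torus :: topological_space
begin

definition open_torus :: "torus set \<Rightarrow> bool" where
  "open_torus U \<longleftrightarrow> open (abs_torus -` U)"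

instance
  by standard (auto simp: open_torus_def vimage_Union)

end

lemma continuous_on_abs_torus: "continuous_on UNIV abs_torus"
  by (simp add: continuous_on_open_vimage open_torus_def)

definition torus_measure :: "torus measure" where
  "torus_measure =
     distr (restrict_space lborel {x :: real^2. \<forall>i. 0 \<le> x $ i \<and> x $ i < 1}) borel abs_torus"

text \<open>Functions on the torus are differentiated through their periodic lifts \<open>f \<circ> abs_torus\<close>. The
  derivative of a lift is again periodic, so the representative chosen by \<open>rep_torus\<close> is immaterial.\<close>

definition torus_partial :: "2 \<Rightarrow> (torus \<Rightarrow> 'b::real_normed_vector) \<Rightarrow> torus \<Rightarrow> 'b" where
  "torus_partial i f x = frechet_derivative (f \<circ> abs_torus) (at (rep_torus x)) (axis i 1)"

text \<open>\<open>C_k k f\<close> says that the directional derivatives of \<open>f\<close> of all orders up to \<open>k\<close> exist, as values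
  of Frechet derivatives, and are continuous.\<close>

fun C_k :: "nat \<Rightarrow> (real^2 \<Rightarrow> 'b::real_normed_vector) \<Rightarrow> bool" where
  "C_k 0 f \<longleftrightarrow> continuous_on UNIV f"
| "C_k (Suc k) f \<longleftrightarrow>
     (\<forall>x. f differentiable (at x)) \<and> (\<forall>v. C_k k (\<lambda>x. frechet_derivative f (at x) v))"

definition torus_smooth :: "(torus \<Rightarrow> 'b::real_normed_vector) \<Rightarrow> bool" where
  "torus_smooth f \<longleftrightarrow> (\<forall>k. C_k k (f \<circ> abs_torus))"

definition divergence :: "(torus \<Rightarrow> real^2) \<Rightarrow> torus \<Rightarrow> real" where
  "divergence V x = (\<Sum>i\<in>UNIV. torus_partial i V x $ i)"

definition torus_L2 :: "(torus \<Rightarrow> 'b::euclidean_space) \<Rightarrow> bool" where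
  "torus_L2 f \<longleftrightarrow>
     f \<in> borel_measurable torus_measure \<and> integrable torus_measure (\<lambda>x. (norm (f x))\<^sup>2)"

definition weak_gradient :: "(torus \<Rightarrow> real) \<Rightarrow> (torus \<Rightarrow> real^2) \<Rightarrow> bool" where
  "weak_gradient w G \<longleftrightarrow>
     (\<forall>\<phi> :: torus \<Rightarrow> real. torus_smooth \<phi> \<longrightarrow>
       (\<forall>i. (\<integral>x. w x * torus_partial i \<phi> x \<partial>torus_measure)
          = - (\<integral>x. G x $ i * \<phi> x \<partial>torus_measure)))"

text \<open>\<open>w\<close> belongs to the Sobolev space \<open>H\<^sup>1\<close> and \<open>G\<close> is its (a.e. unique) weak gradient.\<close>

definition H1_with_gradient :: "(torus \<Rightarrow> real) \<Rightarrow> (torus \<Rightarrow> real^2) \<Rightarrow> bool" where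
  "H1_with_gradient w G \<longleftrightarrow> torus_L2 w \<and> torus_L2 G \<and> weak_gradient w G"

text \<open>A solution on the torus of the autonomous equation driven by \<open>V\<close> is the projection of a curve
  in the plane solving the lifted equation. Two lifts with the same initial point on the torus differ
  by a constant lattice vector, so the description below is unambiguous whenever \<open>V\<close> has a smooth
  lift.\<close>

definition flow :: "(torus \<Rightarrow> real^2) \<Rightarrow> real \<Rightarrow> torus \<Rightarrow> torus" where
  "flow V t x = (THE y. \<exists>\<xi> :: real \<Rightarrow> real^2.
     (\<forall>s. (\<xi> has_vector_derivative V (abs_torus (\<xi> s))) (at s)) \<and>
     abs_torus (\<xi> 0) = x \<and> abs_torus (\<xi> t) = y)"

definition invariant_measures :: "(torus \<Rightarrow> real^2) \<Rightarrow> torus measure set" where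
  "invariant_measures V =
     {\<sigma>. prob_space \<sigma> \<and> sets \<sigma> = sets borel \<and> (\<forall>t. distr \<sigma> borel (flow V t) = \<sigma>)}"

definition invariant_H1_densities :: "(torus \<Rightarrow> real^2) \<Rightarrow> torus measure set" where
  "invariant_H1_densities V =
     {density torus_measure (\<lambda>x. ennreal ((w x)\<^sup>2)) | w.
        (\<integral>x. (w x)\<^sup>2 \<partial>torus_measure) = 1 \<and>
        (\<exists>G. H1_with_gradient w G \<and> (AE x in torus_measure. V x \<bullet> G x = 0))}"

end

theory Submission
  imports Defs
begin

text \<open>Everything happens on the plane, for lattice-periodic lifts. Since \<open>V\<close> is divergence free with mean
  zero it has a periodic Hamiltonian \<open>H\<close>. Let \<open>\<Phi>\<close> be the flow and let \<open>m\<close> be the infimum over \<open>n\<close> of the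
  largest value of \<open>p \<bullet> (\<Phi> n x - x) / n\<close>; it bounds the integral of \<open>p \<bullet> V\<close> against every invariant measure.
  If \<open>m \<le> 0\<close>, Lebesgue measure is optimal in both classes. If \<open>m > 0\<close>, compactness yields an orbit drifting
  at rate at least \<open>m\<close> at all times. It returns close to itself where \<open>V\<close> is bounded away from zero, and
  conservation of \<open>H\<close> forces it to close up; the invariant measure on this closed orbit is optimal, and cutoffs
  of \<open>H\<close> near the closed orbit give \<open>H\<^sup>1\<close> densities whose integrals are as close as desired.

  Conversely, an \<open>H\<^sup>1\<close> function \<open>w\<close> with \<open>V \<bullet> Dw = 0\<close> is transported by the flow: pairing \<open>w\<close> with a test
  function composed with the flow gives a constant, by mollifying the composition, which is only Lipschitz.
  For \<open>w = 1\<close> this is Liouville's theorem.\<close>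

section \<open>Calculus of periodic functions\<close>

text \<open>The flow is never differentiated in its initial point; only the Lipschitz bound from
  Gronwall's inequality is available. Derivatives of torus integrals along the flow are therefore
  replaced by pointwise expansions with a quadratic remainder, which integrate without further
  regularity, and \<open>quadratic_increment_const\<close> turns such an estimate into a
  conservation law. The same device shows that the Hamiltonian is periodic and that the mean drift
  under an invariant measure is linear in time.

  Positive drift carries the geometric half. A drifting orbit cannot slow down for good, and once
  closed it contains no zero of \<open>V\<close>. So the field is bounded below where the orbit
  returns and, by periodicity, along the whole closed orbit; flow boxes then describe the level set
  of the Hamiltonian nearby, and critical levels never have to be analysed. Mean zero is what makes
  this possible on the torus: an orbit returns only modulo the lattice, and comparing levels across
  cells requires a periodic Hamiltonian.\<close>

lemma C_k_cong: "C_k k f \<Longrightarrow> (\<And>x. f x = g x) \<Longrightarrow> C_k k g"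
  by (simp add: ext[of f g])

lemma C_k_Suc_imp: "C_k (Suc k) f \<Longrightarrow> C_k k f"
proof (induction k arbitrary: f)
  case 0
  then show ?case
    by (auto intro!: continuous_at_imp_continuous_on differentiable_imp_continuous_within)
next
  case (Suc k)
  show ?case
    using Suc.prems Suc.IH by (simp del: C_k.simps(1))
qed

lemma C_k_continuous: "C_k k f \<Longrightarrow> continuous_on UNIV f"
  by (induction k arbitrary: f) (auto intro: C_k_Suc_imp simp del: C_k.simps(2))

lemma C_k_const: "C_k k (\<lambda>x. c)"
  by (induction k arbitrary: c) auto

lemma C_k_add:
  assumes "C_k k f" "C_k k g"
  shows "C_k k (\<lambda>x. f x + g x)"
  using assms
proof (induction k arbitrary: f g)
  case (Suc k)
  have "((\<lambda>x. f x + g x) has_derivative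
      (\<lambda>v. frechet_derivative f (at x) v + frechet_derivative g (at x) v)) (at x)" for x
    using Suc.prems frechet_derivative_works by (auto intro!: has_derivative_add)
  from frechet_derivative_at[OF this]
  have D: "frechet_derivative (\<lambda>x. f x + g x) (at x)
      = (\<lambda>v. frechet_derivative f (at x) v + frechet_derivative g (at x) v)" for x
    by simp
  show ?case
    unfolding C_k.simps(2) D using Suc by auto
qed (auto intro: continuous_intros)

lemma C_k_bounded_linear:
  assumes "bounded_linear L" "C_k k f"
  shows "C_k k (\<lambda>x. L (f x))"
  using assms(2)
proof (induction k arbitrary: f)
  case 0
  then show ?case
    using bounded_linear.continuous_on[OF assms(1)] by simp
next
  case (Suc k)
  have D: "((\<lambda>x. L (f x)) has_derivative (\<lambda>v. L (frechet_derivative f (at x) v))) (at x)" for x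
    using Suc.prems frechet_derivative_works
    by (auto intro!: bounded_linear.has_derivative[OF assms(1)])
  have "frechet_derivative (\<lambda>x. L (f x)) (at x) = (\<lambda>v. L (frechet_derivative f (at x) v))" for x
    using frechet_derivative_at[OF D] by simp
  then show ?case
    using Suc D by (auto simp: differentiable_def)
qed

lemma C_k_mult:
  fixes f g :: "real^2 \<Rightarrow> real"
  assumes "C_k k f" "C_k k g"
  shows "C_k k (\<lambda>x. f x * g x)"
  using assms
proof (induction k arbitrary: f g)
  case (Suc k)
  have "((\<lambda>x. f x * g x) has_derivative
      (\<lambda>v. f x * frechet_derivative g (at x) v + frechet_derivative f (at x) v * g x)) (at x)" for x
    using Suc.prems frechet_derivative_works by (auto intro!: has_derivative_mult)
  from frechet_derivative_at[OF this]
  have D: "frechet_derivative (\<lambda>x. f x * g x) (at x)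
      = (\<lambda>v. f x * frechet_derivative g (at x) v + frechet_derivative f (at x) v * g x)" for x
    by simp
  have "C_k k f" "C_k k g"
    using Suc.prems C_k_Suc_imp by blast+
  then show ?case
    unfolding C_k.simps(2) D using Suc by (auto intro!: C_k_add)
qed (auto intro: continuous_intros)

lemma C_k_sum:
  assumes "\<And>i. i \<in> I \<Longrightarrow> C_k k (f i)"
  shows "C_k k (\<lambda>x. \<Sum>i\<in>I. f i x)"
  using assms by (induction I rule: infinite_finite_induct) (auto intro: C_k_const C_k_add)

lemma C_k_nth: "C_k k f \<Longrightarrow> C_k k (\<lambda>x. f x $ i)"
  by (rule C_k_bounded_linear[OF bounded_linear_vec_nth])

lemma C_k_cos_sin:
  "C_k k (\<lambda>x. cos (c * x $ i))" "C_k k (\<lambda>x. sin (c * x $ i))"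
proof (induction k)
  case (Suc k)
  have "((\<lambda>x. cos (c * x $ i)) has_derivative (\<lambda>v. (- c * v $ i) * sin (c * x $ i))) (at x)"
       "((\<lambda>x. sin (c * x $ i)) has_derivative (\<lambda>v. (c * v $ i) * cos (c * x $ i))) (at x)" for x
    by (auto intro!: derivative_eq_intros bounded_linear_imp_has_derivative simp: bounded_linear_vec_nth)
  note D = this this[THEN frechet_derivative_at, symmetric]
  {
    case 1
    then show ?case
      unfolding C_k.simps(2) D(3) using D(1) Suc
      by (auto simp only: differentiable_def intro!: C_k_mult[OF C_k_const])
    case 2
    then show ?case
      unfolding C_k.simps(2) D(4) using D(2) Suc
      by (auto simp only: differentiable_def intro!: C_k_mult[OF C_k_const])
  }
qed (auto intro!: continuous_intros)

lemma C_k_has_derivative: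
  "C_k (Suc k) f \<Longrightarrow> (f has_derivative frechet_derivative f (at x)) (at x)"
  by (simp add: frechet_derivative_works)

lemma C_k_frechet_derivative: "C_k (Suc k) f \<Longrightarrow> C_k k (\<lambda>x. frechet_derivative f (at x) v)"
  by simp

lemma line_derivative:
  fixes u :: "real^2 \<Rightarrow> real"
  assumes "C_k (Suc k) u"
  shows "((\<lambda>t. u (x + t *\<^sub>R v)) has_real_derivative frechet_derivative u (at x) v) (at 0)"
proof -
  interpret linear "frechet_derivative u (at x)"
    by (rule has_derivative_linear[OF C_k_has_derivative[OF assms]])
  have "((\<lambda>t. u (x + t *\<^sub>R v)) has_derivative (\<lambda>t. frechet_derivative u (at x) (t *\<^sub>R v))) (at 0)"
    by (rule has_derivative_compose[where g = u])
      (use C_k_has_derivative[OF assms, of x] in \<open>auto intro!: derivative_eq_intros\<close>)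
  then show ?thesis
    unfolding has_field_derivative_def
    by (simp add: scaleR mult.commute[of _ "frechet_derivative u (at x) v"])
qed

text \<open>Reduces a directional derivative to one-variable calculus along a line, as done for the
  trigonometric kernel.\<close>

lemma frechet_derivative_eqI:
  fixes u :: "real^2 \<Rightarrow> real"
  assumes "C_k (Suc k) u" "((\<lambda>t. u (x + t *\<^sub>R v)) has_real_derivative d) (at 0)"
  shows "frechet_derivative u (at x) v = d"
  using line_derivative[OF assms(1)] assms(2) DERIV_unique by blast

lemma frechet_derivative_lift_mult:
  fixes f g :: "real^2 \<Rightarrow> real"
  assumes "C_k (Suc k) f" "C_k (Suc k) g"
  shows "frechet_derivative (\<lambda>x. f x * g x) (at x) v
    = f x * frechet_derivative g (at x) v + frechet_derivative f (at x) v * g x"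
  using frechet_derivative_at[OF has_derivative_mult[OF C_k_has_derivative[OF assms(1)] C_k_has_derivative[OF assms(2)]], of x]
  by (simp add: fun_eq_iff)

lemma frechet_derivative_nth:
  fixes f :: "real^2 \<Rightarrow> real^2"
  assumes "C_k (Suc k) f"
  shows "frechet_derivative (\<lambda>x. f x $ i) (at x) v = frechet_derivative f (at x) v $ i"
proof -
  have "((\<lambda>x. f x $ i) has_derivative (\<lambda>v. frechet_derivative f (at x) v $ i)) (at x)"
    by (rule bounded_linear.has_derivative[OF bounded_linear_vec_nth C_k_has_derivative[OF assms]])
  from frechet_derivative_at[OF this] show ?thesis by (simp add: fun_eq_iff)
qed

lemma frechet_derivative_expand:
  fixes f :: "real^2 \<Rightarrow> 'b::real_normed_vector"
  assumes "C_k (Suc k) f"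
  shows "frechet_derivative f (at x) v = (\<Sum>i\<in>UNIV. v $ i *\<^sub>R frechet_derivative f (at x) (axis i 1))"
proof -
  interpret linear "frechet_derivative f (at x)"
    by (rule has_derivative_linear[OF C_k_has_derivative[OF assms]])
  have "frechet_derivative f (at x) v = frechet_derivative f (at x) (\<Sum>i\<in>UNIV. v $ i *\<^sub>R axis i 1)"
    using basis_expansion[of v] by (simp add: scalar_mult_eq_scaleR)
  then show ?thesis by (simp add: sum scaleR)
qed

section \<open>Periodic lifts of functions on the torus\<close>

definition periodic :: "(real^2 \<Rightarrow> 'b) \<Rightarrow> bool" where
  "periodic f \<longleftrightarrow> (\<forall>x y. lattice_rel x y \<longrightarrow> f x = f y)"

definition unit_cell :: "(real^2) set" where
  "unit_cell = {x. \<forall>i. 0 \<le> x $ i \<and> x $ i < 1}"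

lemma abs_torus_eq_iff: "abs_torus x = abs_torus y \<longleftrightarrow> lattice_rel x y"
  by (simp add: torus.abs_eq_iff)

lemma abs_rep_torus [simp]: "abs_torus (rep_torus X) = X"
  by (rule Quotient3_abs_rep[OF Quotient3_torus])

lemma lattice_rel_rep_abs: "lattice_rel (rep_torus (abs_torus x)) x"
  using abs_torus_eq_iff abs_rep_torus by blast

lemma periodicD: "periodic f \<Longrightarrow> lattice_rel x y \<Longrightarrow> f x = f y"
  by (simp add: periodic_def)

lemma lattice_rel_refl [simp]: "lattice_rel x x"
  by (simp add: lattice_rel_def)

lemma lattice_rel_sym: "lattice_rel x y \<Longrightarrow> lattice_rel y x"
  by (metis abs_torus_eq_iff)

lemma lattice_rel_trans: "lattice_rel x y \<Longrightarrow> lattice_rel y z \<Longrightarrow> lattice_rel x z"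
  by (metis abs_torus_eq_iff)

lemma lattice_rel_add [simp]: "lattice_rel (x + a) (y + a) \<longleftrightarrow> lattice_rel x y"
  by (simp add: lattice_rel_def)

lemma periodic_rep: "periodic f \<Longrightarrow> f (rep_torus (abs_torus x)) = f x"
  by (rule periodicD[OF _ lattice_rel_rep_abs])

lemma periodic_abs: "periodic (\<lambda>x. f (abs_torus x))"
  by (metis abs_torus_eq_iff periodic_def)

lemma periodic_const [simp]: "periodic (\<lambda>x. c)"
  by (simp add: periodic_def)

lemma periodic_comp: "periodic f \<Longrightarrow> periodic (\<lambda>x. h (f x))"
  unfolding periodic_def by (intro allI impI, simp)

lemma periodic_comp2: "periodic f \<Longrightarrow> periodic g \<Longrightarrow> periodic (\<lambda>x. h (f x) (g x))"
  unfolding periodic_def by (intro allI impI) (rule arg_cong2[where f = h]; blast)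

lemma periodic_translate: "periodic f \<Longrightarrow> periodic (\<lambda>x. f (x + a))"
  by (auto simp: periodic_def)

text \<open>The section \<open>rep_torus\<close> comes from a choice and carries no continuity.
  Periodicity makes the composite the map induced on the quotient, whose open sets are read off by
  pulling back along \<open>abs_torus\<close>.\<close>

lemma continuous_on_rep_torus:
  fixes f :: "real^2 \<Rightarrow> 'b::topological_space"
  assumes "periodic f" "continuous_on UNIV f"
  shows "continuous_on UNIV (\<lambda>X. f (rep_torus X))"
  unfolding continuous_on_open_vimage[OF open_UNIV]
proof (intro allI impI)
  fix S :: "'b set" assume "open S"
  have "abs_torus -` ((\<lambda>X. f (rep_torus X)) -` S) = f -` S"
    by (auto simp: periodic_rep[OF assms(1)])
  with \<open>open S\<close> assms(2) show "open ((\<lambda>X. f (rep_torus X)) -` S \<inter> UNIV)"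
    by (simp add: open_torus_def continuous_on_open_vimage[OF open_UNIV])
qed

lemma borel_measurable_rep_torus:
  "periodic f \<Longrightarrow> continuous_on UNIV f \<Longrightarrow> (\<lambda>X. f (rep_torus X)) \<in> borel_measurable borel"
  by (intro borel_measurable_continuous_onI continuous_on_rep_torus)

lemma borel_measurable_abs_torus [measurable]: "abs_torus \<in> borel_measurable borel"
  by (rule borel_measurable_continuous_onI[OF continuous_on_abs_torus])

lemma lattice_rel_unit_cell:
  obtains y where "y \<in> unit_cell" "lattice_rel x y"
proof
  show "(\<chi> i. frac (x $ i)) \<in> unit_cell"
    by (simp add: unit_cell_def frac_lt_1)
  have "t - frac t = of_int \<lfloor>t\<rfloor>" for t :: real
    by (simp add: frac_def)
  then show "lattice_rel x (\<chi> i. frac (x $ i))"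
    by (simp add: lattice_rel_def)
qed

lemma unit_cell_subset: "unit_cell \<subseteq> cbox 0 1"
  by (auto simp: unit_cell_def mem_box_cart less_imp_le)

lemma periodic_bounded:
  fixes f :: "real^2 \<Rightarrow> 'b::real_normed_vector"
  assumes "periodic f" "continuous_on UNIV f"
  obtains B where "B > 0" "\<And>x. norm (f x) \<le> B"
proof -
  have "compact (f ` cbox 0 1)"
    by (meson assms(2) compact_cbox compact_continuous_image continuous_on_subset subset_UNIV)
  then have "bounded (f ` cbox 0 1)"
    by (rule compact_imp_bounded)
  then obtain B where "B > 0" and B: "\<And>x. x \<in> cbox 0 1 \<Longrightarrow> norm (f x) \<le> B"
    unfolding bounded_pos by blast
  have "norm (f x) \<le> B" for x
  proof -
    obtain y where y: "y \<in> unit_cell" "lattice_rel x y" by (rule lattice_rel_unit_cell)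
    then have "norm (f y) \<le> B" using unit_cell_subset by (intro B) blast
    then show ?thesis by (simp only: periodicD[OF assms(1) y(2)])
  qed
  with \<open>B > 0\<close> that show thesis by blast
qed

text \<open>Translation by a lattice vector identifies the possible derivatives at the two points,
  so \<open>frechet_derivative\<close>, a choice from that set, selects the same map at both, even
  where \<open>f\<close> has no derivative.\<close>

lemma periodic_frechet_derivative:
  assumes "periodic f"
  shows "periodic (\<lambda>x. frechet_derivative f (at x))"
  unfolding periodic_def
proof (intro allI impI)
  fix x y :: "real^2" assume *: "lattice_rel x y"
  have shift: "f (z + (y - x)) = f z" for z
    by (rule periodicD[OF assms]) (use lattice_rel_sym[OF *] in \<open>simp add: lattice_rel_def\<close>)
  have tr: "((\<lambda>z. f (z + (b - a))) has_derivative D) (at a)" if "(f has_derivative D) (at b)" for a b D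
    by (rule has_derivative_compose[where g = f and g' = D and f = "\<lambda>z. z + (b - a)" and f' = "\<lambda>z. z"])
      (use that in \<open>auto intro!: derivative_eq_intros\<close>)
  have "f (z + (x - y)) = f z" for z
    using shift[of "z + (x - y)"] by simp
  then have eq: "(f has_derivative D) (at x) \<longleftrightarrow> (f has_derivative D) (at y)" for D
    using tr[of D x y] tr[of D y x] shift by auto
  show "frechet_derivative f (at x) = frechet_derivative f (at y)"
    unfolding frechet_derivative_def eq ..
qed

text \<open>The partial derivatives are continuous and periodic, hence bounded. The sum of their
  bounds dominates the operator norm, and the mean value inequality applies on the whole plane
  because it is convex.\<close>

lemma C1_periodic_lipschitz:
  fixes f :: "real^2 \<Rightarrow> 'b::real_normed_vector"
  assumes "periodic f" "C_k 1 f"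
  obtains L where "L > 0" "\<And>x y. norm (f x - f y) \<le> L * norm (x - y)"
proof -
  have f: "C_k (Suc 0) f" using assms(2) by simp
  let ?D = "\<lambda>i x. frechet_derivative f (at x) (axis i 1)"
  have "\<exists>B>0. \<forall>x. norm (?D i x) \<le> B" for i
  proof -
    have "periodic (?D i)"
      by (rule periodic_comp[OF periodic_frechet_derivative[OF assms(1)], where h = "\<lambda>D. D (axis i 1)"])
    moreover have "continuous_on UNIV (?D i)"
      by (rule C_k_continuous[OF C_k_frechet_derivative[OF f]])
    ultimately obtain B where "B > 0" "\<And>x. norm (?D i x) \<le> B"
      by (rule periodic_bounded) (rule that)
    then show ?thesis by blast
  qed
  then obtain B where B: "\<And>i. B i > 0" "\<And>i x. norm (?D i x) \<le> B i"
    by metis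
  define L where "L = (\<Sum>i\<in>UNIV. B i)"
  have "onorm (frechet_derivative f (at x)) \<le> L" for x
  proof (rule onorm_bound)
    show "0 \<le> L" unfolding L_def using B(1) by (auto intro: sum_nonneg less_imp_le)
    fix v
    have "frechet_derivative f (at x) v = (\<Sum>i\<in>UNIV. v $ i *\<^sub>R ?D i x)"
      by (rule frechet_derivative_expand[OF f])
    also have "norm \<dots> \<le> (\<Sum>i\<in>UNIV. B i * norm v)"
    proof (rule sum_norm_le)
      fix i
      have "\<bar>v $ i\<bar> * norm (?D i x) \<le> norm v * B i"
        by (intro mult_mono component_le_norm_cart B) auto
      then show "norm (v $ i *\<^sub>R ?D i x) \<le> B i * norm v"
        by (simp add: mult.commute)
    qed
    finally show "norm (frechet_derivative f (at x) v) \<le> L * norm v"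
      by (simp add: L_def sum_distrib_right)
  qed
  then have "norm (f x - f y) \<le> L * norm (x - y)" for x y
    by (intro differentiable_bound[of UNIV f "\<lambda>x. frechet_derivative f (at x)"])
      (auto intro: C_k_has_derivative[OF f] has_derivative_at_withinI)
  moreover have "L > 0" unfolding L_def using B(1) by (auto intro!: sum_pos)
  ultimately show thesis using that by blast
qed

section \<open>Normalised Lebesgue measure on the torus and its translation invariance\<close>

lemma unit_cell_borel [measurable]: "unit_cell \<in> sets borel"
proof -
  have "unit_cell = (\<Inter>i. {x. 0 \<le> x $ i} \<inter> {x. x $ i < 1})"
    by (auto simp: unit_cell_def)
  also have "\<dots> \<in> sets borel"
    by (intro sets.countable_INT'' sets.Int borel_closed borel_open closed_Collect_le open_Collect_less
        continuous_intros) auto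
  finally show ?thesis .
qed

lemma torus_measure_alt:
  "torus_measure = distr (restrict_space lborel unit_cell) borel abs_torus"
  by (simp add: torus_measure_def unit_cell_def)

lemma sets_torus_measure [simp, measurable_cong]: "sets torus_measure = sets borel"
  by (simp add: torus_measure_def)

lemma space_torus_measure [simp]: "space torus_measure = UNIV"
  by (simp add: torus_measure_def)

lemma measurable_abs_torus_cell: "abs_torus \<in> measurable (restrict_space lborel unit_cell) borel"
  by (rule measurable_restrict_space1) simp

lemma nn_integral_torus_measure:
  assumes [measurable]: "h \<in> borel_measurable borel"
  shows "(\<integral>\<^sup>+X. h X \<partial>torus_measure) = (\<integral>\<^sup>+x. h (abs_torus x) * indicator unit_cell x \<partial>lborel)"
proof -
  have "(\<integral>\<^sup>+X. h X \<partial>torus_measure) = (\<integral>\<^sup>+x. h (abs_torus x) \<partial>restrict_space lborel unit_cell)"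
    unfolding torus_measure_alt by (rule nn_integral_distr[OF measurable_abs_torus_cell]) simp
  also have "\<dots> = (\<integral>\<^sup>+x. h (abs_torus x) * indicator unit_cell x \<partial>lborel)"
    by (rule nn_integral_restrict_space) simp
  finally show ?thesis .
qed

lemma emeasure_unit_cell: "emeasure lborel unit_cell = 1"
proof (rule antisym)
  have 1: "emeasure lborel (cbox 0 (1::real^2)) = 1" "emeasure lborel (box 0 (1::real^2)) = 1"
    by (auto simp: emeasure_lborel_cbox_eq emeasure_lborel_box_eq Basis_vec_def inner_axis intro!: prod.neutral)
  show "emeasure lborel unit_cell \<le> 1"
    using emeasure_mono[OF unit_cell_subset, of lborel] 1 by simp
  have "box 0 1 \<subseteq> unit_cell" by (auto simp: unit_cell_def mem_box_cart less_imp_le)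
  from emeasure_mono[OF this, of lborel] 1 show "1 \<le> emeasure lborel unit_cell" by simp
qed

interpretation torus: prob_space torus_measure
proof
  show "emeasure torus_measure (space torus_measure) = 1"
    using nn_integral_torus_measure[of "\<lambda>_. 1"] by (simp add: emeasure_unit_cell)
qed

lemma nn_integral_lborel_translate:
  fixes f :: "'a::euclidean_space \<Rightarrow> ennreal"
  assumes [measurable]: "f \<in> borel_measurable borel"
  shows "(\<integral>\<^sup>+x. f (x + a) \<partial>lborel) = (\<integral>\<^sup>+x. f x \<partial>lborel)"
proof -
  have "(\<integral>\<^sup>+x. f x \<partial>lborel) = (\<integral>\<^sup>+x. f x \<partial>distr lborel borel ((+) a))"
    by (simp add: lborel_distr_plus)
  also have "\<dots> = (\<integral>\<^sup>+x. f (x + a) \<partial>lborel)"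
    by (subst nn_integral_distr) (auto simp: add.commute)
  finally show ?thesis by simp
qed

text \<open>Shifting the cell along one axis pushes a slab out on one side; a lattice step brings it
  back on the other side, and the periodic integrand does not notice.\<close>

lemma nn_integral_cell_translate_axis:
  fixes f :: "real^2 \<Rightarrow> ennreal"
  assumes [measurable]: "f \<in> borel_measurable borel" and per: "periodic f" and t: "0 \<le> t" "t < 1"
  shows "(\<integral>\<^sup>+x. f (x + axis i t) * indicator unit_cell x \<partial>lborel)
       = (\<integral>\<^sup>+x. f x * indicator unit_cell x \<partial>lborel)"
proof -
  let ?e = "axis i t :: real^2" and ?u = "axis i 1 :: real^2"
  let ?A = "{x \<in> unit_cell. t \<le> x $ i}" and ?B = "{x \<in> unit_cell. x $ i < t}"
  have [measurable]: "?A \<in> sets borel" "?B \<in> sets borel"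
  proof -
    have "{x::real^2. t \<le> x $ i} \<in> sets borel" "{x::real^2. x $ i < t} \<in> sets borel"
      by (intro borel_closed borel_open closed_Collect_le open_Collect_less continuous_intros)+
    from sets.Int[OF unit_cell_borel this(1)] sets.Int[OF unit_cell_borel this(2)]
    moreover have "?A = unit_cell \<inter> {x. t \<le> x $ i}" "?B = unit_cell \<inter> {x. x $ i < t}" by auto
    ultimately show "?A \<in> sets borel" "?B \<in> sets borel" by simp_all
  qed
  \<comment> \<open>The shifted cell is the disjoint union of \<open>?A\<close>, the part that stays
    inside the cell, and the slab \<open>?B\<close> moved by one lattice step.\<close>
  have split: "indicator unit_cell (x - ?e) = (indicator ?A x + indicator ?B (x - ?u) :: ennreal)" for x
  proof -
    have nth: "(x - axis i c) $ j = (if j = i then x $ i - c else x $ j)" for c j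
      by (simp add: axis_def)
    have all: "(\<forall>j. Q j) \<longleftrightarrow> Q i \<and> (\<forall>j. j \<noteq> i \<longrightarrow> Q j)" for Q
      by metis
    let ?R = "\<forall>j. j \<noteq> i \<longrightarrow> 0 \<le> x $ j \<and> x $ j < 1"
    have c1: "x - ?e \<in> unit_cell \<longleftrightarrow> (t \<le> x $ i \<and> x $ i < 1 + t) \<and> ?R"
      unfolding unit_cell_def mem_Collect_eq all[of "\<lambda>j. 0 \<le> (x - ?e) $ j \<and> (x - ?e) $ j < 1"] nth
      by (simp cong: imp_cong) auto
    have c2: "x \<in> ?A \<longleftrightarrow> (t \<le> x $ i \<and> x $ i < 1) \<and> ?R"
      unfolding unit_cell_def mem_Collect_eq all[of "\<lambda>j. 0 \<le> x $ j \<and> x $ j < 1"]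
      using t by (simp cong: imp_cong) auto
    have c3: "x - ?u \<in> ?B \<longleftrightarrow> (1 \<le> x $ i \<and> x $ i < 1 + t) \<and> ?R"
      unfolding unit_cell_def mem_Collect_eq all[of "\<lambda>j. 0 \<le> (x - ?u) $ j \<and> (x - ?u) $ j < 1"] nth
      using t by (simp cong: imp_cong) auto
    have i1: "x - ?e \<in> unit_cell \<longleftrightarrow> x \<in> ?A \<or> x - ?u \<in> ?B"
      unfolding c1 c2 c3 using t by auto
    have i2: "\<not> (x \<in> ?A \<and> x - ?u \<in> ?B)"
      unfolding c2 c3 using t by auto
    have "indicator U a = (indicator A b + indicator B c :: ennreal)"
      if "a \<in> U \<longleftrightarrow> b \<in> A \<or> c \<in> B" "\<not> (b \<in> A \<and> c \<in> B)" for U A B :: "(real^2) set" and a b c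
      using that by (auto simp: indicator_def)
    from this[OF i1 i2] show ?thesis .
  qed
  have per1: "f (x + ?u) = f x" for x
    by (rule periodicD[OF per]) (simp add: lattice_rel_def axis_def)
  have "(\<integral>\<^sup>+x. f (x + ?e) * indicator unit_cell x \<partial>lborel)
      = (\<integral>\<^sup>+x. (\<lambda>x. f x * indicator unit_cell (x - ?e)) (x + ?e) \<partial>lborel)"
    by simp
  also have "\<dots> = (\<integral>\<^sup>+x. f x * indicator unit_cell (x - ?e) \<partial>lborel)"
    by (rule nn_integral_lborel_translate) measurable
  also have "\<dots> = (\<integral>\<^sup>+x. f x * indicator ?A x + f x * indicator ?B (x - ?u) \<partial>lborel)"
    by (simp only: split distrib_left)
  also have "\<dots> = (\<integral>\<^sup>+x. f x * indicator ?A x \<partial>lborel) + (\<integral>\<^sup>+x. f x * indicator ?B (x - ?u) \<partial>lborel)"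
    by (rule nn_integral_add) measurable
  also have "(\<integral>\<^sup>+x. f x * indicator ?B (x - ?u) \<partial>lborel)
      = (\<integral>\<^sup>+x. (\<lambda>x. f x * indicator ?B (x - ?u)) (x + ?u) \<partial>lborel)"
    by (rule nn_integral_lborel_translate[symmetric]) measurable
  also have "\<dots> = (\<integral>\<^sup>+x. f x * indicator ?B x \<partial>lborel)"
    by (simp add: per1)
  also have "(\<integral>\<^sup>+x. f x * indicator ?A x \<partial>lborel) + \<dots>
      = (\<integral>\<^sup>+x. f x * indicator ?A x + f x * indicator ?B x \<partial>lborel)"
    by (rule nn_integral_add[symmetric]) measurable
  also have "\<dots> = (\<integral>\<^sup>+x. f x * indicator unit_cell x \<partial>lborel)"
    by (rule nn_integral_cong) (auto simp: indicator_def)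
  finally show ?thesis .
qed

text \<open>Periodicity absorbs the integer parts of the shift; the fractional parts are then
  removed one axis at a time.\<close>

lemma nn_integral_cell_translate:
  fixes f :: "real^2 \<Rightarrow> ennreal"
  assumes [measurable]: "f \<in> borel_measurable borel" and per: "periodic f"
  shows "(\<integral>\<^sup>+x. f (x + a) * indicator unit_cell x \<partial>lborel)
       = (\<integral>\<^sup>+x. f x * indicator unit_cell x \<partial>lborel)"
proof -
  have fr: "t - frac t = of_int \<lfloor>t\<rfloor>" for t :: real
    by (simp add: frac_def)
  have "f (x + a) = f (x + axis 1 (frac (a $ 1)) + axis 2 (frac (a $ 2)))" for x
  proof (rule periodicD[OF per])
    have "(x + a) $ i - (x + axis 1 (frac (a $ 1)) + axis 2 (frac (a $ 2))) $ i = a $ i - frac (a $ i)" for i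
      using exhaust_2[of i] by (auto simp: axis_def)
    then show "lattice_rel (x + a) (x + axis 1 (frac (a $ 1)) + axis 2 (frac (a $ 2)))"
      by (simp add: lattice_rel_def fr)
  qed
  then have "(\<integral>\<^sup>+x. f (x + a) * indicator unit_cell x \<partial>lborel)
     = (\<integral>\<^sup>+x. (\<lambda>x. f (x + axis 2 (frac (a $ 2)))) (x + axis 1 (frac (a $ 1))) * indicator unit_cell x \<partial>lborel)"
    by simp
  also have "\<dots> = (\<integral>\<^sup>+x. f (x + axis 2 (frac (a $ 2))) * indicator unit_cell x \<partial>lborel)"
    by (rule nn_integral_cell_translate_axis)
      (auto simp: frac_lt_1 intro: periodic_translate[OF per])
  also have "\<dots> = (\<integral>\<^sup>+x. f x * indicator unit_cell x \<partial>lborel)"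
    by (rule nn_integral_cell_translate_axis) (auto simp: frac_lt_1 per)
  finally show ?thesis .
qed

definition torus_shift :: "real^2 \<Rightarrow> torus \<Rightarrow> torus" where
  "torus_shift a X = abs_torus (rep_torus X + a)"

lemma measurable_torus_shift [measurable]: "torus_shift a \<in> measurable borel borel"
proof -
  have "periodic (\<lambda>x. abs_torus (x + a))"
    by (simp add: periodic_def abs_torus_eq_iff)
  moreover have "continuous_on UNIV (\<lambda>x. abs_torus (x + a))"
    using continuous_on_compose2[OF continuous_on_abs_torus, of UNIV "\<lambda>x. x + a"]
    by (simp add: continuous_on_add)
  ultimately show ?thesis
    unfolding torus_shift_def by (rule borel_measurable_rep_torus)
qed

lemma torus_shift_abs: "torus_shift a (abs_torus x) = abs_torus (x + a)"
  by (simp add: torus_shift_def abs_torus_eq_iff lattice_rel_rep_abs)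

lemma distr_torus_shift: "distr torus_measure borel (torus_shift a) = torus_measure"
proof (rule measure_eqI)
  fix B assume "B \<in> sets (distr torus_measure borel (torus_shift a))"
  then have [measurable]: "B \<in> sets borel" by simp
  have "emeasure (distr torus_measure borel (torus_shift a)) B
      = (\<integral>\<^sup>+X. indicator B X \<partial>distr torus_measure borel (torus_shift a))"
    by simp
  also have "\<dots> = (\<integral>\<^sup>+X. indicator B (torus_shift a X) \<partial>torus_measure)"
    by (rule nn_integral_distr) measurable
  also have "\<dots> = (\<integral>\<^sup>+x. indicator B (torus_shift a (abs_torus x)) * indicator unit_cell x \<partial>lborel)"
    by (rule nn_integral_torus_measure) measurable
  also have "\<dots> = (\<integral>\<^sup>+x. indicator B (abs_torus (x + a)) * indicator unit_cell x \<partial>lborel)"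
    by (simp add: torus_shift_abs)
  also have "\<dots> = (\<integral>\<^sup>+x. indicator B (abs_torus x) * indicator unit_cell x \<partial>lborel)"
    by (rule nn_integral_cell_translate) (auto intro: periodic_abs[where f = "indicator B"])
  also have "\<dots> = (\<integral>\<^sup>+X. indicator B X \<partial>torus_measure)"
    by (rule nn_integral_torus_measure[symmetric]) measurable
  also have "\<dots> = emeasure torus_measure B"
    by simp
  finally show "emeasure (distr torus_measure borel (torus_shift a)) B = emeasure torus_measure B" .
qed simp

lemma integral_torus_translate:
  fixes f :: "real^2 \<Rightarrow> 'b::{banach, second_countable_topology}"
  assumes "periodic f" "continuous_on UNIV f"
  shows "(\<integral>X. f (rep_torus X + a) \<partial>torus_measure) = (\<integral>X. f (rep_torus X) \<partial>torus_measure)"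
proof -
  have "(\<integral>X. f (rep_torus X) \<partial>torus_measure)
      = (\<integral>X. f (rep_torus X) \<partial>distr torus_measure borel (torus_shift a))"
    by (simp add: distr_torus_shift)
  also have "\<dots> = (\<integral>X. f (rep_torus (torus_shift a X)) \<partial>torus_measure)"
    using borel_measurable_rep_torus[OF assms] by (intro integral_distr) simp_all
  also have "\<dots> = (\<integral>X. f (rep_torus X + a) \<partial>torus_measure)"
    by (simp add: torus_shift_def periodic_rep[OF assms(1)])
  finally show ?thesis by simp
qed

lemma integrable_torus_continuous:
  fixes f :: "real^2 \<Rightarrow> 'b::{banach, second_countable_topology}"
  assumes "periodic f" "continuous_on UNIV f" "finite_measure M" "sets M = sets borel"
  shows "integrable M (\<lambda>X. f (rep_torus X))"
proof -
  obtain B where "\<And>x. norm (f x) \<le> B" by (meson periodic_bounded assms)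
  then show ?thesis
    using borel_measurable_rep_torus[OF assms(1,2)] assms(3,4)
    by (intro finite_measure.integrable_const_bound[of _ _ B]) (simp_all cong: measurable_cong_sets)
qed

text \<open>By translation invariance every difference quotient has integral zero. The Lipschitz
  constant dominates the quotients, so the limit passes under the integral. Applied to products,
  this is integration by parts on the torus.\<close>

lemma integral_derivative_zero:
  fixes u :: "real^2 \<Rightarrow> real"
  assumes "periodic u" "C_k 1 u"
  shows "(\<integral>X. frechet_derivative u (at (rep_torus X)) v \<partial>torus_measure) = 0"
proof -
  have u: "C_k (Suc 0) u" using assms(2) by simp
  have cont: "continuous_on UNIV u" by (rule C_k_continuous[OF u])
  obtain L where "L > 0" and L: "\<And>x y. norm (u x - u y) \<le> L * norm (x - y)"
    by (rule C1_periodic_lipschitz[OF assms]) (rule that)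
  let ?h = "\<lambda>n. inverse (real (Suc n))"
  let ?q = "\<lambda>n x. (u (x + ?h n *\<^sub>R v) - u x) / ?h n"
  have perq: "periodic (?q n)" for n
    by (rule periodic_comp2[OF periodic_translate[OF assms(1)] assms(1)])
  have contq: "continuous_on UNIV (?q n)" for n
    by (intro continuous_intros continuous_on_compose2[OF cont]; simp)
  have perd: "periodic (\<lambda>x. frechet_derivative u (at x) v)"
    by (rule periodic_comp[OF periodic_frechet_derivative[OF assms(1)], where h = "\<lambda>D. D v"])
  have contd: "continuous_on UNIV (\<lambda>x. frechet_derivative u (at x) v)"
    using C_k_frechet_derivative[OF u] C_k_continuous by blast
  have "(\<lambda>n. \<integral>X. ?q n (rep_torus X) \<partial>torus_measure)
      \<longlonglongrightarrow> (\<integral>X. frechet_derivative u (at (rep_torus X)) v \<partial>torus_measure)"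
  proof (rule integral_dominated_convergence)
    show "(\<lambda>X. frechet_derivative u (at (rep_torus X)) v) \<in> borel_measurable torus_measure"
      using borel_measurable_rep_torus[OF perd contd] by simp
    show "(\<lambda>X. ?q n (rep_torus X)) \<in> borel_measurable torus_measure" for n
      using borel_measurable_rep_torus[OF perq contq] by simp
    show "integrable torus_measure (\<lambda>X. L * norm v)" by simp
    show "AE X in torus_measure. (\<lambda>n. ?q n (rep_torus X)) \<longlonglongrightarrow> frechet_derivative u (at (rep_torus X)) v"
    proof (rule AE_I2)
      fix X
      have "((\<lambda>t. u (rep_torus X + t *\<^sub>R v)) has_field_derivative
          frechet_derivative u (at (rep_torus X)) v) (at 0)"
        by (rule line_derivative[OF u])
      then have "((\<lambda>t. (u (rep_torus X + t *\<^sub>R v) - u (rep_torus X)) / t)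
          \<longlongrightarrow> frechet_derivative u (at (rep_torus X)) v) (at 0)"
        by (simp add: has_field_derivative_iff)
      moreover have "filterlim ?h (at 0) sequentially"
        using LIMSEQ_inverse_real_of_nat by (simp add: filterlim_at)
      ultimately show "(\<lambda>n. ?q n (rep_torus X)) \<longlonglongrightarrow> frechet_derivative u (at (rep_torus X)) v"
        by (rule filterlim_compose)
    qed
    show "AE X in torus_measure. norm (?q n (rep_torus X)) \<le> L * norm v" for n
    proof (rule AE_I2)
      fix X
      have "norm (u (rep_torus X + ?h n *\<^sub>R v) - u (rep_torus X)) \<le> L * norm (?h n *\<^sub>R v)"
        using L[of "rep_torus X + ?h n *\<^sub>R v" "rep_torus X"] by simp
      also have "\<dots> = (L * norm v) * ?h n"
        by simp
      finally have "norm (u (rep_torus X + ?h n *\<^sub>R v) - u (rep_torus X)) / ?h n \<le> L * norm v"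
        by (subst pos_divide_le_eq) auto
      then show "norm (?q n (rep_torus X)) \<le> L * norm v"
        by (simp only: norm_divide) simp
    qed
  qed
  moreover have "(\<integral>X. ?q n (rep_torus X) \<partial>torus_measure) = 0" for n
  proof -
    have "integrable torus_measure (\<lambda>X. u (rep_torus X + ?h n *\<^sub>R v))"
    proof (rule integrable_torus_continuous[where f = "\<lambda>x. u (x + ?h n *\<^sub>R v)"])
      show "continuous_on UNIV (\<lambda>x. u (x + ?h n *\<^sub>R v))"
        by (rule continuous_on_compose2[OF cont]) (auto intro: continuous_intros)
    qed (simp_all add: periodic_translate[OF assms(1)] torus.finite_measure_axioms)
    moreover have "integrable torus_measure (\<lambda>X. u (rep_torus X))"
      by (rule integrable_torus_continuous[OF assms(1) cont torus.finite_measure_axioms]) simp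
    ultimately show ?thesis
      using integral_torus_translate[OF assms(1) cont, of "?h n *\<^sub>R v"] by simp
  qed
  ultimately show ?thesis
    by (simp add: LIMSEQ_const_iff)
qed

section \<open>Lipschitz functions determine a measure on the torus\<close>

lemma infdist_lattice:
  fixes C :: "(real^2) set"
  assumes C: "\<And>x y. x \<in> C \<Longrightarrow> lattice_rel x y \<Longrightarrow> y \<in> C"
  shows "periodic (\<lambda>x. infdist x C)"
proof (cases "C = {}")
  case False
  have le: "infdist y C \<le> infdist x C" if "lattice_rel x y" for x y
    unfolding infdist_notempty[OF False, of x]
  proof (rule cINF_greatest[OF False])
    fix a assume "a \<in> C"
    then have "a + (y - x) \<in> C"
      by (rule C) (use that in \<open>auto simp: lattice_rel_def\<close>)
    then have "infdist y C \<le> dist y (a + (y - x))" by (rule infdist_le)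
    then show "infdist y C \<le> dist x a" by (simp add: dist_norm algebra_simps)
  qed
  show ?thesis
    unfolding periodic_def
  proof (intro allI impI)
    fix x y :: "real^2" assume "lattice_rel x y"
    then show "infdist x C = infdist y C"
      using le[of x y] le[of y x] lattice_rel_sym[of x y] by simp
  qed
qed (simp add: infdist_def)

lemma infdist_lipschitz: "\<bar>infdist x C - infdist y C\<bar> \<le> dist x y"
  using infdist_triangle[of x C y] infdist_triangle[of y C x] by (simp add: dist_commute abs_le_iff)

text \<open>Truncated multiples of the distance to the complement increase to the indicator of an
  open set, and open sets form an intersection-stable generator. The distance is taken between lifts
  in the plane, since \<open>torus\<close> carries only a topology.\<close>

lemma torus_measure_eqI_lipschitz:
  assumes fin: "finite_measure M" "finite_measure N"
    and sets: "sets M = sets borel" "sets N = sets borel"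
    and eq: "\<And>(f::real^2 \<Rightarrow> real) K. periodic f \<Longrightarrow> (\<And>x y. \<bar>f x - f y\<bar> \<le> K * norm (x - y)) \<Longrightarrow>
       (\<integral>X. f (rep_torus X) \<partial>M) = (\<integral>X. f (rep_torus X) \<partial>N)"
  shows "M = N"
proof (rule measure_eqI_generator_eq[where E = "{U. open U}" and \<Omega> = UNIV and A = "\<lambda>_. UNIV"])
  interpret M: finite_measure M by fact
  interpret N: finite_measure N by fact
  have sp [simp]: "space M = UNIV" "space N = UNIV"
    using sets_eq_imp_space_eq[OF sets(1)] sets_eq_imp_space_eq[OF sets(2)] by auto
  note sets [measurable_cong]
  show "Int_stable {U::torus set. open U}" by (auto simp: Int_stable_def)
  show "sets M = sigma_sets UNIV {U. open U}" "sets N = sigma_sets UNIV {U. open U}"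
    using sets by (auto simp: borel_def)
  fix U :: "torus set" assume "U \<in> {U. open U}"
  then have "open U" by simp
  have "measure M U = measure N U"
  proof (cases "U = UNIV")
    \<comment> \<open>Here the complement is empty and \<open>infdist\<close> to the empty set is 0
      by convention, so the approximants used below would vanish; the constant function 1 takes
      their place.\<close>
    case True
    then show ?thesis using eq[of "\<lambda>_. 1" 0] by simp
  next
    case False
    define C where "C = abs_torus -` (- U)"
    have "C \<noteq> {}" using False by (metis C_def Compl_eq_Diff_UNIV Diff_eq_empty_iff UNIV_eq_I abs_rep_torus empty_iff vimage_eq ComplI)
    have "closed C"
      using \<open>open U\<close> by (simp add: C_def closed_def open_torus_def vimage_Compl)
    have inC: "infdist (rep_torus X) C = 0 \<longleftrightarrow> X \<notin> U" for X
      using in_closed_iff_infdist_zero[OF \<open>closed C\<close> \<open>C \<noteq> {}\<close>, of "rep_torus X"]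
      by (auto simp: C_def)
    define f where "f n x = min 1 (real n * infdist x C)" for n and x :: "real^2"
    have per: "periodic (f n)" for n
      unfolding f_def by (rule periodic_comp[OF infdist_lattice]) (auto simp: C_def simp flip: abs_torus_eq_iff)
    have lip: "\<bar>f n x - f n y\<bar> \<le> real n * norm (x - y)" for n x y
    proof -
      have "\<bar>f n x - f n y\<bar> \<le> \<bar>real n * infdist x C - real n * infdist y C\<bar>"
        unfolding f_def by (simp only: min_def split: if_split) linarith
      also have "\<dots> = real n * \<bar>infdist x C - infdist y C\<bar>"
        by (simp add: abs_mult flip: right_diff_distrib)
      also have "\<dots> \<le> real n * norm (x - y)"
        using infdist_lipschitz[of x C y] by (intro mult_left_mono) (auto simp: dist_norm)
      finally show ?thesis .
    qed
    have cont: "continuous_on UNIV (f n)" for n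
      unfolding f_def by (intro continuous_intros)
    have lim: "(\<lambda>n. f n (rep_torus X)) \<longlonglongrightarrow> indicator U X" for X
    proof (cases "X \<in> U")
      case True
      then have pos: "infdist (rep_torus X) C > 0"
        using inC[of X] infdist_nonneg[of "rep_torus X" C] by linarith
      then obtain n0 where n0: "1 < real n0 * infdist (rep_torus X) C"
        using ex_less_of_nat_mult by blast
      have "f n (rep_torus X) = 1" if "n \<ge> n0" for n
      proof -
        have "real n0 * infdist (rep_torus X) C \<le> real n * infdist (rep_torus X) C"
          using that pos by (intro mult_right_mono) auto
        then show ?thesis using n0 by (simp add: f_def)
      qed
      then have "\<forall>\<^sub>F n in sequentially. f n (rep_torus X) = 1"
        using eventually_sequentially by blast
      then show ?thesis using True by (simp add: tendsto_eventually)
    next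
      case False
      then show ?thesis using inC[of X] by (simp add: f_def)
    qed
    have meas: "(\<lambda>X. f n (rep_torus X)) \<in> borel_measurable borel" for n
      by (rule borel_measurable_rep_torus[OF per cont])
    have [measurable]: "U \<in> sets borel" using \<open>open U\<close> by simp
    have bnd: "norm (f n (rep_torus X)) \<le> 1" for n X
      by (simp add: f_def infdist_nonneg)
    have "(\<lambda>n. \<integral>X. f n (rep_torus X) \<partial>M) \<longlonglongrightarrow> (\<integral>X. indicator U X \<partial>M)"
      by (rule integral_dominated_convergence[where w = "\<lambda>_. 1"])
        (use meas lim bnd in \<open>auto cong: measurable_cong_sets\<close>)
    moreover have "(\<lambda>n. \<integral>X. f n (rep_torus X) \<partial>N) \<longlonglongrightarrow> (\<integral>X. indicator U X \<partial>N)"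
      by (rule integral_dominated_convergence[where w = "\<lambda>_. 1"])
        (use meas lim bnd in \<open>auto cong: measurable_cong_sets\<close>)
    ultimately have "(\<integral>X. indicator U X \<partial>M) = (\<integral>X. (indicator U X :: real) \<partial>N)"
      using eq[OF per lip] LIMSEQ_unique by simp
    then show ?thesis by simp
  qed
  then show "emeasure M U = emeasure N U"
    by (simp add: M.emeasure_eq_measure N.emeasure_eq_measure)
next
  interpret M: finite_measure M by fact
  show "emeasure M ((\<lambda>_. UNIV) i) \<noteq> \<infinity>" for i :: nat by simp
qed auto

section \<open>Mollification by trigonometric kernels\<close>

lemma trig_int_periodic:
  fixes a b :: real
  assumes "a - b \<in> \<int>"
  shows "cos (2 * pi * a) = cos (2 * pi * b)" "sin (2 * pi * a) = sin (2 * pi * b)"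
    "\<bar>sin (pi * a)\<bar> = \<bar>sin (pi * b)\<bar>"
proof -
  obtain n where n: "a = b + of_int n"
    using assms by (metis Ints_cases add.commute diff_add_cancel)
  have "2 * pi * a = 2 * pi * b + 2 * pi * of_int n" and 2: "pi * a = pi * b + pi * of_int n"
    by (simp_all add: n algebra_simps)
  from this(1) show "cos (2 * pi * a) = cos (2 * pi * b)" "sin (2 * pi * a) = sin (2 * pi * b)"
    by (simp_all only: cos_add sin_add cos_int_2pin sin_int_2pin)
  have "\<bar>cos (pi * of_int n :: real)\<bar> = 1" by simp
  then show "\<bar>sin (pi * a)\<bar> = \<bar>sin (pi * b)\<bar>"
    unfolding 2 by (simp only: sin_add sin_npi_int abs_mult) simp
qed

text \<open>The range splits at 1 / 3. Up to there cos (pi s) is at least cos (pi / 3) = 1 / 2, so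
  sin (pi s) grows at rate at least pi / 2; beyond it the sine is at least sin (pi / 6) = 1 / 2,
  which already dominates s.\<close>

lemma abs_le_abs_sin_pi:
  assumes "\<bar>t\<bar> \<le> 1 / 2"
  shows "\<bar>t\<bar> \<le> \<bar>sin (pi * t)\<bar>"
proof -
  have *: "s \<le> sin (pi * s)" if "0 \<le> s" "s \<le> 1 / 2" for s :: real
  proof (cases "s \<le> 1 / 3")
    case True
    have "pi * 0 / 2 \<le> sin (pi * 0) \<and> pi * s / 2 - sin (pi * s) \<le> pi * 0 / 2 - sin (pi * 0)"
    proof (rule conjI, simp, rule DERIV_nonpos_imp_nonincreasing[OF that(1)])
      fix x assume x: "0 \<le> x" "x \<le> s"
      have "cos (pi / 3) \<le> cos (pi * x)"
        using x True by (intro cos_monotone_0_pi_le) (auto simp: field_simps)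
      then have "pi / 2 - pi * cos (pi * x) \<le> 0"
        by (simp add: cos_60)
      moreover have "((\<lambda>x. pi * x / 2 - sin (pi * x)) has_real_derivative (pi / 2 - pi * cos (pi * x))) (at x)"
        by (auto intro!: derivative_eq_intros)
      ultimately show "\<exists>y. ((\<lambda>x. pi * x / 2 - sin (pi * x)) has_real_derivative y) (at x) \<and> y \<le> 0"
        by blast
    qed
    then have "pi * s / 2 \<le> sin (pi * s)" by simp
    moreover have "2 * s \<le> pi * s" using pi_ge_two that by (intro mult_right_mono) auto
    ultimately show ?thesis by simp
  next
    case False
    have "sin (pi / 6) \<le> sin (pi * s)"
      using that False by (intro sin_monotone_2pi_le) (auto simp: field_simps)
    then show ?thesis using that by (simp add: sin_30)
  qed
  show ?thesis
    using *[of t] *[of "- t"] assms by (cases "t \<ge> 0") auto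
qed

text \<open>A modulus of continuity on the torus that is adapted to the trigonometric kernel below.\<close>

definition sin_modulus :: "real^2 \<Rightarrow> real" where
  "sin_modulus y = (\<Sum>i\<in>UNIV. \<bar>sin (pi * y $ i)\<bar>)"

text \<open>Rounding the coordinates of \<open>y\<close> leaves a lattice-equivalent shift with
  entries of size at most 1 / 2, where |r| is at most |sin (pi r)|. The sines do not change under
  rounding.\<close>

lemma periodic_lipschitz_sin_modulus:
  fixes f :: "real^2 \<Rightarrow> 'b::real_normed_vector"
  assumes "periodic f" "L \<ge> 0" "\<And>x y. norm (f x - f y) \<le> L * norm (x - y)"
  shows "norm (f (x + y) - f x) \<le> L * sin_modulus y"
proof -
  define r where "r = (\<chi> i. y $ i - of_int (round (y $ i)))"
  have r: "y $ i - r $ i \<in> \<int>" for i by (simp add: r_def)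
  have "f (x + y) = f (x + r)"
    by (rule periodicD[OF assms(1)]) (simp add: lattice_rel_def r)
  then have "norm (f (x + y) - f x) \<le> L * norm r"
    using assms(3)[of "x + r" x] by simp
  also have "norm r \<le> (\<Sum>i\<in>UNIV. \<bar>r $ i\<bar>)"
    by (rule norm_le_l1_cart)
  also have "\<dots> \<le> sin_modulus y"
    unfolding sin_modulus_def
  proof (rule sum_mono)
    fix i
    have "\<bar>r $ i\<bar> \<le> 1 / 2"
      using of_int_round_abs_le[of "y $ i"] by (simp add: r_def abs_minus_commute)
    then have "\<bar>r $ i\<bar> \<le> \<bar>sin (pi * r $ i)\<bar>"
      by (rule abs_le_abs_sin_pi)
    also have "\<dots> = \<bar>sin (pi * y $ i)\<bar>"
      by (rule trig_int_periodic(3)[OF r, symmetric])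
    finally show "\<bar>r $ i\<bar> \<le> \<bar>sin (pi * y $ i)\<bar>" .
  qed
  finally show ?thesis using assms(2) by (simp add: mult_left_mono)
qed

lemma periodic_sin_modulus: "periodic sin_modulus"
  unfolding periodic_def sin_modulus_def lattice_rel_def
  by (intro allI impI sum.cong refl trig_int_periodic(3)) blast

lemma continuous_sin_modulus: "continuous_on UNIV sin_modulus"
  unfolding sin_modulus_def by (intro continuous_intros)

lemma integral_torus_pos:
  fixes f :: "real^2 \<Rightarrow> real"
  assumes per: "periodic f" and cont: "continuous_on UNIV f" and nn: "\<And>x. 0 \<le> f x" and pos: "f x0 > 0"
  shows "0 < (\<integral>X. f (rep_torus X) \<partial>torus_measure)"
proof -
  \<comment> \<open>Moving \<open>x0\<close> to the centre of the cell ensures that the open set of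
    positivity meets the open box inside the half-open cell; a representative of \<open>x0\<close>
    itself could lie on the boundary.\<close>
  define c :: "real^2" where "c = (\<chi> i. 1 / 2)"
  define g where "g x = f (x + (x0 - c))" for x
  have perg: "periodic g" unfolding g_def by (rule periodic_translate[OF per])
  have contg: "continuous_on UNIV g"
    unfolding g_def by (rule continuous_on_compose2[OF cont]) (auto intro: continuous_intros)
  have eq: "(\<integral>X. f (rep_torus X) \<partial>torus_measure) = (\<integral>X. g (rep_torus X) \<partial>torus_measure)"
    unfolding g_def by (rule integral_torus_translate[OF per cont, symmetric])
  have int: "integrable torus_measure (\<lambda>X. g (rep_torus X))"
    by (rule integrable_torus_continuous[OF perg contg torus.finite_measure_axioms]) simp
  have "\<not> (AE X in torus_measure. g (rep_torus X) = 0)"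
  proof
    assume "AE X in torus_measure. g (rep_torus X) = 0"
    then have "AE x in restrict_space lborel unit_cell. g (rep_torus (abs_torus x)) = 0"
      unfolding torus_measure_alt by (rule AE_distrD[OF measurable_abs_torus_cell])
    then have "AE x in lborel. x \<in> unit_cell \<longrightarrow> g x = 0"
      unfolding periodic_rep[OF perg] by (subst (asm) AE_restrict_space_iff) auto
    moreover define U where "U = {x. 0 < g x} \<inter> box 0 1"
    have "open U"
      unfolding U_def by (intro open_Int open_Collect_less contg continuous_on_const open_box)
    have "box 0 1 \<subseteq> unit_cell"
      by (auto simp: unit_cell_def mem_box_cart less_imp_le)
    ultimately have "AE x in lborel. x \<notin> U"
      by (auto simp: U_def elim!: eventually_mono)
    then have "U \<in> null_sets lborel"
      using \<open>open U\<close> by (subst AE_iff_null_sets) auto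
    then have "negligible U"
      by (simp add: negligible_iff_null_sets null_sets_completionI)
    then have "U = {}"
      using \<open>open U\<close> open_not_negligible by blast
    moreover have "c \<in> U"
      using pos by (simp add: U_def g_def c_def mem_box_cart)
    ultimately show False by blast
  qed
  then have "(\<integral>X. g (rep_torus X) \<partial>torus_measure) \<noteq> 0"
    using integral_nonneg_eq_0_iff_AE[OF int] nn by (simp add: g_def)
  moreover have "(\<integral>X. g (rep_torus X) \<partial>torus_measure) \<ge> 0"
    using nn by (intro integral_nonneg_AE) (simp add: g_def)
  ultimately show ?thesis by (simp add: eq)
qed

text \<open>By the half-angle formula this is the product of the squares of cos (pi y_i), so its
  powers are unnormalised de la Vallee Poussin kernels: nonnegative trigonometric polynomials that
  concentrate at the lattice points.\<close>

definition trig_kernel :: "real^2 \<Rightarrow> real" where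
  "trig_kernel y = ((1 + cos (2 * pi * y $ 1)) / 2) * ((1 + cos (2 * pi * y $ 2)) / 2)"

lemma trig_kernel_nonneg: "0 \<le> trig_kernel y"
proof -
  have "0 \<le> 1 + cos t" for t :: real using cos_ge_minus_one[of t] by linarith
  then show ?thesis unfolding trig_kernel_def by simp
qed

lemma periodic_trig:
  "periodic (\<lambda>x. cos (2 * pi * x $ i))" "periodic (\<lambda>x. sin (2 * pi * x $ i))"
  unfolding periodic_def lattice_rel_def using trig_int_periodic(1,2) by blast+

lemma periodic_trig_kernel: "periodic (\<lambda>y. trig_kernel y ^ n)"
  unfolding periodic_def lattice_rel_def trig_kernel_def using trig_int_periodic(1) by metis

lemma C_k_power:
  fixes f :: "real^2 \<Rightarrow> real"
  assumes "C_k k f"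
  shows "C_k k (\<lambda>x. f x ^ n)"
  by (induction n) (auto intro: C_k_const C_k_mult assms)

lemma C_k_trig_kernel: "C_k k (\<lambda>y. trig_kernel y ^ n)"
proof -
  have "C_k k (\<lambda>y. ((1 / 2) * (1 + cos (2 * pi * y $ 1))) * ((1 / 2) * (1 + cos (2 * pi * y $ 2))))"
    by (intro C_k_mult C_k_add C_k_const C_k_cos_sin)
  then show ?thesis
    unfolding trig_kernel_def by (intro C_k_power) simp
qed

lemma continuous_trig_kernel: "continuous_on UNIV (\<lambda>y. trig_kernel y ^ n)"
  by (rule C_k_continuous[OF C_k_trig_kernel])

definition kernel_mass :: "nat \<Rightarrow> real" where
  "kernel_mass n = (\<integral>X. trig_kernel (rep_torus X) ^ n \<partial>torus_measure)"

lemma kernel_mass_pos: "0 < kernel_mass n"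
  unfolding kernel_mass_def
  by (rule integral_torus_pos[OF periodic_trig_kernel continuous_trig_kernel, where ?x0.0 = 0])
    (intro zero_le_power trig_kernel_nonneg, simp add: trig_kernel_def)

text \<open>The prefactor sin (2 pi y_i) is chosen so that its derivative against the kernel is
  again the kernel times an affine function of sin^2 (pi y_i): writing c for the cosine, the squared
  sine is (1 - c) (1 + c), and the factor 1 + c restores the power of the kernel lost by
  differentiation.\<close>

lemma trig_kernel_derivative:
  "frechet_derivative (\<lambda>y. sin (2 * pi * y $ i) * trig_kernel y ^ Suc n) (at x) (axis i 1)
     = 2 * pi * (trig_kernel x ^ Suc n * (1 - (2 * real (Suc n) + 2) * (sin (pi * x $ i))\<^sup>2))"
proof (rule frechet_derivative_eqI[where k = 0])
  show "C_k (Suc 0) (\<lambda>y. sin (2 * pi * y $ i) * trig_kernel y ^ Suc n)"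
    by (intro C_k_mult C_k_cos_sin C_k_trig_kernel)
  define A where "A t = (1 + cos (2 * pi * t)) / 2" for t
  define R where "R = (if i = 1 then A (x $ 2) else A (x $ 1))"
  have kern: "trig_kernel (x + t *\<^sub>R axis i 1) = A (x $ i + t) * R" for t
    using exhaust_2[of i] by (auto simp: trig_kernel_def A_def R_def axis_def)
  have k0: "trig_kernel x = A (x $ i) * R"
    using kern[of 0] by simp
  define c s where "c = cos (2 * pi * x $ i)" and "s = sin (2 * pi * x $ i)"
  have A0: "A (x $ i) = (1 + c) / 2" by (simp add: A_def c_def)
  have cs: "s\<^sup>2 = (1 - c) * (1 + c)"
    using sin_cos_squared_add[of "2 * pi * x $ i"] by (simp add: c_def s_def power2_eq_square algebra_simps)
  have half: "(sin (pi * x $ i))\<^sup>2 = (1 - c) / 2"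
    using cos_double_sin[of "pi * x $ i"] by (simp add: c_def mult.assoc)
  have D: "((\<lambda>t. sin (2 * pi * (x $ i + t)) * (A (x $ i + t) * R) ^ Suc n) has_real_derivative
      2 * pi * c * (A (x $ i) * R) ^ Suc n
        + s * (real (Suc n) * (A (x $ i) * R) ^ n * (- pi * s * R))) (at 0)"
  proof -
    have "((\<lambda>t. A (x $ i + t) * R) has_real_derivative (- pi * s * R)) (at 0)"
      unfolding A_def s_def by (auto intro!: derivative_eq_intros)
    from DERIV_power[OF this, of "Suc n"]
    have P: "((\<lambda>t. (A (x $ i + t) * R) ^ Suc n) has_real_derivative
        real (Suc n) * (A (x $ i) * R) ^ n * (- pi * s * R)) (at 0)"
      by (simp add: mult_ac)
    have Q: "((\<lambda>t. sin (2 * pi * (x $ i + t))) has_real_derivative 2 * pi * c) (at 0)"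
      unfolding c_def by (auto intro!: derivative_eq_intros)
    from DERIV_mult[OF Q P] show ?thesis
      by (rule DERIV_cong) (simp add: s_def)
  qed
  have "2 * pi * c * (A (x $ i) * R) ^ Suc n + s * (real (Suc n) * (A (x $ i) * R) ^ n * (- pi * s * R))
      = 2 * pi * c * (A (x $ i) * R) ^ Suc n - pi * real (Suc n) * (A (x $ i) * R) ^ n * R * s\<^sup>2"
    by (simp add: power2_eq_square algebra_simps)
  also have "\<dots> = 2 * pi * (trig_kernel x ^ Suc n * (1 - (2 * real (Suc n) + 2) * (sin (pi * x $ i))\<^sup>2))"
    unfolding cs half k0 A0 by (simp add: field_simps del: of_nat_Suc)
  finally have E: "2 * pi * c * (A (x $ i) * R) ^ Suc n + s * (real (Suc n) * (A (x $ i) * R) ^ n * (- pi * s * R))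
      = 2 * pi * (trig_kernel x ^ Suc n * (1 - (2 * real (Suc n) + 2) * (sin (pi * x $ i))\<^sup>2))" .
  have xi: "(x + t *\<^sub>R axis i 1) $ i = x $ i + t" for t by (simp add: axis_def)
  show "((\<lambda>t. sin (2 * pi * (x + t *\<^sub>R axis i 1) $ i) * trig_kernel (x + t *\<^sub>R axis i 1) ^ Suc n)
      has_real_derivative 2 * pi * (trig_kernel x ^ Suc n * (1 - (2 * real (Suc n) + 2) * (sin (pi * x $ i))\<^sup>2))) (at 0)"
    using D unfolding kern xi E .
qed

text \<open>The derivative just computed integrates to zero, which can be solved for the second
  moment. Relative to the mass it decays like the reciprocal of the exponent.\<close>

lemma integral_kernel_sin2:
  "(\<integral>X. trig_kernel (rep_torus X) ^ Suc n * (sin (pi * rep_torus X $ i))\<^sup>2 \<partial>torus_measure)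
     = kernel_mass (Suc n) / (2 * real (Suc n) + 2)"
proof -
  let ?N = "2 * real (Suc n) + 2"
  let ?S = "\<lambda>y. trig_kernel y ^ Suc n * (sin (pi * y $ i))\<^sup>2"
  have "periodic (\<lambda>y. sin (2 * pi * y $ i) * trig_kernel y ^ Suc n)"
    by (rule periodic_comp2[OF periodic_trig(2) periodic_trig_kernel])
  from integral_derivative_zero[OF this, of "axis i 1"]
  have "(\<integral>X. frechet_derivative (\<lambda>y. sin (2 * pi * y $ i) * trig_kernel y ^ Suc n) (at (rep_torus X)) (axis i 1)
      \<partial>torus_measure) = 0"
    by (simp only: C_k_mult C_k_cos_sin C_k_trig_kernel simp_thms)
  then have "(\<integral>X. trig_kernel (rep_torus X) ^ Suc n - ?N * ?S (rep_torus X) \<partial>torus_measure) = 0"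
    unfolding trig_kernel_derivative integral_mult_right_zero
    by (simp add: right_diff_distrib mult_ac del: power_Suc of_nat_Suc)
  moreover have "periodic ?S"
  proof (rule periodic_comp2[OF periodic_trig_kernel, where h = "(*)"])
    have "periodic (\<lambda>y. \<bar>sin (pi * y $ i)\<bar>)"
      unfolding periodic_def lattice_rel_def using trig_int_periodic(3) by blast
    from periodic_comp[OF this, of "\<lambda>a. a\<^sup>2"] show "periodic (\<lambda>y. (sin (pi * y $ i))\<^sup>2)" by simp
  qed
  then have "integrable torus_measure (\<lambda>X. ?S (rep_torus X))"
    by (intro integrable_torus_continuous torus.finite_measure_axioms continuous_intros continuous_trig_kernel) simp_all
  moreover have "integrable torus_measure (\<lambda>X. trig_kernel (rep_torus X) ^ Suc n)"
    by (intro integrable_torus_continuous torus.finite_measure_axioms periodic_trig_kernel continuous_trig_kernel) simp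
  ultimately have "kernel_mass (Suc n) - ?N * (\<integral>X. ?S (rep_torus X) \<partial>torus_measure) = 0"
    unfolding kernel_mass_def by simp
  then show ?thesis
    by (simp add: field_simps del: of_nat_Suc)
qed

text \<open>Integration by parts controls the second moment of \<open>sin\<close>, and AM-GM passes from the second moment to the first.\<close>

lemma kernel_concentrates:
  assumes "\<epsilon> > 0"
  obtains n where "(\<integral>X. trig_kernel (rep_torus X) ^ Suc n * sin_modulus (rep_torus X) \<partial>torus_measure)
      \<le> \<epsilon> * kernel_mass (Suc n)"
proof -
  \<comment> \<open>With AM-GM weight \<open>a\<close> the two coordinates together contribute a /
    (2 N + 2) + 1 / a times the mass, where N is \<open>Suc n\<close>. The choice n > a * a bounds
    this by 2 / a, which is \<epsilon>.\<close>
  define a where "a = 2 / \<epsilon>"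
  have "a > 0" using assms by (simp add: a_def)
  obtain n where n: "a * a < real n" using reals_Archimedean2 by blast
  let ?K = "\<lambda>X. trig_kernel (rep_torus X) ^ Suc n"
  let ?S = "\<lambda>i X. (sin (pi * rep_torus X $ i))\<^sup>2"
  have intK: "integrable torus_measure ?K"
    by (intro integrable_torus_continuous torus.finite_measure_axioms periodic_trig_kernel continuous_trig_kernel) simp
  have intS: "integrable torus_measure (\<lambda>X. ?K X * ?S i X)" for i
  proof (rule integrable_torus_continuous[OF _ _ torus.finite_measure_axioms sets_torus_measure])
    have "periodic (\<lambda>y. \<bar>sin (pi * y $ i)\<bar>)"
      unfolding periodic_def lattice_rel_def using trig_int_periodic(3) by blast
    from periodic_comp[OF this, of "\<lambda>a. a\<^sup>2"] have "periodic (\<lambda>y. (sin (pi * y $ i))\<^sup>2)" by simp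
    then show "periodic (\<lambda>y. trig_kernel y ^ Suc n * (sin (pi * y $ i))\<^sup>2)"
      by (rule periodic_comp2[OF periodic_trig_kernel, where h = "(*)"])
  qed (intro continuous_intros continuous_trig_kernel)
  have "integrable torus_measure (\<lambda>X. ?K X * sin_modulus (rep_torus X))"
    by (intro integrable_torus_continuous[OF _ _ torus.finite_measure_axioms sets_torus_measure]
        periodic_comp2[OF periodic_trig_kernel periodic_sin_modulus, where h = "(*)"]
        continuous_intros continuous_trig_kernel continuous_sin_modulus)
  then have "(\<integral>X. ?K X * sin_modulus (rep_torus X) \<partial>torus_measure)
      \<le> (\<integral>X. (\<Sum>i\<in>UNIV. (a / 2) * (?K X * ?S i X) + (1 / (2 * a)) * ?K X) \<partial>torus_measure)"
  proof (rule integral_mono)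
    fix X
    have amgm: "\<bar>s\<bar> \<le> a / 2 * s\<^sup>2 + 1 / (2 * a)" for s
    proof -
      have "0 \<le> (a * \<bar>s\<bar> - 1)\<^sup>2 / (2 * a)" using \<open>a > 0\<close> by simp
      also have "\<dots> = a / 2 * s\<^sup>2 + 1 / (2 * a) - \<bar>s\<bar>"
        using \<open>a > 0\<close> by (simp add: power2_diff power_mult_distrib field_simps power2_eq_square)
      finally show ?thesis by simp
    qed
    show "?K X * sin_modulus (rep_torus X) \<le> (\<Sum>i\<in>UNIV. (a / 2) * (?K X * ?S i X) + (1 / (2 * a)) * ?K X)"
      unfolding sin_modulus_def sum_distrib_left
    proof (rule sum_mono)
      fix i
      have "?K X * \<bar>sin (pi * rep_torus X $ i)\<bar> \<le> ?K X * (a / 2 * ?S i X + 1 / (2 * a))"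
        by (intro mult_left_mono amgm zero_le_power trig_kernel_nonneg)
      then show "?K X * \<bar>sin (pi * rep_torus X $ i)\<bar> \<le> (a / 2) * (?K X * ?S i X) + (1 / (2 * a)) * ?K X"
        by (simp only: distrib_left mult_ac)
    qed
  qed (intro Bochner_Integration.integrable_sum Bochner_Integration.integrable_add integrable_mult_right intS intK)
  also have "\<dots> = (\<Sum>i\<in>(UNIV::2 set). (a / 2) * (\<integral>X. ?K X * ?S i X \<partial>torus_measure)
      + (1 / (2 * a)) * (\<integral>X. ?K X \<partial>torus_measure))"
    by (simp add: intS intK del: power_Suc)
  also have "\<dots> = 2 * ((a / 2) * (kernel_mass (Suc n) / (2 * real (Suc n) + 2)) + (1 / (2 * a)) * kernel_mass (Suc n))"
    unfolding integral_kernel_sin2 kernel_mass_def[symmetric] by simp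
  also have "\<dots> = (a / (2 * real (Suc n) + 2) + 1 / a) * kernel_mass (Suc n)"
  proof -
    have "2 * ((a / 2) * (M / N) + (1 / (2 * a)) * M) = (a / N + 1 / a) * M" for M N
      by (simp add: algebra_simps)
    then show ?thesis .
  qed
  also have "\<dots> \<le> \<epsilon> * kernel_mass (Suc n)"
  proof (rule mult_right_mono[OF _ less_imp_le[OF kernel_mass_pos]])
    have "a / (2 * real (Suc n) + 2) \<le> 1 / a"
      using n \<open>a > 0\<close> by (simp add: field_simps)
    then have "a / (2 * real (Suc n) + 2) + 1 / a \<le> 2 / a" by simp
    then show "a / (2 * real (Suc n) + 2) + 1 / a \<le> \<epsilon>" using assms by (simp add: a_def)
  qed
  finally show thesis by (rule that)
qed

text \<open>Kernels of finite rank; convolution against them is visibly smooth.\<close>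

inductive separable :: "(real^2 \<Rightarrow> real^2 \<Rightarrow> real) \<Rightarrow> bool" where
  separable_prod: "(\<And>k. C_k k a) \<Longrightarrow> periodic b \<Longrightarrow> continuous_on UNIV b \<Longrightarrow> separable (\<lambda>x y. a x * b y)"
| separable_add: "separable F \<Longrightarrow> separable G \<Longrightarrow> separable (\<lambda>x y. F x y + G x y)"

lemma separable_cong: "separable F \<Longrightarrow> (\<And>x y. F x y = G x y) \<Longrightarrow> separable G"
  by (metis ext)

lemma separable_mult_prod:
  assumes "separable F" "\<And>k. C_k k a" "periodic b" "continuous_on UNIV b"
  shows "separable (\<lambda>x y. F x y * (a x * b y))"
  using assms(1)
proof induction
  case (separable_prod a' b')
  have "separable (\<lambda>x y. (a' x * a x) * (b' y * b y))"
    by (rule separable.separable_prod)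
      (intro C_k_mult separable_prod assms periodic_comp2[where h = "(*)"] continuous_intros)+
  then show ?case by (rule separable_cong) simp
next
  case (separable_add F G)
  show ?case
    by (rule separable_cong[OF separable.separable_add[OF separable_add.IH]]) (simp add: distrib_right)
qed

lemma separable_mult:
  assumes "separable F" "separable G"
  shows "separable (\<lambda>x y. F x y * G x y)"
  using assms(2)
proof induction
  case (separable_prod a b)
  then show ?case by (intro separable_mult_prod assms(1))
next
  case (separable_add G H)
  then show ?case
    by (intro separable_cong[OF separable.separable_add[OF separable_add.IH]]) (simp_all add: distrib_left)
qed

lemma separable_const: "separable (\<lambda>x y. c)"
proof -
  have "separable (\<lambda>x y. c * 1)"
    by (rule separable_prod) (simp_all add: C_k_const)
  then show ?thesis by simp
qed

text \<open>The addition formula splits the cosine of a difference; this is what a trigonometric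
  kernel offers over a compactly supported bump.\<close>

lemma separable_cos: "separable (\<lambda>x y. (1 + cos (2 * pi * (y - x) $ i)) / 2)"
proof -
  have "separable (\<lambda>x y. cos (2 * pi * x $ i) * cos (2 * pi * y $ i))"
    "separable (\<lambda>x y. sin (2 * pi * x $ i) * sin (2 * pi * y $ i))"
    by (intro separable_prod C_k_cos_sin periodic_trig continuous_intros)+
  from separable_mult[OF separable_const[of "1 / 2"] separable_add[OF separable_const[of 1] separable_add[OF this]]]
  show ?thesis
    by (rule separable_cong) (simp add: right_diff_distrib cos_diff mult_ac)
qed

lemma separable_trig_kernel: "separable (\<lambda>x y. trig_kernel (y - x) ^ n)"
proof (induction n)
  case (Suc n)
  have "separable (\<lambda>x y. trig_kernel (y - x))"
    unfolding trig_kernel_def by (intro separable_mult separable_cos)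
  from separable_mult[OF this Suc] show ?case by simp
qed (simp add: separable_const)

text \<open>Integrating out \<open>y\<close> leaves a finite sum of constants times smooth functions
  of \<open>x\<close>, so nothing is differentiated under the integral. Periodicity and continuity
  in \<open>y\<close> ride along in the induction because splitting the integral of a sum needs
  integrability of both terms.\<close>

lemma separable_integral_smooth:
  assumes "separable F" "periodic g" "continuous_on UNIV g"
  shows "periodic (F x) \<and> continuous_on UNIV (F x)
    \<and> C_k k (\<lambda>x. \<integral>X. F x (rep_torus X) * g (rep_torus X) \<partial>torus_measure)"
  using assms(1)
proof (induction arbitrary: x)
  case (separable_prod a b)
  have "periodic (\<lambda>y. b y * g y)" "continuous_on UNIV (\<lambda>y. b y * g y)"
    by (intro periodic_comp2[where h = "(*)"] continuous_intros separable_prod assms)+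
  have eq: "(\<integral>X. a x * b (rep_torus X) * g (rep_torus X) \<partial>torus_measure)
      = a x * (\<integral>X. b (rep_torus X) * g (rep_torus X) \<partial>torus_measure)" for x
    by (simp add: mult.assoc)
  show ?case
    unfolding eq
    by (intro conjI C_k_mult C_k_const separable_prod continuous_intros periodic_comp[OF separable_prod(2), where h = "(*) (a x)"])
next
  case (separable_add F G)
  have int: "integrable torus_measure (\<lambda>X. H (rep_torus X) * g (rep_torus X))"
    if "periodic H" "continuous_on UNIV H" for H
    by (rule integrable_torus_continuous[where f = "\<lambda>y. H y * g y", OF _ _ torus.finite_measure_axioms])
      (intro periodic_comp2[where h = "(*)"] continuous_intros assms that | simp)+
  have "integrable torus_measure (\<lambda>X. F x (rep_torus X) * g (rep_torus X))"
    "integrable torus_measure (\<lambda>X. G x (rep_torus X) * g (rep_torus X))" for x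
    by (intro int; use separable_add.IH in blast)+
  then have eq: "(\<integral>X. (F x (rep_torus X) + G x (rep_torus X)) * g (rep_torus X) \<partial>torus_measure)
    = (\<integral>X. F x (rep_torus X) * g (rep_torus X) \<partial>torus_measure)
      + (\<integral>X. G x (rep_torus X) * g (rep_torus X) \<partial>torus_measure)" for x
    by (simp add: distrib_right)
  show ?case
    unfolding eq using separable_add.IH
    by (auto intro!: C_k_add continuous_intros periodic_comp2[where h = "(+)"])
qed

section \<open>Smooth approximation of Lipschitz functions\<close>

definition mollify :: "nat \<Rightarrow> (real^2 \<Rightarrow> real) \<Rightarrow> real^2 \<Rightarrow> real" where
  "mollify n g x = (\<integral>X. trig_kernel (rep_torus X) ^ Suc n * g (x + rep_torus X) \<partial>torus_measure)
     / kernel_mass (Suc n)"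

text \<open>The definition puts the shift on \<open>g\<close>, which suits error estimates;
  translation invariance moves it to the kernel, where dependence on \<open>x\<close> is separable
  and hence smooth.\<close>

lemma mollify_alt:
  assumes "periodic g" "continuous_on UNIV g"
  shows "mollify n g x =
    (\<integral>X. trig_kernel (rep_torus X - x) ^ Suc n * g (rep_torus X) \<partial>torus_measure) / kernel_mass (Suc n)"
proof -
  let ?f = "\<lambda>y. trig_kernel (y - x) ^ Suc n * g y"
  have "periodic (\<lambda>y. trig_kernel (y - x) ^ Suc n)"
    using periodic_translate[OF periodic_trig_kernel[of "Suc n"], of "- x"] by simp
  then have "periodic ?f"
    using assms(1) by (rule periodic_comp2)
  moreover have "continuous_on UNIV ?f"
    by (intro continuous_intros assms continuous_on_compose2[OF continuous_trig_kernel, of _ "\<lambda>y. y - x"]) auto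
  ultimately have "(\<integral>X. ?f (rep_torus X + x) \<partial>torus_measure) = (\<integral>X. ?f (rep_torus X) \<partial>torus_measure)"
    by (rule integral_torus_translate)
  then show ?thesis by (simp add: mollify_def add.commute)
qed

lemma C_k_mollify:
  assumes "periodic g" "continuous_on UNIV g"
  shows "C_k k (mollify n g)"
proof -
  have "C_k k (\<lambda>x. (1 / kernel_mass (Suc n)) *
      (\<integral>X. trig_kernel (rep_torus X - x) ^ Suc n * g (rep_torus X) \<partial>torus_measure))"
    using separable_integral_smooth[OF separable_trig_kernel assms]
    by (intro C_k_mult C_k_const) blast
  then show ?thesis
    by (rule C_k_cong) (simp add: mollify_alt[OF assms])
qed

lemma periodic_mollify:
  assumes "periodic g"
  shows "periodic (mollify n g)"
  unfolding periodic_def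
proof (intro allI impI)
  fix x y :: "real^2" assume "lattice_rel x y"
  then have "g (x + z) = g (y + z)" for z
    by (intro periodicD[OF assms]) simp
  then show "mollify n g x = mollify n g y" by (simp add: mollify_def)
qed

lemma torus_smooth_rep:
  assumes "periodic f" "\<And>k. C_k k f"
  shows "torus_smooth (\<lambda>X. f (rep_torus X))" "(\<lambda>X. f (rep_torus X)) \<circ> abs_torus = f"
proof -
  show eq: "(\<lambda>X. f (rep_torus X)) \<circ> abs_torus = f"
    using periodic_rep[OF assms(1)] by (simp add: fun_eq_iff)
  show "torus_smooth (\<lambda>X. f (rep_torus X))"
    unfolding torus_smooth_def eq using assms(2) by blast
qed

text \<open>The mean of \<open>sin_modulus\<close> under the normalised kernel, which is the rate at
  which functions with Lipschitz constant 1 are approximated.\<close>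

definition kernel_spread :: "nat \<Rightarrow> real" where
  "kernel_spread n = (\<integral>X. trig_kernel (rep_torus X) ^ Suc n * sin_modulus (rep_torus X) \<partial>torus_measure)
     / kernel_mass (Suc n)"

lemma kernel_spread_small:
  assumes "\<epsilon> > 0"
  obtains n where "kernel_spread n \<le> \<epsilon>"
proof -
  obtain n where "(\<integral>X. trig_kernel (rep_torus X) ^ Suc n * sin_modulus (rep_torus X) \<partial>torus_measure)
      \<le> \<epsilon> * kernel_mass (Suc n)"
    using kernel_concentrates[OF assms] by blast
  then have "kernel_spread n \<le> \<epsilon>"
    using kernel_mass_pos[of "Suc n"] by (simp add: kernel_spread_def divide_le_eq)
  then show thesis by (rule that)
qed

text \<open>The normalised kernel is a probability density, so a pointwise bound can simply be
  averaged. The term \<open>B\<close> carries errors independent of \<open>y\<close>, such as the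
  remainder of a difference quotient.\<close>

lemma kernel_average_bound:
  assumes "periodic F" "continuous_on UNIV F" "\<And>y. \<bar>F y - c\<bar> \<le> L * sin_modulus y + B"
  shows "\<bar>(\<integral>X. trig_kernel (rep_torus X) ^ Suc n * F (rep_torus X) \<partial>torus_measure) / kernel_mass (Suc n) - c\<bar>
     \<le> L * kernel_spread n + B"
proof -
  let ?K = "\<lambda>X. trig_kernel (rep_torus X) ^ Suc n" and ?Z = "kernel_mass (Suc n)"
  have Z: "?Z > 0" by (rule kernel_mass_pos)
  have intK: "integrable torus_measure ?K"
    by (intro integrable_torus_continuous torus.finite_measure_axioms periodic_trig_kernel continuous_trig_kernel) simp
  have intF: "integrable torus_measure (\<lambda>X. ?K X * F (rep_torus X))"
    by (intro integrable_torus_continuous[where f = "\<lambda>y. trig_kernel y ^ Suc n * F y", OF _ _ torus.finite_measure_axioms sets_torus_measure]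
        periodic_comp2[OF periodic_trig_kernel assms(1), where h = "(*)"]
        continuous_intros continuous_trig_kernel assms(2))
  have intM: "integrable torus_measure (\<lambda>X. ?K X * sin_modulus (rep_torus X))"
    by (intro integrable_torus_continuous[OF _ _ torus.finite_measure_axioms sets_torus_measure]
        periodic_comp2[OF periodic_trig_kernel periodic_sin_modulus, where h = "(*)"]
        continuous_intros continuous_trig_kernel continuous_sin_modulus)
  have "(\<integral>X. ?K X * F (rep_torus X) \<partial>torus_measure) - c * ?Z
      = (\<integral>X. ?K X * F (rep_torus X) - c * ?K X \<partial>torus_measure)"
    using intF intK by (simp add: kernel_mass_def del: power_Suc)
  then have "\<bar>(\<integral>X. ?K X * F (rep_torus X) \<partial>torus_measure) - c * ?Z\<bar>
      \<le> (\<integral>X. \<bar>?K X * F (rep_torus X) - c * ?K X\<bar> \<partial>torus_measure)"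
    by (simp only: integral_abs_bound)
  also have "\<dots> \<le> (\<integral>X. L * (?K X * sin_modulus (rep_torus X)) + B * ?K X \<partial>torus_measure)"
  proof (rule integral_mono)
    fix X
    have "\<bar>?K X * F (rep_torus X) - c * ?K X\<bar> = ?K X * \<bar>F (rep_torus X) - c\<bar>"
    proof -
      have "?K X * F (rep_torus X) - c * ?K X = ?K X * (F (rep_torus X) - c)"
        by (simp only: right_diff_distrib mult.commute[of c])
      moreover have "\<bar>?K X\<bar> = ?K X"
        by (intro abs_of_nonneg zero_le_power trig_kernel_nonneg)
      ultimately show ?thesis by (simp only: abs_mult)
    qed
    also have "\<dots> \<le> ?K X * (L * sin_modulus (rep_torus X) + B)"
      by (intro mult_left_mono assms zero_le_power trig_kernel_nonneg)
    finally show "\<bar>?K X * F (rep_torus X) - c * ?K X\<bar> \<le> L * (?K X * sin_modulus (rep_torus X)) + B * ?K X"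
      by (simp only: distrib_left mult_ac)
  qed (intro integrable_abs Bochner_Integration.integrable_diff Bochner_Integration.integrable_add
      integrable_mult_right intF intK intM)+
  also have "\<dots> = (L * kernel_spread n + B) * ?Z"
    using intM intK Z by (simp add: kernel_spread_def kernel_mass_def[symmetric] distrib_right del: power_Suc)
  finally have "\<bar>(\<integral>X. ?K X * F (rep_torus X) \<partial>torus_measure) - c * ?Z\<bar> / ?Z \<le> L * kernel_spread n + B"
    using Z by (simp only: pos_divide_le_eq)
  moreover have "\<bar>a - c * ?Z\<bar> / ?Z = \<bar>a / ?Z - c\<bar>" for a
  proof -
    have "a / ?Z - c = (a - c * ?Z) / ?Z" using Z by (simp add: diff_divide_distrib)
    then show ?thesis using Z by simp
  qed
  ultimately show ?thesis by simp
qed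

lemma lipschitz_continuous:
  fixes g :: "'a::real_normed_vector \<Rightarrow> 'b::real_normed_vector"
  assumes "\<And>x y. norm (g x - g y) \<le> L * norm (x - y)"
  shows "continuous_on S g"
proof (rule continuous_on_subset[OF _ subset_UNIV], rule lipschitz_on_continuous_on)
  show "(max L 0)-lipschitz_on UNIV g"
  proof (rule lipschitz_onI)
    fix x y :: 'a
    have "L * norm (x - y) \<le> max L 0 * norm (x - y)" by (intro mult_right_mono) auto
    with assms[of x y] show "dist (g x) (g y) \<le> max L 0 * dist x y" by (simp add: dist_norm)
  qed simp
qed

lemma periodic_translate_left: "periodic f \<Longrightarrow> periodic (\<lambda>y::real^2. f (x + y))"
  by (simp add: periodic_def lattice_rel_def)

lemma smooth_approx:
  fixes g :: "real^2 \<Rightarrow> real"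
  assumes "periodic g" "\<And>x y. \<bar>g x - g y\<bar> \<le> L * norm (x - y)" "\<epsilon> > 0"
  obtains \<phi> :: "torus \<Rightarrow> real" where "torus_smooth \<phi>" "\<And>x. \<bar>\<phi> (abs_torus x) - g x\<bar> \<le> \<epsilon>"
proof -
  \<comment> \<open>The given \<open>L\<close> may be zero or negative, while the choice of
    \<open>n\<close> divides by the constant.\<close>
  define L' where "L' = max L 1"
  have L': "norm (g x - g y) \<le> L' * norm (x - y)" for x y
  proof -
    have "L * norm (x - y) \<le> L' * norm (x - y)" unfolding L'_def by (intro mult_right_mono) auto
    with assms(2)[of x y] show ?thesis by simp
  qed
  have "L' > 0" by (simp add: L'_def)
  have cont: "continuous_on UNIV g" by (rule lipschitz_continuous[OF L'])
  obtain n where n: "kernel_spread n \<le> \<epsilon> / L'"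
    using kernel_spread_small[of "\<epsilon> / L'"] \<open>L' > 0\<close> \<open>\<epsilon> > 0\<close> by auto
  have "\<bar>mollify n g x - g x\<bar> \<le> \<epsilon>" for x
  proof -
    have "\<bar>mollify n g x - g x\<bar> \<le> L' * kernel_spread n + 0"
      unfolding mollify_def
    proof (rule kernel_average_bound[OF periodic_translate_left[OF assms(1)]])
      show "continuous_on UNIV (\<lambda>y. g (x + y))"
        by (rule continuous_on_compose2[OF cont]) (auto intro: continuous_intros)
      show "\<bar>g (x + y) - g x\<bar> \<le> L' * sin_modulus y + 0" for y
        using periodic_lipschitz_sin_modulus[OF assms(1) _ L', of x y] \<open>L' > 0\<close> by simp
    qed
    also have "\<dots> \<le> \<epsilon>"
      using n \<open>L' > 0\<close> by (simp add: field_simps)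
    finally show ?thesis .
  qed
  moreover have "mollify n g (rep_torus (abs_torus x)) = mollify n g x" for x
    by (rule periodic_rep[OF periodic_mollify[OF assms(1)]])
  ultimately show thesis
    using torus_smooth_rep(1)[OF periodic_mollify[OF assms(1), of n] C_k_mollify[OF assms(1) cont]]
    by (intro that[of "\<lambda>X. mollify n g (rep_torus X)"]) simp_all
qed

text \<open>The commutator between mollification and differentiation along a Lipschitz field is small.\<close>

lemma smooth_approx_directional:
  fixes g l :: "real^2 \<Rightarrow> real" and W :: "real^2 \<Rightarrow> real^2"
  assumes per: "periodic g" "periodic l" "periodic W"
    and g: "K \<ge> 0" "\<And>x y. norm (g x - g y) \<le> K * norm (x - y)"
    and l: "L \<ge> 0" "\<And>x y. norm (l x - l y) \<le> L * norm (x - y)"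
    and W: "C \<ge> 0" "\<And>x y. norm (W x - W y) \<le> C * norm (x - y)"
    and D: "\<And>x h. 0 \<le> h \<Longrightarrow> h \<le> 1 \<Longrightarrow> \<bar>g (x + h *\<^sub>R W x) - g x - h * l x\<bar> \<le> B * h\<^sup>2"
    and "\<epsilon> > 0"
  obtains \<phi> :: "torus \<Rightarrow> real" where "torus_smooth \<phi>"
    "\<And>x. \<bar>frechet_derivative (\<phi> \<circ> abs_torus) (at x) (W x) - l x\<bar> \<le> \<epsilon>"
proof -
  \<comment> \<open>K * C is the price of following \<open>W\<close> frozen at x instead of
    \<open>W\<close> at x + y, and \<open>L\<close> that of comparing \<open>l\<close> at these two
    points; the 1 makes the constant positive.\<close>
  define A where "A = K * C + L + 1"
  have "A > 0" using g(1) l(1) W(1) by (simp add: A_def add_nonneg_pos)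
  obtain n where n: "kernel_spread n \<le> \<epsilon> / A"
    using kernel_spread_small[of "\<epsilon> / A"] \<open>A > 0\<close> \<open>\<epsilon> > 0\<close> by auto
  have contg: "continuous_on UNIV g" by (rule lipschitz_continuous[OF g(2)])
  let ?G = "mollify n g" and ?h = "\<lambda>m. inverse (real (Suc m))"
  have smooth: "C_k k ?G" for k by (rule C_k_mollify[OF per(1) contg])
  have "\<bar>frechet_derivative ?G (at x) (W x) - l x\<bar> \<le> \<epsilon>" for x
  proof -
    \<comment> \<open>Only difference quotients of \<open>g\<close> enter, since \<open>g\<close>
      need not be differentiable in all directions. The kernel error is uniform in \<open>h\<close>,
      and the remainder B * h disappears in the limit.\<close>
    have dq: "\<bar>(?G (x + h *\<^sub>R W x) - ?G x) / h - l x\<bar> \<le> A * kernel_spread n + B * h" if h: "0 < h" "h \<le> 1" for h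
    proof -
      let ?F = "\<lambda>y. (g ((x + h *\<^sub>R W x) + y) - g (x + y)) / h"
      have perF: "periodic ?F"
        by (rule periodic_comp2[OF periodic_translate_left[OF per(1)] periodic_translate_left[OF per(1)]])
      have cont: "continuous_on UNIV (\<lambda>y. g (z + y))" for z
        by (rule continuous_on_compose2[OF contg]) (auto intro: continuous_intros)
      have contF: "continuous_on UNIV ?F"
        using h by (intro continuous_on_divide continuous_on_diff cont continuous_on_const) auto
      have int: "integrable torus_measure (\<lambda>X. trig_kernel (rep_torus X) ^ Suc n * g (z + rep_torus X))" for z
        by (intro integrable_torus_continuous[where f = "\<lambda>y. trig_kernel y ^ Suc n * g (z + y)", OF _ _ torus.finite_measure_axioms sets_torus_measure]
          periodic_comp2[OF periodic_trig_kernel periodic_translate_left[OF per(1)], where h = "(*)"]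
          continuous_on_mult continuous_trig_kernel cont)
      have "(?G (x + h *\<^sub>R W x) - ?G x) / h
          = ((\<integral>X. trig_kernel (rep_torus X) ^ Suc n * g (x + h *\<^sub>R W x + rep_torus X) \<partial>torus_measure)
            - (\<integral>X. trig_kernel (rep_torus X) ^ Suc n * g (x + rep_torus X) \<partial>torus_measure)) / h / kernel_mass (Suc n)"
        by (simp add: mollify_def diff_divide_distrib mult.commute)
      also have "\<dots> = (\<integral>X. trig_kernel (rep_torus X) ^ Suc n * ?F (rep_torus X) \<partial>torus_measure) / kernel_mass (Suc n)"
        using int by (simp add: right_diff_distrib times_divide_eq_right del: power_Suc)
      finally have eq: "(?G (x + h *\<^sub>R W x) - ?G x) / h
        = (\<integral>X. trig_kernel (rep_torus X) ^ Suc n * ?F (rep_torus X) \<partial>torus_measure) / kernel_mass (Suc n)" .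
      show ?thesis
        unfolding eq
      proof (rule kernel_average_bound[OF perF contF])
        fix y
        have m: "0 \<le> sin_modulus y" by (simp add: sin_modulus_def sum_nonneg)
        have 1: "\<bar>g (x + h *\<^sub>R W x + y) - g (x + y + h *\<^sub>R W (x + y))\<bar> \<le> h * (K * C * sin_modulus y)"
        proof -
          have "\<bar>g (x + h *\<^sub>R W x + y) - g (x + y + h *\<^sub>R W (x + y))\<bar> \<le> K * norm (h *\<^sub>R (W x - W (x + y)))"
            using g(2)[of "x + h *\<^sub>R W x + y" "x + y + h *\<^sub>R W (x + y)"] by (simp add: algebra_simps)
          also have "\<dots> = h * (K * norm (W (x + y) - W x))"
            using h by (simp add: norm_minus_commute)
          also have "\<dots> \<le> h * (K * (C * sin_modulus y))"
            using h g(1) by (intro mult_left_mono periodic_lipschitz_sin_modulus per W) auto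
          finally show ?thesis by (simp add: mult_ac)
        qed
        have 2: "\<bar>g (x + y + h *\<^sub>R W (x + y)) - g (x + y) - h * l (x + y)\<bar> \<le> B * h\<^sup>2"
          using D[of h "x + y"] h by simp
        have 3: "\<bar>h * l (x + y) - h * l x\<bar> \<le> h * (L * sin_modulus y)"
          using periodic_lipschitz_sin_modulus[OF per(2) l, of x y] h
          by (simp add: abs_mult flip: right_diff_distrib)
        have "\<bar>g (x + h *\<^sub>R W x + y) - g (x + y) - h * l x\<bar> \<le> h * ((K * C + L) * sin_modulus y) + B * h\<^sup>2"
          using 1 2 3 by (simp add: algebra_simps abs_le_iff)
        also have "\<dots> \<le> h * (A * sin_modulus y + B * h)"
          using m h by (simp add: A_def power2_eq_square algebra_simps)
        finally have "\<bar>g (x + h *\<^sub>R W x + y) - g (x + y) - h * l x\<bar> / h \<le> A * sin_modulus y + B * h"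
          using h by (simp add: divide_le_eq mult.commute)
        moreover have "?F y - l x = (g (x + h *\<^sub>R W x + y) - g (x + y) - h * l x) / h"
          using h by (simp add: diff_divide_distrib)
        ultimately show "\<bar>?F y - l x\<bar> \<le> A * sin_modulus y + B * h"
          using h by simp
      qed
    qed
    have "((\<lambda>t. ?G (x + t *\<^sub>R W x)) has_field_derivative frechet_derivative ?G (at x) (W x)) (at 0)"
      by (rule line_derivative[OF smooth])
    then have "((\<lambda>t. (?G (x + t *\<^sub>R W x) - ?G x) / t) \<longlongrightarrow> frechet_derivative ?G (at x) (W x)) (at 0)"
      by (simp add: has_field_derivative_iff)
    moreover have h0: "?h \<longlonglongrightarrow> 0" by (rule LIMSEQ_inverse_real_of_nat)
    then have "filterlim ?h (at 0) sequentially"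
      by (simp add: filterlim_at)
    ultimately have "(\<lambda>m. (?G (x + ?h m *\<^sub>R W x) - ?G x) / ?h m) \<longlonglongrightarrow> frechet_derivative ?G (at x) (W x)"
      by (rule filterlim_compose)
    then have lhs: "(\<lambda>m. \<bar>(?G (x + ?h m *\<^sub>R W x) - ?G x) / ?h m - l x\<bar>)
        \<longlonglongrightarrow> \<bar>frechet_derivative ?G (at x) (W x) - l x\<bar>"
      by (intro tendsto_intros)
    have "(\<lambda>m. A * kernel_spread n + B * ?h m) \<longlonglongrightarrow> A * kernel_spread n + B * 0"
      by (intro tendsto_intros h0)
    moreover have "\<bar>(?G (x + ?h m *\<^sub>R W x) - ?G x) / ?h m - l x\<bar> \<le> A * kernel_spread n + B * ?h m" for m
      by (rule dq) (simp_all add: field_simps)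
    ultimately have "\<bar>frechet_derivative ?G (at x) (W x) - l x\<bar> \<le> A * kernel_spread n + B * 0"
      using LIMSEQ_le[OF lhs] by blast
    also have "\<dots> \<le> \<epsilon>"
      using n \<open>A > 0\<close> by (simp add: field_simps)
    finally show ?thesis .
  qed
  then show thesis
    using torus_smooth_rep[OF periodic_mollify[OF per(1), of n] smooth]
    by (intro that[of "\<lambda>X. mollify n g (rep_torus X)"]) simp_all
qed

text \<open>Mollification approximates Lipschitz functions uniformly by smooth ones, and on finite
  measures uniform approximation passes to integrals.\<close>

lemma torus_measure_eqI_smooth:
  assumes fin: "finite_measure M" "finite_measure N"
    and sets: "sets M = sets borel" "sets N = sets borel"
    and eq: "\<And>\<phi> :: torus \<Rightarrow> real. torus_smooth \<phi> \<Longrightarrow> (\<integral>X. \<phi> X \<partial>M) = (\<integral>X. \<phi> X \<partial>N)"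
  shows "M = N"
proof (rule torus_measure_eqI_lipschitz[OF fin sets])
  fix f :: "real^2 \<Rightarrow> real" and K
  assume f: "periodic f" "\<And>x y. \<bar>f x - f y\<bar> \<le> K * norm (x - y)"
  have bound: "\<bar>(\<integral>X. \<phi> X \<partial>P) - (\<integral>X. f (rep_torus X) \<partial>P)\<bar> \<le> \<epsilon> * measure P UNIV"
    if P: "finite_measure P" "sets P = sets borel" and \<phi>: "torus_smooth \<phi>"
      and ap: "\<And>x. \<bar>\<phi> (abs_torus x) - f x\<bar> \<le> \<epsilon>" for P \<phi> \<epsilon>
  proof -
    interpret P: finite_measure P by fact
    have sp: "space P = UNIV" using sets_eq_imp_space_eq[OF P(2)] by simp
    have "continuous_on UNIV (\<phi> \<circ> abs_torus)"
      using \<phi> C_k_continuous unfolding torus_smooth_def by blast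
    moreover have "periodic (\<phi> \<circ> abs_torus)"
      unfolding o_def by (rule periodic_abs)
    ultimately have i1: "integrable P (\<lambda>X. \<phi> X)"
      using integrable_torus_continuous[of "\<phi> \<circ> abs_torus", OF _ _ P] by simp
    have i2: "integrable P (\<lambda>X. f (rep_torus X))"
      by (rule integrable_torus_continuous[OF f(1) lipschitz_continuous P]) (use f(2) in simp)
    have "\<bar>(\<integral>X. \<phi> X \<partial>P) - (\<integral>X. f (rep_torus X) \<partial>P)\<bar> = \<bar>\<integral>X. \<phi> X - f (rep_torus X) \<partial>P\<bar>"
      using i1 i2 by simp
    also have "\<dots> \<le> (\<integral>X. \<bar>\<phi> X - f (rep_torus X)\<bar> \<partial>P)"
      by (rule integral_abs_bound)
    also have "\<dots> \<le> (\<integral>X. \<epsilon> \<partial>P)"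
    proof (rule integral_mono)
      show "\<bar>\<phi> X - f (rep_torus X)\<bar> \<le> \<epsilon>" for X
        using ap[of "rep_torus X"] by simp
    qed (use i1 i2 in auto)
    also have "\<dots> = \<epsilon> * measure P UNIV" by (simp add: sp)
    finally show ?thesis .
  qed
  show "(\<integral>X. f (rep_torus X) \<partial>M) = (\<integral>X. f (rep_torus X) \<partial>N)"
  proof (rule ccontr)
    let ?a = "\<integral>X. f (rep_torus X) \<partial>M" and ?b = "\<integral>X. f (rep_torus X) \<partial>N"
    assume "?a \<noteq> ?b"
    \<comment> \<open>The additional 1 makes the combined approximation error strictly smaller than
      the assumed gap between the integrals.\<close>
    define m where "m = measure M UNIV + measure N UNIV + 1"
    have "m > 0" by (simp add: m_def add_nonneg_pos)
    define \<epsilon> where "\<epsilon> = \<bar>?a - ?b\<bar> / m"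
    have "\<epsilon> > 0" using \<open>?a \<noteq> ?b\<close> \<open>m > 0\<close> by (simp add: \<epsilon>_def)
    obtain \<phi> :: "torus \<Rightarrow> real" where \<phi>: "torus_smooth \<phi>" and ap: "\<And>x. \<bar>\<phi> (abs_torus x) - f x\<bar> \<le> \<epsilon>"
      by (rule smooth_approx[OF f \<open>\<epsilon> > 0\<close>]) (rule that)
    have "\<bar>?a - ?b\<bar> \<le> \<epsilon> * measure M UNIV + \<epsilon> * measure N UNIV"
      using bound[OF fin(1) sets(1) \<phi> ap] bound[OF fin(2) sets(2) \<phi> ap] eq[OF \<phi>] by linarith
    also have "\<dots> < \<epsilon> * m"
      using \<open>\<epsilon> > 0\<close> by (simp add: m_def algebra_simps)
    also have "\<dots> = \<bar>?a - ?b\<bar>" using \<open>m > 0\<close> by (simp add: \<epsilon>_def)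
    finally show False by simp
  qed
qed

section \<open>The flow\<close>

lemma has_vector_derivative_affine:
  assumes "(f has_vector_derivative f') (at (a * s + b))"
  shows "((\<lambda>s. f (a * s + b)) has_vector_derivative a *\<^sub>R f') (at s)"
proof -
  have "((\<lambda>s. f (a * s + b)) has_derivative (\<lambda>h. (a * h) *\<^sub>R f')) (at s)"
    by (rule has_derivative_compose[where g = f])
      (use assms in \<open>auto simp: has_vector_derivative_def intro!: derivative_eq_intros\<close>)
  then show ?thesis by (simp add: has_vector_derivative_def mult.commute)
qed

text \<open>Reflecting time reduces negative \<open>t\<close> to the one-sided mean value
  inequality; the majorant \<open>k\<close> depends only on the absolute value of time so that it
  serves both directions.\<close>

lemma vector_derivative_bound_general:
  fixes G :: "real \<Rightarrow> 'a::real_normed_vector"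
  assumes G: "\<And>s. (G has_vector_derivative g s) (at s)"
    and K: "\<And>s. (K has_real_derivative k s) (at s)"
    and bnd: "\<And>s. \<bar>s\<bar> \<le> \<bar>t\<bar> \<Longrightarrow> norm (g s) \<le> k \<bar>s\<bar>"
  shows "norm (G t - G 0) \<le> K \<bar>t\<bar> - K 0"
proof -
  have pos: "norm (H \<bar>t\<bar> - H 0) \<le> K \<bar>t\<bar> - K 0"
    if H: "\<And>s. (H has_vector_derivative h s) (at s)" and b: "\<And>s. 0 < s \<Longrightarrow> s < \<bar>t\<bar> \<Longrightarrow> norm (h s) \<le> k s"
      and "t \<noteq> 0" for H h :: "real \<Rightarrow> 'a"
  proof (rule differentiable_bound_general[where f' = h and \<phi>' = k])
    show "continuous_on {0..\<bar>t\<bar>} H"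
      by (intro continuous_at_imp_continuous_on ballI has_vector_derivative_continuous[OF H])
    show "continuous_on {0..\<bar>t\<bar>} K"
      by (intro continuous_at_imp_continuous_on ballI DERIV_isCont[OF K])
  qed (use that K in \<open>auto simp: has_real_derivative_iff_has_vector_derivative\<close>)
  consider "t = 0" | "t > 0" | "t < 0" by linarith
  then show ?thesis
  proof cases
    case 2
    have "norm (g s) \<le> k s" if "0 < s" "s < \<bar>t\<bar>" for s
      using bnd[of s] that by simp
    from pos[OF G this] 2 show ?thesis by simp
  next
    case 3
    have D: "((\<lambda>s. G (- s)) has_vector_derivative - g (- s)) (at s)" for s
      using has_vector_derivative_affine[of G "g (- s)" "- 1" s 0] G by simp
    have "norm (- g (- s)) \<le> k s" if "0 < s" "s < \<bar>t\<bar>" for s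
      using bnd[of "- s"] that by simp
    from pos[OF D this] 3 show ?thesis by simp
  qed simp
qed

lemma continuous_antiderivative:
  fixes f :: "real \<Rightarrow> 'a::euclidean_space"
  assumes "continuous_on UNIV f"
  obtains F where "F 0 = 0" "\<And>t. (F has_vector_derivative f t) (at t)"
proof -
  have "\<exists>F. \<forall>x :: real. -\<infinity> < ereal x \<longrightarrow> ereal x < \<infinity> \<longrightarrow> (F has_vector_derivative f x) (at x)"
    by (rule einterval_antiderivative)
      (use assms in \<open>auto simp: continuous_on_eq_continuous_at\<close>)
  then obtain F where F: "\<And>t. (F has_vector_derivative f t) (at t)" by auto
  have "((\<lambda>t. F t - F 0) has_vector_derivative f t) (at t)" for t
    using has_vector_derivative_diff[OF F has_vector_derivative_const] by simp
  with that[of "\<lambda>t. F t - F 0"] show thesis by simp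
qed

text \<open>Stated for an arbitrary field on Euclidean space, so that the locale can be interpreted
  a second time for the reversed field, which turns backward estimates into forward ones.\<close>

locale lipschitz_field =
  fixes W :: "'a::euclidean_space \<Rightarrow> 'a" and L C :: real
  assumes L_pos: "L > 0" and C_pos: "C > 0"
    and W_lipschitz: "\<And>x y. norm (W x - W y) \<le> L * norm (x - y)"
    and W_bounded: "\<And>x. norm (W x) \<le> C"
begin

definition solution :: "(real \<Rightarrow> 'a) \<Rightarrow> bool" where
  "solution \<xi> \<longleftrightarrow> (\<forall>t. (\<xi> has_vector_derivative W (\<xi> t)) (at t))"

lemma continuous_W: "continuous_on S W"
  by (rule lipschitz_continuous[OF W_lipschitz])

text \<open>Picard iteration is a contraction on the whole line in the norm with weight \<open>exp (- 2 L \<bar>t\<bar>)\<close>.\<close>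

lemma solution_exists: "\<exists>\<xi>. \<xi> 0 = x \<and> solution \<xi>"
proof -
  let ?e = "\<lambda>t. exp (2 * L * \<bar>t\<bar>)"
  \<comment> \<open>\<open>u\<close> stands for the displacement from \<open>x\<close> divided by
    the weight \<open>?e\<close>. Displacements grow at most linearly, so the quotient stays in the
    complete space of bounded continuous functions.\<close>
  define E where "E u s = W (x + ?e s *\<^sub>R apply_bcontfun u s)" for u :: "real \<Rightarrow>\<^sub>C 'a" and s
  have contE: "continuous_on UNIV (E u)" for u
    unfolding E_def by (rule continuous_on_compose2[OF continuous_W]) (auto intro!: continuous_intros)
  have "\<exists>F. F 0 = 0 \<and> (\<forall>t. (F has_vector_derivative E u t) (at t))" for u
    using continuous_antiderivative[OF contE[of u]] by metis
  then obtain F where F0: "\<And>u. F u 0 = 0" and F: "\<And>u t. (F u has_vector_derivative E u t) (at t)"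
    by metis
  have contF: "continuous_on UNIV (F u)" for u
    by (intro continuous_at_imp_continuous_on ballI has_vector_derivative_continuous[OF F])
  have bF: "norm (F u t) \<le> C * \<bar>t\<bar>" for u t
    using vector_derivative_bound_general[OF F, of "\<lambda>t. C * t" "\<lambda>t. C" t u] W_bounded
    by (auto simp: E_def F0 intro!: derivative_eq_intros)
  define P where "P u = Bcontfun (\<lambda>t. inverse (?e t) *\<^sub>R F u t)" for u
  have "(\<lambda>t. inverse (?e t) *\<^sub>R F u t) \<in> bcontfun" for u
  proof (rule bcontfun_normI)
    show "continuous_on UNIV (\<lambda>t. inverse (?e t) *\<^sub>R F u t)"
      by (intro continuous_intros contF) simp
    fix t
    have "2 * L * \<bar>t\<bar> \<le> ?e t"
      using exp_ge_add_one_self[of "2 * L * \<bar>t\<bar>"] by linarith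
    then have "\<bar>t\<bar> \<le> ?e t * (1 / (2 * L))"
      using L_pos by (simp add: field_simps)
    then have "norm (F u t) \<le> ?e t * (C * (1 / (2 * L)))"
      using bF[of u t] C_pos mult_left_mono[of "\<bar>t\<bar>" "?e t * (1 / (2 * L))" C] by (simp add: mult_ac)
    then have "inverse (?e t) * norm (F u t) \<le> inverse (?e t) * (?e t * (C * (1 / (2 * L))))"
      by (intro mult_left_mono) auto
    also have "\<dots> = C * (1 / (2 * L))" by simp
    finally show "norm (inverse (?e t) *\<^sub>R F u t) \<le> C * (1 / (2 * L))" by simp
  qed
  then have P: "apply_bcontfun (P u) t = inverse (?e t) *\<^sub>R F u t" for u t
    by (simp add: P_def Bcontfun_inverse)
  have "dist (P u) (P v) \<le> 1 / 2 * dist u v" for u v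
  proof (rule dist_bound)
    fix t
    have "((\<lambda>t. F u t - F v t) has_vector_derivative (E u s - E v s)) (at s)" for s
      by (intro has_vector_derivative_diff F)
    \<comment> \<open>The weight with exponent 2 L is a primitive of 2 L times itself, while the
      Lipschitz bound costs only one factor L; their ratio is the contraction constant 1 /
      2.\<close>
    moreover have "((\<lambda>s. exp (2 * L * s) / 2 * dist u v) has_real_derivative L * exp (2 * L * s) * dist u v) (at s)" for s
      by (auto intro!: derivative_eq_intros)
    moreover have "norm (E u s - E v s) \<le> L * ?e s * dist u v" for s
    proof -
      have "norm (E u s - E v s) \<le> L * norm (?e s *\<^sub>R (apply_bcontfun u s - apply_bcontfun v s))"
        using W_lipschitz[of "x + ?e s *\<^sub>R apply_bcontfun u s" "x + ?e s *\<^sub>R apply_bcontfun v s"]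
        by (simp add: E_def scaleR_diff_right)
      also have "\<dots> = L * (?e s * dist (apply_bcontfun u s) (apply_bcontfun v s))"
        by (simp add: dist_norm)
      also have "\<dots> \<le> L * (?e s * dist u v)"
        using L_pos by (intro mult_left_mono dist_bounded) auto
      finally show ?thesis by simp
    qed
    ultimately have "norm (F u t - F v t - (F u 0 - F v 0)) \<le> ?e t / 2 * dist u v - exp (2 * L * 0) / 2 * dist u v"
      by (rule vector_derivative_bound_general)
    then have "norm (F u t - F v t) \<le> ?e t * (1 / 2 * dist u v)"
      using zero_le_dist[of u v] unfolding F0 by (simp del: zero_le_dist)
    then have "inverse (?e t) * norm (F u t - F v t) \<le> inverse (?e t) * (?e t * (1 / 2 * dist u v))"
      by (intro mult_left_mono) auto
    also have "\<dots> = 1 / 2 * dist u v" by simp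
    finally show "dist (apply_bcontfun (P u) t) (apply_bcontfun (P v) t) \<le> 1 / 2 * dist u v"
      by (simp add: P dist_norm flip: scaleR_diff_right)
  qed
  then have "\<exists>!u. P u = u"
    by (intro banach_fix_type[where c = "1 / 2"]) auto
  then obtain u where u: "P u = u" by blast
  have eu: "?e t *\<^sub>R apply_bcontfun u t = F u t" for t
    using P[of u t] by (simp add: u)
  have "solution (\<lambda>t. x + F u t)"
    unfolding solution_def using has_vector_derivative_add[OF has_vector_derivative_const F, of x u]
    by (simp add: E_def eu)
  then show ?thesis
    using F0 by (intro exI[of _ "\<lambda>t. x + F u t"]) simp
qed

text \<open>The squared distance is differentiable even where the distance vanishes. Cauchy-Schwarz
  and the Lipschitz bound make its product with exp (- 2 L t) nonincreasing.\<close>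

lemma forward_gronwall:
  assumes "solution \<xi>" "solution \<eta>" "t \<ge> 0"
  shows "norm (\<xi> t - \<eta> t) \<le> exp (L * t) * norm (\<xi> 0 - \<eta> 0)"
proof -
  let ?d = "\<lambda>s. \<xi> s - \<eta> s"
  let ?f = "\<lambda>s. exp (- (2 * L) * s) * (?d s \<bullet> ?d s)"
  have "?f t \<le> ?f 0"
  proof (rule DERIV_nonpos_imp_nonincreasing[OF assms(3)])
    fix s
    let ?w = "W (\<xi> s) - W (\<eta> s)"
    have "(?d has_vector_derivative ?w) (at s)"
      using assms by (intro has_vector_derivative_diff) (auto simp: solution_def)
    then have "(?d has_derivative (\<lambda>h. h *\<^sub>R ?w)) (at s)"
      by (simp add: has_vector_derivative_def)
    from has_derivative_inner[OF this this]
    have "((\<lambda>s. ?d s \<bullet> ?d s) has_real_derivative (2 * (?d s \<bullet> ?w))) (at s)"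
      unfolding has_field_derivative_def
      by (rule has_derivative_eq_rhs) (simp add: fun_eq_iff inner_commute)
    then have D: "(?f has_real_derivative
        (- (2 * L) * exp (- (2 * L) * s) * (?d s \<bullet> ?d s) + exp (- (2 * L) * s) * (2 * (?d s \<bullet> ?w)))) (at s)"
      by (auto intro!: derivative_eq_intros)
    have "?d s \<bullet> ?w \<le> norm (?d s) * norm ?w" by (rule norm_cauchy_schwarz)
    also have "\<dots> \<le> norm (?d s) * (L * norm (?d s))"
      by (intro mult_left_mono W_lipschitz) simp
    also have "\<dots> = L * (?d s \<bullet> ?d s)" by (simp add: dot_square_norm power2_eq_square)
    finally have "exp (- (2 * L) * s) * (2 * (?d s \<bullet> ?w)) \<le> exp (- (2 * L) * s) * (2 * (L * (?d s \<bullet> ?d s)))"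
      by (intro mult_left_mono) auto
    then have "- (2 * L) * exp (- (2 * L) * s) * (?d s \<bullet> ?d s) + exp (- (2 * L) * s) * (2 * (?d s \<bullet> ?w)) \<le> 0"
      by (simp add: mult_ac)
    with D show "\<exists>y. (?f has_real_derivative y) (at s) \<and> y \<le> 0"
      by blast
  qed
  then have "exp (- (2 * L) * t) * (norm (?d t))\<^sup>2 \<le> (norm (?d 0))\<^sup>2"
    by (simp add: dot_square_norm)
  then have "(exp (- (L * t)) * norm (?d t))\<^sup>2 \<le> (norm (?d 0))\<^sup>2"
    by (simp add: power_mult_distrib exp_double[symmetric] mult.assoc)
  then have "exp (- (L * t)) * norm (?d t) \<le> norm (?d 0)"
    by (rule power2_le_imp_le) simp
  then show ?thesis
    by (simp add: exp_minus divide_simps mult.commute)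
qed

lemma gronwall:
  assumes "solution \<xi>" "solution \<eta>"
  shows "norm (\<xi> t - \<eta> t) \<le> exp (L * \<bar>t\<bar>) * norm (\<xi> 0 - \<eta> 0)"
proof (cases "t \<ge> 0")
  case True
  then show ?thesis using forward_gronwall[OF assms] by simp
next
  case False
  interpret rev: lipschitz_field "\<lambda>x. - W x" L C
    using L_pos C_pos W_lipschitz W_bounded
    by unfold_locales (auto simp: norm_minus_commute)
  have rev: "rev.solution (\<lambda>s. \<zeta> (- s))" if "solution \<zeta>" for \<zeta>
    unfolding rev.solution_def
  proof
    fix s
    show "((\<lambda>s. \<zeta> (- s)) has_vector_derivative - W (\<zeta> (- s))) (at s)"
      using has_vector_derivative_affine[of \<zeta> "W (\<zeta> (- s))" "- 1" s 0] that
      by (simp add: solution_def)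
  qed
  from rev.forward_gronwall[OF rev[OF assms(1)] rev[OF assms(2)], of "- t"] False
  show ?thesis by simp
qed

definition flow_map :: "real \<Rightarrow> 'a \<Rightarrow> 'a" where
  "flow_map t x = (SOME \<xi>. \<xi> 0 = x \<and> solution \<xi>) t"

lemma flow_map_0: "flow_map 0 x = x"
  and solution_flow_map: "solution (\<lambda>t. flow_map t x)"
proof -
  have "(SOME \<xi>. \<xi> 0 = x \<and> solution \<xi>) 0 = x \<and> solution (SOME \<xi>. \<xi> 0 = x \<and> solution \<xi>)"
    by (rule someI_ex[OF solution_exists])
  then show "flow_map 0 x = x" "solution (\<lambda>t. flow_map t x)"
    by (simp_all add: flow_map_def)
qed

lemma flow_map_derivative: "((\<lambda>t. flow_map t x) has_vector_derivative W (flow_map t x)) (at t)"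
  using solution_flow_map unfolding solution_def by blast

lemma flow_map_unique:
  assumes "solution \<xi>"
  shows "\<xi> t = flow_map t (\<xi> 0)"
  using gronwall[OF assms solution_flow_map[of "\<xi> 0"], of t] by (simp add: flow_map_0)

lemma flow_map_lipschitz: "norm (flow_map t x - flow_map t y) \<le> exp (L * \<bar>t\<bar>) * norm (x - y)"
  using gronwall[OF solution_flow_map solution_flow_map, of t x y] by (simp add: flow_map_0)

lemma flow_map_add: "flow_map (s + t) x = flow_map s (flow_map t x)"
proof -
  have "solution (\<lambda>s. flow_map (s + t) x)"
    unfolding solution_def
  proof
    fix s
    show "((\<lambda>s. flow_map (s + t) x) has_vector_derivative W (flow_map (s + t) x)) (at s)"
      using has_vector_derivative_affine[of "\<lambda>t. flow_map t x" "W (flow_map (s + t) x)" 1 s t]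
        flow_map_derivative[of x "s + t"]
      by simp
  qed
  from flow_map_unique[OF this, of s] show ?thesis by simp
qed

lemma flow_map_inverse: "flow_map (- t) (flow_map t x) = x"
  by (simp add: flow_map_0 flip: flow_map_add)

lemma flow_map_speed: "norm (flow_map t x - x) \<le> C * \<bar>t\<bar>"
  using vector_derivative_bound_general[OF flow_map_derivative, of "\<lambda>t. C * t" "\<lambda>t. C" t x] W_bounded
  by (auto simp: flow_map_0 intro!: derivative_eq_intros)

lemma continuous_flow_map: "continuous_on S (flow_map t)"
  by (rule lipschitz_continuous[OF flow_map_lipschitz])

lemma continuous_flow_map_time: "continuous_on S (\<lambda>t. flow_map t x)"
  by (intro continuous_at_imp_continuous_on ballI has_vector_derivative_continuous[OF flow_map_derivative])

text \<open>Speed at most \<open>C\<close> keeps \<open>l\<close> within K C |s| of its initial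
  value along the orbit, and integrating this gives the remainder, stated without the factor 1 /
  2.\<close>

lemma flow_map_expansion:
  fixes f :: "'a \<Rightarrow> 'b::real_normed_vector"
  assumes f: "\<And>t. ((\<lambda>t. f (flow_map t x)) has_vector_derivative l (flow_map t x)) (at t)"
    and l: "K \<ge> 0" "\<And>x y. norm (l x - l y) \<le> K * norm (x - y)"
  shows "norm (f (flow_map h x) - f x - h *\<^sub>R l x) \<le> K * C * h\<^sup>2"
proof -
  have "((\<lambda>t. f (flow_map t x) - t *\<^sub>R l x) has_vector_derivative l (flow_map t x) - l x) (at t)" for t
    by (intro has_vector_derivative_diff f) (auto intro!: derivative_eq_intros)
  moreover have "((\<lambda>t. K * C * t\<^sup>2 / 2) has_real_derivative K * C * t) (at t)" for t
    by (auto intro!: derivative_eq_intros)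
  moreover have "norm (l (flow_map s x) - l x) \<le> K * C * \<bar>s\<bar>" for s
    using order_trans[OF l(2) mult_left_mono[OF flow_map_speed l(1)], of s x] by simp
  ultimately have "norm (f (flow_map h x) - h *\<^sub>R l x - (f (flow_map 0 x) - 0 *\<^sub>R l x))
      \<le> K * C * \<bar>h\<bar>\<^sup>2 / 2 - K * C * 0\<^sup>2 / 2"
    by (rule vector_derivative_bound_general)
  also have "\<dots> \<le> K * C * h\<^sup>2"
    using l(1) C_pos by (simp add: mult_nonneg_nonneg)
  finally show ?thesis by (simp add: flow_map_0 algebra_simps)
qed

end

section \<open>The flow on the torus and its lift\<close>

lemma torus_smooth_lift:
  assumes "torus_smooth f"
  shows "C_k k (\<lambda>x. f (abs_torus x))"
  using assms by (simp add: torus_smooth_def o_def)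

text \<open>The constants \<open>L\<close> and \<open>C\<close> are parameters so that the lifted
  field is an instance of \<open>lipschitz_field\<close> from the start; smoothness and periodicity
  supply them in the end.\<close>

locale torus_field =
  fixes V :: "torus \<Rightarrow> real^2" and L C :: real
  assumes smooth: "torus_smooth V" and divergence_free: "\<And>x. divergence V x = 0"
    and L_pos': "L > 0" and C_pos': "C > 0"
    and lift_lipschitz: "\<And>x y. norm (V (abs_torus x) - V (abs_torus y)) \<le> L * norm (x - y)"
    and lift_bounded: "\<And>x. norm (V (abs_torus x)) \<le> C"
begin

sublocale lipschitz_field "\<lambda>x. V (abs_torus x)" L C
  by unfold_locales (simp_all add: L_pos' C_pos' lift_lipschitz lift_bounded)

text \<open>A lattice translate of an orbit solves the same equation, and solutions are unique.
  Hence the flow descends to the torus, and displacements along it are periodic functions of the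
  starting point.\<close>

lemma flow_map_lattice:
  assumes "lattice_rel x y"
  shows "flow_map t y = flow_map t x + (y - x)"
proof -
  have eq: "abs_torus (flow_map s x + (y - x)) = abs_torus (flow_map s x)" for s
    using lattice_rel_sym[OF assms] by (simp add: abs_torus_eq_iff lattice_rel_def)
  have "solution (\<lambda>s. flow_map s x + (y - x))"
    unfolding solution_def eq
    using has_vector_derivative_add[OF flow_map_derivative has_vector_derivative_const] by simp
  from flow_map_unique[OF this, of t] show ?thesis by (simp add: flow_map_0)
qed

lemma flow_map_lattice_rel:
  assumes "lattice_rel x y"
  shows "lattice_rel (flow_map t x) (flow_map t y)"
  unfolding flow_map_lattice[OF assms] using assms by (simp add: lattice_rel_def)

lemma periodic_flow_map: "periodic f \<Longrightarrow> periodic (\<lambda>x. f (flow_map t x))"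
  using flow_map_lattice_rel by (auto simp: periodic_def)

text \<open>Discharges the description operator in \<open>flow\<close>: lifts whose initial points
  agree modulo the lattice stay equivalent for all times.\<close>

lemma flow_abs_torus: "flow V t (abs_torus x) = abs_torus (flow_map t x)"
  unfolding flow_def
proof (rule the_equality)
  show "\<exists>\<xi>. (\<forall>s. (\<xi> has_vector_derivative V (abs_torus (\<xi> s))) (at s)) \<and>
     abs_torus (\<xi> 0) = abs_torus x \<and> abs_torus (\<xi> t) = abs_torus (flow_map t x)"
    using flow_map_derivative[of x] by (intro exI[of _ "\<lambda>s. flow_map s x"]) (simp add: flow_map_0)
next
  fix y
  assume "\<exists>\<xi>. (\<forall>s. (\<xi> has_vector_derivative V (abs_torus (\<xi> s))) (at s)) \<and>
     abs_torus (\<xi> 0) = abs_torus x \<and> abs_torus (\<xi> t) = y"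
  then obtain \<xi> where \<xi>: "solution \<xi>" "lattice_rel (\<xi> 0) x" "abs_torus (\<xi> t) = y"
    by (auto simp: solution_def abs_torus_eq_iff)
  have "lattice_rel (\<xi> t) (flow_map t x)"
    by (subst flow_map_unique[OF \<xi>(1)]) (rule flow_map_lattice_rel[OF \<xi>(2)])
  with \<xi>(3) show "y = abs_torus (flow_map t x)" by (simp add: abs_torus_eq_iff[symmetric])
qed

lemma flow_rep_torus: "flow V t X = abs_torus (flow_map t (rep_torus X))"
  using flow_abs_torus[of t "rep_torus X"] by simp

lemma measurable_flow [measurable]: "flow V t \<in> measurable borel borel"
proof -
  have "periodic (\<lambda>x. abs_torus (flow_map t x))"
    using flow_map_lattice_rel by (auto simp: periodic_def abs_torus_eq_iff)
  moreover have "continuous_on UNIV (\<lambda>x. abs_torus (flow_map t x))"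
    by (rule continuous_on_compose2[OF continuous_on_abs_torus continuous_flow_map]) simp
  ultimately show ?thesis
    unfolding flow_rep_torus[abs_def] by (rule borel_measurable_rep_torus)
qed

lemma lift_flow: "periodic f \<Longrightarrow> f (rep_torus (flow V t X)) = f (flow_map t (rep_torus X))"
  by (simp add: flow_rep_torus periodic_rep)

end

section \<open>Transport of weakly invariant functions\<close>

lemma integrable_mult_periodic:
  fixes w :: "torus \<Rightarrow> real" and f :: "real^2 \<Rightarrow> real"
  assumes "integrable torus_measure w" "periodic f" "continuous_on UNIV f"
  shows "integrable torus_measure (\<lambda>X. w X * f (rep_torus X))"
proof -
  obtain B where B: "B > 0" "\<And>x. norm (f x) \<le> B"
    by (rule periodic_bounded[OF assms(2,3)]) (rule that)
  have [measurable]: "(\<lambda>X. f (rep_torus X)) \<in> borel_measurable borel"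
    by (rule borel_measurable_rep_torus[OF assms(2,3)])
  have [measurable]: "w \<in> borel_measurable borel"
    using borel_measurable_integrable[OF assms(1)] by (simp cong: measurable_cong_sets)
  show ?thesis
  proof (rule Bochner_Integration.integrable_bound[where f = "\<lambda>X. B * w X"])
    show "integrable torus_measure (\<lambda>X. B * w X)" using assms(1) by simp
    show "AE X in torus_measure. norm (w X * f (rep_torus X)) \<le> norm (B * w X)"
    proof (rule AE_I2)
      fix X
      have "\<bar>w X\<bar> * \<bar>f (rep_torus X)\<bar> \<le> \<bar>w X\<bar> * B"
        using B(2)[of "rep_torus X"] by (intro mult_left_mono) auto
      then show "norm (w X * f (rep_torus X)) \<le> norm (B * w X)"
        using B(1) by (simp add: abs_mult mult.commute)
    qed
  qed simp
qed

lemma integrable_of_square: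
  fixes f :: "torus \<Rightarrow> real"
  assumes "f \<in> borel_measurable torus_measure" "integrable torus_measure (\<lambda>X. (f X)\<^sup>2)"
  shows "integrable torus_measure f"
proof (rule Bochner_Integration.integrable_bound[where f = "\<lambda>X. 1 + (f X)\<^sup>2"])
  show "integrable torus_measure (\<lambda>X. 1 + (f X)\<^sup>2)" using assms(2) by simp
  have "\<bar>s\<bar> \<le> 1 + s\<^sup>2" for s :: real
  proof -
    have "0 \<le> (\<bar>s\<bar> - 1)\<^sup>2 + s\<^sup>2" by simp
    then show ?thesis by (simp add: power2_diff)
  qed
  then show "AE X in torus_measure. norm (f X) \<le> norm (1 + (f X)\<^sup>2)"
    by (auto intro: order_trans)
qed (rule assms)

lemma DERIV_quadratic_remainder:
  fixes f :: "real \<Rightarrow> real"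
  assumes "\<And>h. \<bar>f (x + h) - f x - d * h\<bar> \<le> B * h\<^sup>2"
  shows "(f has_real_derivative d) (at x)"
proof -
  have "((\<lambda>h. (f (x + h) - f x) / h - d) \<longlongrightarrow> 0) (at 0)"
  proof (rule Lim_null_comparison[where g = "\<lambda>h. B * \<bar>h\<bar>"])
    have "((\<lambda>h. B * \<bar>h\<bar>) \<longlongrightarrow> B * \<bar>0\<bar>) (at 0)" by (intro tendsto_intros)
    then show "((\<lambda>h. B * \<bar>h\<bar>) \<longlongrightarrow> 0) (at 0)" by simp
    have "norm ((f (x + h) - f x) / h - d) \<le> B * \<bar>h\<bar>" if "h \<noteq> 0" for h
    proof -
      have "\<bar>f (x + h) - f x - d * h\<bar> \<le> (B * \<bar>h\<bar>) * \<bar>h\<bar>"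
        using assms[of h] by (simp add: power2_eq_square)
      then have "\<bar>f (x + h) - f x - d * h\<bar> / \<bar>h\<bar> \<le> B * \<bar>h\<bar>"
        using that by (subst pos_divide_le_eq) auto
      moreover have "(f (x + h) - f x) / h - d = (f (x + h) - f x - d * h) / h"
        using that by (simp add: diff_divide_distrib)
      ultimately show ?thesis by simp
    qed
    then show "\<forall>\<^sub>F h in at 0. norm ((f (x + h) - f x) / h - d) \<le> B * \<bar>h\<bar>"
      by (simp add: eventually_at_filter)
  qed
  then have "((\<lambda>h. (f (x + h) - f x) / h) \<longlongrightarrow> d) (at 0)"
    by (simp add: LIM_zero_iff)
  then show ?thesis unfolding DERIV_def .
qed

text \<open>The derivative vanishes everywhere. This replaces differentiation under the integral: a
  pointwise expansion whose linear term integrates to zero yields a conserved quantity.\<close>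

lemma quadratic_increment_const:
  fixes a :: "real \<Rightarrow> real"
  assumes "\<And>s h. \<bar>a (s + h) - a s\<bar> \<le> B * h\<^sup>2"
  shows "a s = a t"
proof (rule DERIV_isconst_all[where f = a])
  show "\<forall>s. (a has_real_derivative 0) (at s)"
    using assms by (intro allI DERIV_quadratic_remainder[where B = B]) simp
qed

context torus_field
begin

lemma C_k_W: "C_k k (\<lambda>x. V (abs_torus x))"
  by (rule torus_smooth_lift[OF smooth])

lemma periodic_W: "periodic (\<lambda>x. V (abs_torus x))"
  by (rule periodic_abs)

definition directional :: "(torus \<Rightarrow> real) \<Rightarrow> real^2 \<Rightarrow> real" where
  "directional \<phi> x = frechet_derivative (\<phi> \<circ> abs_torus) (at x) (V (abs_torus x))"

text \<open>The distributional form of V . Dw = 0 for a divergence-free field, with the derivative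
  moved to the test function. Asking only for integrability of \<open>w\<close> covers constants and
  H1 functions alike.\<close>

definition weakly_invariant :: "(torus \<Rightarrow> real) \<Rightarrow> bool" where
  "weakly_invariant w \<longleftrightarrow> integrable torus_measure w \<and>
     (\<forall>\<phi>. torus_smooth \<phi> \<longrightarrow> (\<integral>X. w X * directional \<phi> (rep_torus X) \<partial>torus_measure) = 0)"

text \<open>The product rule gives div (\<phi> V) = V . D\<phi> + \<phi> div V, and the last term
  vanishes. In divergence form the expression can be integrated by parts one component at a time,
  against the smooth functions V_i \<phi>.\<close>

lemma
  assumes "torus_smooth \<phi>"
  shows smooth_component_mult: "torus_smooth (\<lambda>X. V X $ i * \<phi> X)"
    and directional_divergence_form:
      "directional \<phi> (rep_torus X) = (\<Sum>i\<in>UNIV. torus_partial i (\<lambda>X. V X $ i * \<phi> X) X)"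
    and periodic_directional: "periodic (directional \<phi>)"
    and C_k_directional: "C_k k (directional \<phi>)"
proof -
  have Phi: "C_k k (\<lambda>x. \<phi> (abs_torus x))" for k by (rule torus_smooth_lift[OF assms])
  show "torus_smooth (\<lambda>X. V X $ i * \<phi> X)" for i
    unfolding torus_smooth_def o_def by (intro allI C_k_mult C_k_nth C_k_W Phi)
  have ex: "directional \<phi> x = (\<Sum>i\<in>UNIV. V (abs_torus x) $ i * frechet_derivative (\<phi> \<circ> abs_torus) (at x) (axis i 1))" for x
    unfolding directional_def by (subst frechet_derivative_expand[where k = 0]) (use Phi in \<open>simp_all add: o_def del: C_k.simps\<close>)
  show "directional \<phi> (rep_torus X) = (\<Sum>i\<in>UNIV. torus_partial i (\<lambda>X. V X $ i * \<phi> X) X)"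
  proof -
    have p: "torus_partial i (\<lambda>X. V X $ i * \<phi> X) X
        = V X $ i * frechet_derivative (\<phi> \<circ> abs_torus) (at (rep_torus X)) (axis i 1) + torus_partial i V X $ i * \<phi> X" for i
      unfolding torus_partial_def o_def
      using frechet_derivative_lift_mult[OF C_k_nth[OF C_k_W[of "Suc 0"]] Phi[of "Suc 0"], of i "rep_torus X" "axis i 1"]
        frechet_derivative_nth[OF C_k_W[of "Suc 0"], of i "rep_torus X" "axis i 1"]
      by simp
    have "(\<Sum>i\<in>UNIV. torus_partial i V X $ i * \<phi> X) = divergence V X * \<phi> X"
      by (simp add: divergence_def sum_distrib_right)
    then show ?thesis
      unfolding p ex by (simp add: sum.distrib divergence_free)
  qed
  show "periodic (directional \<phi>)"
    unfolding directional_def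
  proof (rule periodic_comp2[OF periodic_frechet_derivative periodic_W, where h = "\<lambda>D v. D v"])
    show "periodic (\<phi> \<circ> abs_torus)" unfolding o_def by (rule periodic_abs)
  qed
  have "C_k k (\<lambda>x. \<Sum>i\<in>UNIV. V (abs_torus x) $ i * frechet_derivative (\<phi> \<circ> abs_torus) (at x) (axis i 1))" for k
    by (intro C_k_sum C_k_mult C_k_nth C_k_W C_k_frechet_derivative) (use Phi[of "Suc k"] in \<open>simp add: o_def del: C_k.simps\<close>)
  then show "C_k k (directional \<phi>)"
    by (rule C_k_cong) (simp add: ex)
qed

lemma torus_partial_periodic:
  assumes "torus_smooth (\<phi> :: torus \<Rightarrow> real)"
  shows "periodic (\<lambda>x. frechet_derivative (\<phi> \<circ> abs_torus) (at x) v)"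
    "continuous_on UNIV (\<lambda>x. frechet_derivative (\<phi> \<circ> abs_torus) (at x) v)"
proof -
  have "periodic (\<phi> \<circ> abs_torus)" unfolding o_def by (rule periodic_abs)
  then show "periodic (\<lambda>x. frechet_derivative (\<phi> \<circ> abs_torus) (at x) v)"
    by (intro periodic_comp[OF periodic_frechet_derivative, where h = "\<lambda>D. D v"])
  have "C_k (Suc 0) (\<phi> \<circ> abs_torus)" using assms unfolding torus_smooth_def by blast
  then show "continuous_on UNIV (\<lambda>x. frechet_derivative (\<phi> \<circ> abs_torus) (at x) v)"
    by (intro C_k_continuous[OF C_k_frechet_derivative])
qed

lemma weakly_invariant_const: "weakly_invariant (\<lambda>X. 1)"
  unfolding weakly_invariant_def
proof (intro conjI allI impI)
  fix \<phi> :: "torus \<Rightarrow> real" assume \<phi>: "torus_smooth \<phi>"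
  let ?\<psi> = "\<lambda>i X. V X $ i * \<phi> X"
  note sm = smooth_component_mult[OF \<phi>]
  have "integrable torus_measure (torus_partial i (?\<psi> i))" for i
    unfolding torus_partial_def[abs_def]
    by (rule integrable_torus_continuous[OF torus_partial_periodic[OF sm] torus.finite_measure_axioms]) simp
  moreover have "(\<integral>X. torus_partial i (?\<psi> i) X \<partial>torus_measure) = 0" for i
    unfolding torus_partial_def[abs_def]
  proof (rule integral_derivative_zero)
    show "periodic (?\<psi> i \<circ> abs_torus)" unfolding o_def by (rule periodic_abs)
    show "C_k 1 (?\<psi> i \<circ> abs_torus)" using sm unfolding torus_smooth_def by blast
  qed
  ultimately show "(\<integral>X. 1 * directional \<phi> (rep_torus X) \<partial>torus_measure) = 0"
    by (simp add: directional_divergence_form[OF \<phi>])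
qed simp

text \<open>The functions V_i \<phi> are themselves admissible in the definition of the weak
  gradient. Summing over i reproduces \<phi> (V . G), which is zero almost everywhere.\<close>

lemma weakly_invariant_H1:
  assumes H1: "H1_with_gradient w G" and orth: "AE X in torus_measure. V X \<bullet> G X = 0"
  shows "weakly_invariant w"
  unfolding weakly_invariant_def
proof (intro conjI allI impI)
  have w: "torus_L2 w" and G: "torus_L2 G" and grad: "weak_gradient w G"
    using H1 by (auto simp: H1_with_gradient_def)
  show int_w: "integrable torus_measure w"
    by (rule integrable_of_square) (use w in \<open>simp_all add: torus_L2_def\<close>)
  have measG: "G \<in> borel_measurable torus_measure" using G by (simp add: torus_L2_def)
  have "integrable torus_measure (\<lambda>X. norm (G X))"
    by (rule integrable_of_square[OF measurable_compose[OF measG borel_measurable_norm]]) (use G in \<open>simp add: torus_L2_def\<close>)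
  then have int_G: "integrable torus_measure (\<lambda>X. G X $ i)" for i
  proof (rule Bochner_Integration.integrable_bound)
    have "(\<lambda>v::real^2. v $ i) \<in> borel_measurable borel"
      by (intro borel_measurable_continuous_onI continuous_intros)
    from measurable_compose[OF measG this] show "(\<lambda>X. G X $ i) \<in> borel_measurable torus_measure" .
    show "AE X in torus_measure. norm (G X $ i) \<le> norm (norm (G X))"
      by (rule AE_I2) (simp add: component_le_norm_cart)
  qed
  fix \<phi> :: "torus \<Rightarrow> real" assume \<phi>: "torus_smooth \<phi>"
  let ?\<psi> = "\<lambda>i X. V X $ i * \<phi> X"
  note sm = smooth_component_mult[OF \<phi>]
  have int1: "integrable torus_measure (\<lambda>X. w X * torus_partial i (?\<psi> i) X)" for i
    unfolding torus_partial_def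
    by (rule integrable_mult_periodic[OF int_w torus_partial_periodic[OF sm]])
  have int2: "integrable torus_measure (\<lambda>X. G X $ i * ?\<psi> i X)" for i
  proof -
    have "C_k 0 (?\<psi> i \<circ> abs_torus)" using sm unfolding torus_smooth_def by blast
    then have "integrable torus_measure (\<lambda>X. G X $ i * (?\<psi> i \<circ> abs_torus) (rep_torus X))"
      by (intro integrable_mult_periodic int_G) (simp_all add: o_def periodic_abs[where f = "\<lambda>X. V X $ i * \<phi> X"])
    then show ?thesis by simp
  qed
  have "(\<integral>X. w X * directional \<phi> (rep_torus X) \<partial>torus_measure)
      = (\<Sum>i\<in>UNIV. \<integral>X. w X * torus_partial i (?\<psi> i) X \<partial>torus_measure)"
    unfolding directional_divergence_form[OF \<phi>] sum_distrib_left
    by (rule Bochner_Integration.integral_sum) (rule int1)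
  also have "\<dots> = (\<Sum>i\<in>UNIV. - (\<integral>X. G X $ i * ?\<psi> i X \<partial>torus_measure))"
    using grad sm by (simp add: weak_gradient_def)
  also have "\<dots> = - (\<integral>X. (\<Sum>i\<in>UNIV. G X $ i * ?\<psi> i X) \<partial>torus_measure)"
    by (subst Bochner_Integration.integral_sum) (auto intro: int2 simp: sum_negf)
  also have "(\<integral>X. (\<Sum>i\<in>UNIV. G X $ i * ?\<psi> i X) \<partial>torus_measure) = (\<integral>X. 0 \<partial>torus_measure)"
  proof (rule integral_cong_AE)
    show "(\<lambda>X. \<Sum>i\<in>UNIV. G X $ i * ?\<psi> i X) \<in> borel_measurable torus_measure"
      by (rule borel_measurable_integrable) (intro Bochner_Integration.integrable_sum int2)
    have eq: "(\<Sum>i\<in>UNIV. G X $ i * ?\<psi> i X) = (V X \<bullet> G X) * \<phi> X" for X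
      unfolding inner_vec_def sum_distrib_right by (rule sum.cong) (simp_all add: mult_ac)
    show "AE X in torus_measure. (\<Sum>i\<in>UNIV. G X $ i * ?\<psi> i X) = 0"
      unfolding eq using orth by (rule eventually_mono) simp
  qed simp
  finally show "(\<integral>X. w X * directional \<phi> (rep_torus X) \<partial>torus_measure) = 0" by simp
qed

section \<open>From weak invariance to invariance along the flow\<close>

lemma flow_map_linearization: "norm (flow_map h x - x - h *\<^sub>R V (abs_torus x)) \<le> L * C * h\<^sup>2"
  by (rule flow_map_expansion[OF flow_map_derivative less_imp_le[OF L_pos] lift_lipschitz])

text \<open>Extends the defining identity to Lipschitz \<open>g\<close> whose derivative
  \<open>l\<close> along the flow is Lipschitz, the class that composition with the flow preserves.
  Uniform closeness of the directional derivative of a smooth function to \<open>l\<close> is all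
  that the integral sees.\<close>

lemma weakly_invariant_lipschitz:
  assumes w: "weakly_invariant w"
    and per: "periodic g" "periodic l"
    and g: "K \<ge> 0" "\<And>x y. norm (g x - g y) \<le> K * norm (x - y)"
    and l: "M \<ge> 0" "\<And>x y. norm (l x - l y) \<le> M * norm (x - y)"
    and D: "\<And>x h. \<bar>g (flow_map h x) - g x - h * l x\<bar> \<le> B * h\<^sup>2"
  shows "(\<integral>X. w X * l (rep_torus X) \<partial>torus_measure) = 0"
proof (rule ccontr)
  let ?I = "\<integral>X. w X * l (rep_torus X) \<partial>torus_measure"
  assume "?I \<noteq> 0"
  have int_w: "integrable torus_measure w" using w by (simp add: weakly_invariant_def)
  define m where "m = (\<integral>X. \<bar>w X\<bar> \<partial>torus_measure) + 1"
  have "m > 0" unfolding m_def by (intro add_nonneg_pos integral_nonneg_AE) auto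
  define \<epsilon> where "\<epsilon> = \<bar>?I\<bar> / m"
  have "\<epsilon> > 0" using \<open>?I \<noteq> 0\<close> \<open>m > 0\<close> by (simp add: \<epsilon>_def)
  \<comment> \<open>A straight step along the field and the flow differ to second order, so the
    expansion along the flow becomes one along x + h V(x), as mollification requires.\<close>
  have D': "\<bar>g (x + h *\<^sub>R V (abs_torus x)) - g x - h * l x\<bar> \<le> (B + K * (L * C)) * h\<^sup>2" for x h
  proof -
    have "\<bar>g (x + h *\<^sub>R V (abs_torus x)) - g (flow_map h x)\<bar> \<le> K * norm (x + h *\<^sub>R V (abs_torus x) - flow_map h x)"
      using g(2)[of "x + h *\<^sub>R V (abs_torus x)" "flow_map h x"] by simp
    also have "\<dots> \<le> K * (L * C * h\<^sup>2)"
      using flow_map_linearization[of h x] g(1)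
      by (intro mult_left_mono) (simp_all add: norm_minus_commute algebra_simps)
    finally show ?thesis using D[of h x] by (simp add: algebra_simps)
  qed
  obtain \<phi> :: "torus \<Rightarrow> real" where \<phi>: "torus_smooth \<phi>"
    and ap: "\<And>x. \<bar>frechet_derivative (\<phi> \<circ> abs_torus) (at x) (V (abs_torus x)) - l x\<bar> \<le> \<epsilon>"
    by (rule smooth_approx_directional[OF per periodic_W g l less_imp_le[OF L_pos] lift_lipschitz D' \<open>\<epsilon> > 0\<close>])
      (rule that)
  have i1: "integrable torus_measure (\<lambda>X. w X * directional \<phi> (rep_torus X))"
    by (rule integrable_mult_periodic[OF int_w periodic_directional[OF \<phi>] C_k_continuous[OF C_k_directional[OF \<phi>]]])
  have i2: "integrable torus_measure (\<lambda>X. w X * l (rep_torus X))"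
    by (rule integrable_mult_periodic[OF int_w per(2) lipschitz_continuous[OF l(2)]])
  have "?I = ?I - (\<integral>X. w X * directional \<phi> (rep_torus X) \<partial>torus_measure)"
    using w \<phi> by (simp add: weakly_invariant_def)
  also have "\<dots> = (\<integral>X. w X * l (rep_torus X) - w X * directional \<phi> (rep_torus X) \<partial>torus_measure)"
    using i1 i2 by simp
  finally have "\<bar>?I\<bar> \<le> (\<integral>X. \<bar>w X * l (rep_torus X) - w X * directional \<phi> (rep_torus X)\<bar> \<partial>torus_measure)"
    by (simp only: integral_abs_bound)
  also have "\<dots> \<le> (\<integral>X. \<bar>w X\<bar> * \<epsilon> \<partial>torus_measure)"
  proof (rule integral_mono)
    fix X
    have "\<bar>w X\<bar> * \<bar>directional \<phi> (rep_torus X) - l (rep_torus X)\<bar> \<le> \<bar>w X\<bar> * \<epsilon>"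
      using ap[of "rep_torus X"] by (intro mult_left_mono) (simp_all add: directional_def)
    moreover have "w X * l (rep_torus X) - w X * directional \<phi> (rep_torus X)
        = - (w X * (directional \<phi> (rep_torus X) - l (rep_torus X)))"
      by (simp add: algebra_simps)
    ultimately show "\<bar>w X * l (rep_torus X) - w X * directional \<phi> (rep_torus X)\<bar> \<le> \<bar>w X\<bar> * \<epsilon>"
      by (simp add: abs_mult)
  qed (use i1 i2 int_w in auto)
  also have "\<dots> = (m - 1) * \<epsilon>"
    by (simp add: m_def)
  also have "\<dots> < m * \<epsilon>" using \<open>\<epsilon> > 0\<close> by simp
  also have "\<dots> = \<bar>?I\<bar>" using \<open>m > 0\<close> by (simp add: \<epsilon>_def)
  finally show False by simp
qed

lemma directional_derivative:
  assumes "torus_smooth (\<phi> :: torus \<Rightarrow> real)"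
  shows "((\<lambda>t. \<phi> (abs_torus (flow_map t x))) has_vector_derivative directional \<phi> (flow_map t x)) (at t)"
proof -
  have Phi: "C_k (Suc 0) (\<phi> \<circ> abs_torus)" using assms unfolding torus_smooth_def by blast
  interpret linear "frechet_derivative (\<phi> \<circ> abs_torus) (at (flow_map t x))"
    by (rule has_derivative_linear[OF C_k_has_derivative[OF Phi]])
  have "((\<lambda>t. (\<phi> \<circ> abs_torus) (flow_map t x)) has_derivative
      (\<lambda>h. frechet_derivative (\<phi> \<circ> abs_torus) (at (flow_map t x)) (h *\<^sub>R V (abs_torus (flow_map t x))))) (at t)"
    by (rule has_derivative_compose[OF _ C_k_has_derivative[OF Phi]])
      (use flow_map_derivative[of x t] in \<open>simp add: has_vector_derivative_def\<close>)
  then show ?thesis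
    by (simp add: has_vector_derivative_def scaleR directional_def)
qed

lemma weakly_invariant_flow:
  assumes w: "weakly_invariant w" and \<phi>: "torus_smooth (\<phi> :: torus \<Rightarrow> real)"
  shows "(\<integral>X. w X * \<phi> (flow V t X) \<partial>torus_measure) = (\<integral>X. w X * \<phi> X \<partial>torus_measure)"
proof -
  let ?\<phi> = "\<lambda>x. \<phi> (abs_torus x)"
  have int_w: "integrable torus_measure w" using w by (simp add: weakly_invariant_def)
  have perD: "periodic (directional \<phi>)" and contD: "continuous_on UNIV (directional \<phi>)"
    using periodic_directional[OF \<phi>] C_k_continuous[OF C_k_directional[OF \<phi>]] by auto
  have cont: "continuous_on UNIV ?\<phi>" and per: "periodic ?\<phi>"
    using C_k_continuous[OF torus_smooth_lift[OF \<phi>]] periodic_abs by auto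
  obtain K where K: "K > 0" "\<And>x y. norm (?\<phi> x - ?\<phi> y) \<le> K * norm (x - y)"
    by (rule C1_periodic_lipschitz[OF per torus_smooth_lift[OF \<phi>]]) (rule that)
  obtain M where M: "M > 0" "\<And>x y. norm (directional \<phi> x - directional \<phi> y) \<le> M * norm (x - y)"
    by (rule C1_periodic_lipschitz[OF perD C_k_directional[OF \<phi>]]) (rule that)
  have exp: "\<bar>?\<phi> (flow_map h x) - ?\<phi> x - h * directional \<phi> x\<bar> \<le> M * C * h\<^sup>2" for h x
    using flow_map_expansion[OF directional_derivative[OF \<phi>] less_imp_le[OF M(1)] M(2), of h x] by simp
  define a where "a s = (\<integral>X. w X * ?\<phi> (flow_map s (rep_torus X)) \<partial>torus_measure)" for s
  have int: "integrable torus_measure (\<lambda>X. w X * f (flow_map s (rep_torus X)))"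
    if "periodic f" "continuous_on UNIV f" for f :: "real^2 \<Rightarrow> real" and s
  proof (rule integrable_mult_periodic[OF int_w periodic_flow_map[OF that(1)]])
    show "continuous_on UNIV (\<lambda>x. f (flow_map s x))"
      by (rule continuous_on_compose2[OF that(2) continuous_flow_map]) simp
  qed
  \<comment> \<open>By the group law, the test function composed with the time-s flow has derivative
    \<open>directional \<phi>\<close> composed with that flow. Both are Lipschitz with a factor exp
    (L |s|), so the previous lemma applies at every s.\<close>
  have zero: "(\<integral>X. w X * directional \<phi> (flow_map s (rep_torus X)) \<partial>torus_measure) = 0" for s
  proof (rule weakly_invariant_lipschitz[OF w, where g = "\<lambda>x. ?\<phi> (flow_map s x)" and l = "\<lambda>x. directional \<phi> (flow_map s x)"])
    show "periodic (\<lambda>x. ?\<phi> (flow_map s x))" "periodic (\<lambda>x. directional \<phi> (flow_map s x))"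
      by (rule periodic_flow_map[OF per], rule periodic_flow_map[OF perD])
    show "norm (?\<phi> (flow_map s x) - ?\<phi> (flow_map s y)) \<le> (K * exp (L * \<bar>s\<bar>)) * norm (x - y)" for x y
      using order_trans[OF K(2) mult_left_mono[OF flow_map_lipschitz less_imp_le[OF K(1)]]] by (simp add: mult.assoc)
    show "norm (directional \<phi> (flow_map s x) - directional \<phi> (flow_map s y)) \<le> (M * exp (L * \<bar>s\<bar>)) * norm (x - y)" for x y
      using order_trans[OF M(2) mult_left_mono[OF flow_map_lipschitz less_imp_le[OF M(1)]]] by (simp add: mult.assoc)
    show "\<bar>?\<phi> (flow_map s (flow_map h x)) - ?\<phi> (flow_map s x) - h * directional \<phi> (flow_map s x)\<bar> \<le> (M * C) * h\<^sup>2" for x h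
      using exp[of h "flow_map s x"] by (simp add: add.commute flip: flow_map_add)
  qed (use K M in auto)
  have "\<bar>a (s + h) - a s\<bar> \<le> ((\<integral>X. \<bar>w X\<bar> \<partial>torus_measure) * (M * C)) * h\<^sup>2" for s h
  proof -
    have eq: "flow_map (s + h) x = flow_map h (flow_map s x)" for x
      by (simp add: add.commute flip: flow_map_add)
    have "a (s + h) - a s = a (s + h) - a s - h * 0" by simp
    also have "\<dots> = (\<integral>X. w X * ?\<phi> (flow_map (s + h) (rep_torus X)) - w X * ?\<phi> (flow_map s (rep_torus X))
        - h * (w X * directional \<phi> (flow_map s (rep_torus X))) \<partial>torus_measure)"
      unfolding zero[of s, symmetric] a_def
      using int[OF per cont] int[OF perD contD] by simp
    finally have "\<bar>a (s + h) - a s\<bar> \<le> (\<integral>X. \<bar>w X * ?\<phi> (flow_map (s + h) (rep_torus X)) - w X * ?\<phi> (flow_map s (rep_torus X))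
        - h * (w X * directional \<phi> (flow_map s (rep_torus X)))\<bar> \<partial>torus_measure)"
      by (simp only: integral_abs_bound)
    also have "\<dots> \<le> (\<integral>X. \<bar>w X\<bar> * (M * C * h\<^sup>2) \<partial>torus_measure)"
    proof (rule integral_mono)
      fix X
      let ?x = "flow_map s (rep_torus X)"
      have "w X * ?\<phi> (flow_map (s + h) (rep_torus X)) - w X * ?\<phi> ?x - h * (w X * directional \<phi> ?x)
          = w X * (?\<phi> (flow_map h ?x) - ?\<phi> ?x - h * directional \<phi> ?x)"
        unfolding eq by (simp only: right_diff_distrib mult.left_commute)
      then show "\<bar>w X * ?\<phi> (flow_map (s + h) (rep_torus X)) - w X * ?\<phi> ?x - h * (w X * directional \<phi> ?x)\<bar>
          \<le> \<bar>w X\<bar> * (M * C * h\<^sup>2)"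
        using mult_left_mono[OF exp[of h ?x], of "\<bar>w X\<bar>"] by (simp add: abs_mult)
    qed (use int[OF per cont] int[OF perD contD] int_w in auto)
    also have "\<dots> = ((\<integral>X. \<bar>w X\<bar> \<partial>torus_measure) * (M * C)) * h\<^sup>2" by (simp add: mult.assoc)
    finally show ?thesis .
  qed
  then have "a t = a 0" by (rule quadratic_increment_const)
  then show ?thesis
    by (simp add: a_def flow_rep_torus flow_map_0)
qed

lemma distr_flow_torus_measure: "distr torus_measure borel (flow V t) = torus_measure"
proof (rule torus_measure_eqI_smooth)
  have m: "flow V t \<in> measurable torus_measure borel" by measurable
  show "finite_measure (distr torus_measure borel (flow V t))"
    by (rule torus.finite_measure_distr[OF m])
  show "finite_measure torus_measure" by (rule torus.finite_measure_axioms)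
  fix \<phi> :: "torus \<Rightarrow> real" assume \<phi>: "torus_smooth \<phi>"
  have "\<phi> \<in> borel_measurable borel"
    using borel_measurable_rep_torus[OF periodic_abs C_k_continuous[OF torus_smooth_lift[OF \<phi>]]] by simp
  then show "(\<integral>X. \<phi> X \<partial>distr torus_measure borel (flow V t)) = (\<integral>X. \<phi> X \<partial>torus_measure)"
    using weakly_invariant_flow[OF weakly_invariant_const \<phi>, of t] by (simp add: integral_distr[OF m])
qed simp_all

text \<open>The positive and negative parts are densities of two finite measures with the same
  integrals of smooth functions, hence of equal measures. So the parts agree almost everywhere,
  while at each point one of them is zero.\<close>

lemma AE_eq_zero_of_smooth:
  fixes h :: "torus \<Rightarrow> real"
  assumes h: "integrable torus_measure h"
    and zero: "\<And>\<phi>. torus_smooth \<phi> \<Longrightarrow> (\<integral>X. h X * \<phi> X \<partial>torus_measure) = 0"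
  shows "AE X in torus_measure. h X = 0"
proof -
  have [measurable]: "h \<in> borel_measurable borel"
    using borel_measurable_integrable[OF h] by (simp cong: measurable_cong_sets)
  let ?P = "\<lambda>X. max 0 (h X)" and ?N = "\<lambda>X. max 0 (- h X)"
  have iP: "integrable torus_measure ?P" and iN: "integrable torus_measure ?N"
    using h by auto
  have fin: "finite_measure (density torus_measure (\<lambda>X. ennreal (f X)))"
    if "integrable torus_measure f" "\<And>X. 0 \<le> f X" for f
  proof
    have [measurable]: "f \<in> borel_measurable borel"
      using borel_measurable_integrable[OF that(1)] by (simp cong: measurable_cong_sets)
    show "emeasure (density torus_measure (\<lambda>X. ennreal (f X))) (space (density torus_measure (\<lambda>X. ennreal (f X)))) \<noteq> \<infinity>"
      using nn_integral_eq_integral[OF that(1)] that(2) by (simp add: emeasure_density)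
  qed
  have "density torus_measure (\<lambda>X. ennreal (?P X)) = density torus_measure (\<lambda>X. ennreal (?N X))"
  proof (rule torus_measure_eqI_smooth)
    fix \<phi> :: "torus \<Rightarrow> real" assume \<phi>: "torus_smooth \<phi>"
    have [measurable]: "\<phi> \<in> borel_measurable borel"
      using borel_measurable_rep_torus[OF periodic_abs C_k_continuous[OF torus_smooth_lift[OF \<phi>]]] by simp
    have int: "integrable torus_measure (\<lambda>X. f X * \<phi> X)" if "integrable torus_measure f" for f
      using integrable_mult_periodic[OF that periodic_abs C_k_continuous[OF torus_smooth_lift[OF \<phi>]]] by simp
    have "(\<integral>X. ?P X * \<phi> X \<partial>torus_measure) - (\<integral>X. ?N X * \<phi> X \<partial>torus_measure)
        = (\<integral>X. ?P X * \<phi> X - ?N X * \<phi> X \<partial>torus_measure)"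
      using int[OF iP] int[OF iN] by simp
    also have "\<dots> = (\<integral>X. h X * \<phi> X \<partial>torus_measure)"
      by (rule Bochner_Integration.integral_cong) (auto simp: max_def)
    finally have "(\<integral>X. ?P X * \<phi> X \<partial>torus_measure) = (\<integral>X. ?N X * \<phi> X \<partial>torus_measure)"
      using zero[OF \<phi>] by simp
    moreover have "(\<integral>X. \<phi> X \<partial>density torus_measure (\<lambda>X. ennreal (?P X))) = (\<integral>X. ?P X * \<phi> X \<partial>torus_measure)"
      by (subst integral_density) auto
    moreover have "(\<integral>X. \<phi> X \<partial>density torus_measure (\<lambda>X. ennreal (?N X))) = (\<integral>X. ?N X * \<phi> X \<partial>torus_measure)"
      by (subst integral_density) auto
    ultimately show "(\<integral>X. \<phi> X \<partial>density torus_measure (\<lambda>X. ennreal (?P X)))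
        = (\<integral>X. \<phi> X \<partial>density torus_measure (\<lambda>X. ennreal (?N X)))"
      by simp
  qed (use fin[OF iP] fin[OF iN] in simp_all)
  then have "AE X in torus_measure. ennreal (?P X) = ennreal (?N X)"
    by (subst (asm) torus.density_unique_iff) auto
  then show ?thesis
    by (rule eventually_mono) (auto simp: max_def ennreal_eq_0_iff split: if_splits)
qed

text \<open>Since the flow preserves Lebesgue measure, pairing the transported function with \<phi>
  is pairing \<open>w\<close> with \<phi> composed with the inverse flow, which does not change the
  value.\<close>

lemma weakly_invariant_AE:
  assumes w: "weakly_invariant w"
  shows "AE X in torus_measure. w (flow V t X) = w X"
proof -
  have int_w: "integrable torus_measure w" using w by (simp add: weakly_invariant_def)
  have [measurable]: "w \<in> borel_measurable borel"
    using borel_measurable_integrable[OF int_w] by (simp cong: measurable_cong_sets)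
  have m: "flow V t \<in> measurable torus_measure borel" by measurable
  have int: "integrable torus_measure (\<lambda>X. f (flow V t X))" if "integrable torus_measure f" for f :: "torus \<Rightarrow> real"
  proof -
    have "integrable (distr torus_measure borel (flow V t)) f"
      using that by (simp add: distr_flow_torus_measure)
    then show ?thesis by (rule integrable_distr[OF m])
  qed
  have "AE X in torus_measure. w (flow V t X) - w X = 0"
  proof (rule AE_eq_zero_of_smooth)
    show "integrable torus_measure (\<lambda>X. w (flow V t X) - w X)"
      using int[OF int_w] int_w by simp
    fix \<phi> :: "torus \<Rightarrow> real" assume \<phi>: "torus_smooth \<phi>"
    have [measurable]: "\<phi> \<in> borel_measurable borel"
      using borel_measurable_rep_torus[OF periodic_abs C_k_continuous[OF torus_smooth_lift[OF \<phi>]]] by simp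
    have intm: "integrable torus_measure (\<lambda>X. f X * \<phi> X)" if "integrable torus_measure f" for f
      using integrable_mult_periodic[OF that periodic_abs C_k_continuous[OF torus_smooth_lift[OF \<phi>]]] by simp
    have inv: "flow V (- t) (flow V t X) = X" for X
      by (simp add: flow_rep_torus[of t] flow_abs_torus flow_map_inverse)
    have "(\<integral>X. w X * \<phi> (flow V (- t) X) \<partial>torus_measure)
        = (\<integral>X. w X * \<phi> (flow V (- t) X) \<partial>distr torus_measure borel (flow V t))"
      by (simp add: distr_flow_torus_measure)
    also have "\<dots> = (\<integral>X. w (flow V t X) * \<phi> X \<partial>torus_measure)"
      by (subst integral_distr[OF m]) (simp_all add: inv)
    finally have "(\<integral>X. w (flow V t X) * \<phi> X \<partial>torus_measure) = (\<integral>X. w X * \<phi> X \<partial>torus_measure)"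
      using weakly_invariant_flow[OF w \<phi>, of "- t"] by simp
    then show "(\<integral>X. (w (flow V t X) - w X) * \<phi> X \<partial>torus_measure) = 0"
      using intm[OF int[OF int_w]] intm[OF int_w] by (simp add: left_diff_distrib)
  qed
  then show ?thesis by simp
qed

text \<open>Both the density, almost everywhere, and the underlying measure are preserved by the
  flow. This inclusion is the inequality of the supremum by the maximum.\<close>

lemma H1_densities_invariant: "invariant_H1_densities V \<subseteq> invariant_measures V"
proof
  fix \<sigma> assume "\<sigma> \<in> invariant_H1_densities V"
  then obtain w G where \<sigma>: "\<sigma> = density torus_measure (\<lambda>X. ennreal ((w X)\<^sup>2))"
    and one: "(\<integral>X. (w X)\<^sup>2 \<partial>torus_measure) = 1"
    and H1: "H1_with_gradient w G" "AE X in torus_measure. V X \<bullet> G X = 0"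
    by (auto simp: invariant_H1_densities_def)
  have w: "weakly_invariant w" by (rule weakly_invariant_H1[OF H1])
  have [measurable]: "w \<in> borel_measurable borel" and int: "integrable torus_measure (\<lambda>X. (w X)\<^sup>2)"
    using H1 by (auto simp: H1_with_gradient_def torus_L2_def cong: measurable_cong_sets)
  have "prob_space \<sigma>"
  proof
    show "emeasure \<sigma> (space \<sigma>) = 1"
      using nn_integral_eq_integral[OF int] one by (simp add: \<sigma> emeasure_density)
  qed
  moreover have "distr \<sigma> borel (flow V t) = \<sigma>" for t
  proof -
    have "\<sigma> = density torus_measure (\<lambda>X. ennreal ((w (flow V t X))\<^sup>2))"
      unfolding \<sigma>
    proof (rule density_cong)
      show "AE X in torus_measure. ennreal ((w X)\<^sup>2) = ennreal ((w (flow V t X))\<^sup>2)"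
        using weakly_invariant_AE[OF w, of t] by (rule eventually_mono) simp
    qed measurable
    then have "distr \<sigma> borel (flow V t)
        = distr (density torus_measure (\<lambda>X. ennreal ((w (flow V t X))\<^sup>2))) borel (flow V t)"
      by simp
    also have "\<dots> = density (distr torus_measure borel (flow V t)) (\<lambda>X. ennreal ((w X)\<^sup>2))"
      by (rule density_distr[symmetric]) measurable
    finally show ?thesis by (simp add: distr_flow_torus_measure \<sigma>)
  qed
  ultimately show "\<sigma> \<in> invariant_measures V"
    by (simp add: invariant_measures_def \<sigma>)
qed

end

section \<open>The Hamiltonian\<close>

text \<open>The planar determinant. It expresses the Hamiltonian structure without a rotation
  matrix: the derivative of \<open>stream\<close> in direction v is \<open>cross2 v V\<close>, which
  vanishes along the field.\<close>

definition cross2 :: "real^2 \<Rightarrow> real^2 \<Rightarrow> real" where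
  "cross2 v w = v $ 1 * w $ 2 - v $ 2 * w $ 1"

lemma cross2_self [simp]: "cross2 v v = 0"
  by (simp add: cross2_def)

lemma bounded_linear_cross2: "bounded_linear (\<lambda>v. cross2 v w)" "bounded_linear (\<lambda>w. cross2 v w)"
  unfolding cross2_def
  by (auto intro!: bounded_linear_sub bounded_linear_mult_const bounded_linear_const_mult bounded_linear_vec_nth)

lemma abs_cross2_le: "\<bar>cross2 v w\<bar> \<le> 2 * norm v * norm w"
proof -
  have "\<bar>v $ i * w $ j\<bar> \<le> norm v * norm w" for i j
    unfolding abs_mult by (intro mult_mono component_le_norm_cart) auto
  from this[of 1 2] this[of 2 1] show ?thesis
    unfolding cross2_def by linarith
qed

text \<open>Closes the flow box: \<open>u\<close> is a chord parallel to a field vector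
  \<open>w\<close> with positive component along \<open>v\<close>, so orthogonality to
  \<open>v\<close> leaves no room for it. Each component of \<open>u\<close> times v . w is a
  combination of the two equations.\<close>

lemma zero_of_orthogonal_parallel:
  fixes u v w :: "real^2"
  assumes "u \<bullet> v = 0" "cross2 u w = 0" "v \<bullet> w > 0"
  shows "u = 0"
proof -
  have a: "u $ 1 * v $ 1 + u $ 2 * v $ 2 = 0" "u $ 1 * w $ 2 - u $ 2 * w $ 1 = 0"
    and pos: "v $ 1 * w $ 1 + v $ 2 * w $ 2 > 0"
    using assms by (simp_all add: inner_vec_def cross2_def sum_2)
  have "u $ 1 * (v $ 1 * w $ 1 + v $ 2 * w $ 2) = 0" "u $ 2 * (v $ 1 * w $ 1 + v $ 2 * w $ 2) = 0"
    using a by algebra+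
  with pos have "u $ 1 = 0" "u $ 2 = 0" by simp_all
  then show ?thesis by (simp add: vec_eq_iff forall_2)
qed

context torus_field
begin

abbreviation DW :: "real^2 \<Rightarrow> real^2 \<Rightarrow> real^2" where
  "DW x \<equiv> frechet_derivative (\<lambda>x. V (abs_torus x)) (at x)"

lemma DW: "((\<lambda>x. V (abs_torus x)) has_derivative DW x) (at x)"
  by (rule C_k_has_derivative[OF C_k_W])

lemma trace_free: "DW x (axis 1 1) $ 1 + DW x (axis 2 1) $ 2 = 0"
proof -
  have "DW x = DW (rep_torus (abs_torus x))"
    by (rule periodicD[OF periodic_frechet_derivative[OF periodic_W]])
      (rule lattice_rel_sym[OF lattice_rel_rep_abs])
  then show ?thesis
    using divergence_free[of "abs_torus x"] by (simp add: divergence_def torus_partial_def sum_2 o_def)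
qed

text \<open>A trace-free matrix is skew-compatible with the determinant. In terms of forms, this
  says that \<open>cross2 v V\<close> is a closed one-form in v; it is where the divergence
  condition enters the Hamiltonian.\<close>

lemma DW_cross2: "cross2 y (DW x v) = cross2 v (DW x y)"
proof -
  have e: "DW x u = u $ 1 *\<^sub>R DW x (axis 1 1) + u $ 2 *\<^sub>R DW x (axis 2 1)" for u
    using frechet_derivative_expand[OF C_k_W, of x u] by (simp add: sum_2)
  have tr: "DW x (axis 2 1) $ 2 = - DW x (axis 1 1) $ 1" using trace_free[of x] by linarith
  show ?thesis
    unfolding e[of v] e[of y] cross2_def by (simp add: tr algebra_simps)
qed

text \<open>The Hamiltonian of the flow, obtained from the Poincare lemma on the plane.\<close>

definition stream :: "real^2 \<Rightarrow> real" where
  "stream x = integral {0..1} (\<lambda>t. cross2 x (V (abs_torus (t *\<^sub>R x))))"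

text \<open>Differentiating under the integral gives the integrand \<open>h s t\<close>. By the
  symmetry in \<open>DW_cross2\<close> it is the t-derivative of t times \<open>cross2 v\<close> of
  the field at t y, so the fundamental theorem evaluates it at t = 1.\<close>

lemma stream_directional:
  "((\<lambda>s. stream (x + s *\<^sub>R v)) has_real_derivative cross2 v (V (abs_torus (x + s *\<^sub>R v)))) (at s)"
proof -
  let ?y = "\<lambda>s. x + s *\<^sub>R v" and ?W = "\<lambda>x. V (abs_torus x)"
  define h where "h s t = cross2 v (?W (t *\<^sub>R ?y s)) + t * cross2 (?y s) (DW (t *\<^sub>R ?y s) v)" for s t
  have cont_h: "continuous_on (UNIV \<times> cbox 0 1) (\<lambda>(s, t). h s t)"
    unfolding h_def cross2_def split_beta
    by (intro continuous_intros continuous_on_compose2[OF continuous_W]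
        continuous_on_compose2[OF C_k_continuous[OF C_k_frechet_derivative[OF C_k_W]]]) auto
  have "((\<lambda>s. integral (cbox 0 1) (\<lambda>t. cross2 (?y s) (?W (t *\<^sub>R ?y s)))) has_vector_derivative
      integral (cbox 0 1) (h s)) (at s within UNIV)"
  proof (rule leibniz_rule_vector_derivative[OF _ _ cont_h])
    fix s t :: real
    have y: "(?y has_derivative (\<lambda>h. h *\<^sub>R v)) (at s)"
      by (auto intro!: derivative_eq_intros)
    have ty: "((\<lambda>s. t *\<^sub>R ?y s) has_derivative (\<lambda>h. t *\<^sub>R (h *\<^sub>R v))) (at s)"
      by (auto intro!: derivative_eq_intros)
    interpret linear "DW (t *\<^sub>R ?y s)" by (rule has_derivative_linear[OF DW])
    have w: "((\<lambda>s. ?W (t *\<^sub>R ?y s)) has_derivative (\<lambda>h. DW (t *\<^sub>R ?y s) (t *\<^sub>R (h *\<^sub>R v)))) (at s)"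
      by (rule has_derivative_compose[OF ty DW])
    have nth: "((\<lambda>s. f s $ i) has_derivative (\<lambda>h. f' h $ i)) (at s)"
      if "(f has_derivative f') (at s)" for f :: "real \<Rightarrow> real^2" and f' i
      by (rule bounded_linear.has_derivative[OF bounded_linear_vec_nth that])
    have "((\<lambda>s. cross2 (?y s) (?W (t *\<^sub>R ?y s))) has_derivative
       (\<lambda>h. (?y s $ 1 * DW (t *\<^sub>R ?y s) (t *\<^sub>R (h *\<^sub>R v)) $ 2 + (h *\<^sub>R v) $ 1 * ?W (t *\<^sub>R ?y s) $ 2)
         - (?y s $ 2 * DW (t *\<^sub>R ?y s) (t *\<^sub>R (h *\<^sub>R v)) $ 1 + (h *\<^sub>R v) $ 2 * ?W (t *\<^sub>R ?y s) $ 1))) (at s)"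
      unfolding cross2_def by (intro has_derivative_diff has_derivative_mult nth y w)
    moreover have "DW (t *\<^sub>R ?y s) (t *\<^sub>R (h *\<^sub>R v)) = (t * h) *\<^sub>R DW (t *\<^sub>R ?y s) v" for h
      by (simp only: scaleR scaleR_scaleR)
    ultimately have "((\<lambda>s. cross2 (?y s) (?W (t *\<^sub>R ?y s))) has_derivative
       (\<lambda>h. (?y s $ 1 * ((t * h) * DW (t *\<^sub>R ?y s) v $ 2) + h * v $ 1 * ?W (t *\<^sub>R ?y s) $ 2)
         - (?y s $ 2 * ((t * h) * DW (t *\<^sub>R ?y s) v $ 1) + h * v $ 2 * ?W (t *\<^sub>R ?y s) $ 1))) (at s)"
      by (simp only: vector_scaleR_component real_scaleR_def)
    then have "((\<lambda>s. cross2 (?y s) (?W (t *\<^sub>R ?y s))) has_vector_derivative h s t) (at s)"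
      unfolding has_vector_derivative_def
      by (rule has_derivative_eq_rhs) (simp add: fun_eq_iff h_def cross2_def algebra_simps)
    then show "((\<lambda>s. cross2 (?y s) (?W (t *\<^sub>R ?y s))) has_vector_derivative h s t) (at s within UNIV)" by simp
  next
    fix s :: real
    show "(\<lambda>t. cross2 (?y s) (?W (t *\<^sub>R ?y s))) integrable_on cbox 0 1"
      unfolding cross2_def
      by (intro integrable_continuous continuous_intros continuous_on_compose2[OF continuous_W]) auto
  qed auto
  moreover have "integral (cbox 0 1) (h s) = cross2 v (?W (?y s))"
  proof -
    have "(h s has_integral (1 * cross2 v (?W (1 *\<^sub>R ?y s)) - 0 * cross2 v (?W (0 *\<^sub>R ?y s)))) {0..1}"
    proof (rule fundamental_theorem_of_calculus)
      fix t :: real assume "t \<in> {0..1}"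
      interpret linear "DW (t *\<^sub>R ?y s)" by (rule has_derivative_linear[OF DW])
      have "((\<lambda>t. t *\<^sub>R ?y s) has_derivative (\<lambda>h. h *\<^sub>R ?y s)) (at t)"
        by (auto intro!: derivative_eq_intros)
      from has_derivative_compose[OF this DW]
      have "((\<lambda>t. ?W (t *\<^sub>R ?y s)) has_derivative (\<lambda>h. DW (t *\<^sub>R ?y s) (h *\<^sub>R ?y s))) (at t)" .
      from bounded_linear.has_derivative[OF bounded_linear_cross2(2) this]
      have "((\<lambda>t. t * cross2 v (?W (t *\<^sub>R ?y s))) has_derivative
          (\<lambda>h. t * cross2 v (DW (t *\<^sub>R ?y s) (h *\<^sub>R ?y s)) + h * cross2 v (?W (t *\<^sub>R ?y s)))) (at t)"
        by (intro has_derivative_mult has_derivative_ident)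
      moreover have cs: "cross2 v (h *\<^sub>R u) = h * cross2 v u" for h u
        by (simp add: cross2_def algebra_simps)
      have "cross2 v (DW (t *\<^sub>R ?y s) (h *\<^sub>R ?y s)) = h * cross2 v (DW (t *\<^sub>R ?y s) (?y s))" for h
        by (simp only: scaleR cs)
      ultimately have "((\<lambda>t. t * cross2 v (?W (t *\<^sub>R ?y s))) has_derivative
          (\<lambda>h. t * (h * cross2 v (DW (t *\<^sub>R ?y s) (?y s))) + h * cross2 v (?W (t *\<^sub>R ?y s)))) (at t)"
        by (simp only:)
      then have "((\<lambda>t. t * cross2 v (?W (t *\<^sub>R ?y s))) has_vector_derivative h s t) (at t)"
        unfolding has_vector_derivative_def
        by (elim has_derivative_eq_rhs) (simp add: fun_eq_iff h_def DW_cross2[of "?y s"] distrib_left mult.left_commute)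
      then show "((\<lambda>t. t * cross2 v (?W (t *\<^sub>R ?y s))) has_vector_derivative h s t) (at t within {0..1})"
        by (rule has_vector_derivative_at_within)
    qed simp
    then show ?thesis by (simp add: integral_unique)
  qed
  ultimately show ?thesis
    by (simp add: stream_def has_real_derivative_iff_has_vector_derivative)
qed

text \<open>The mean value theorem on the segment and the Lipschitz bound of the field give a
  quadratic remainder that is uniform in the direction, which upgrades directional derivatives to a
  total one.\<close>

lemma stream_has_derivative: "(stream has_derivative (\<lambda>v. cross2 v (V (abs_torus x)))) (at x)"
proof (rule has_derivativeI_sandwich[where e = 1 and H = "\<lambda>y. 2 * L * norm (y - x)"])
  fix y assume "y \<noteq> x"
  let ?v = "y - x"
  let ?g = "\<lambda>s. stream (x + s *\<^sub>R ?v) - s * cross2 ?v (V (abs_torus x))"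
  have D: "(?g has_real_derivative (cross2 ?v (V (abs_torus (x + s *\<^sub>R ?v))) - cross2 ?v (V (abs_torus x)))) (at s)" for s
    by (rule DERIV_cong[OF DERIV_diff[OF stream_directional DERIV_cmult_right[OF DERIV_ident]]]) simp
  obtain s where s: "0 < s" "s < 1"
    "?g 1 - ?g 0 = (1 - 0) * (cross2 ?v (V (abs_torus (x + s *\<^sub>R ?v))) - cross2 ?v (V (abs_torus x)))"
    using MVT2[of 0 1 ?g, OF _ D] by auto
  have "cross2 ?v (V (abs_torus (x + s *\<^sub>R ?v))) - cross2 ?v (V (abs_torus x))
      = cross2 ?v (V (abs_torus (x + s *\<^sub>R ?v)) - V (abs_torus x))"
    by (simp add: cross2_def algebra_simps)
  then have "\<bar>stream y - stream x - cross2 ?v (V (abs_torus x))\<bar>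
      = \<bar>cross2 ?v (V (abs_torus (x + s *\<^sub>R ?v)) - V (abs_torus x))\<bar>"
    using s(3) by simp
  also have "\<dots> \<le> 2 * norm ?v * norm (V (abs_torus (x + s *\<^sub>R ?v)) - V (abs_torus x))"
    by (rule abs_cross2_le)
  also have "\<dots> \<le> 2 * norm ?v * (L * norm (s *\<^sub>R ?v))"
    using lift_lipschitz[of "x + s *\<^sub>R ?v" x] by (intro mult_left_mono) auto
  also have "\<dots> \<le> 2 * norm ?v * (L * norm ?v)"
    using s L_pos by (intro mult_left_mono) (auto intro!: mult_left_le_one_le)
  finally show "norm (stream y - stream x - cross2 ?v (V (abs_torus x))) / norm ?v \<le> 2 * L * norm ?v"
    using \<open>y \<noteq> x\<close> by (simp add: divide_le_eq mult_ac)
next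
  have "((\<lambda>y. 2 * L * norm (y - x)) \<longlongrightarrow> 2 * L * norm (x - x)) (at x within UNIV)"
    by (intro tendsto_intros)
  then show "((\<lambda>y. 2 * L * norm (y - x)) \<longlongrightarrow> 0) (at x)" by simp
qed (auto simp: bounded_linear_cross2)

lemma C_k_stream: "C_k k stream"
proof -
  have eq: "frechet_derivative stream (at x) v = cross2 v (V (abs_torus x))" for x v
    using frechet_derivative_at[OF stream_has_derivative, of x] by (simp add: fun_eq_iff)
  have "C_k (Suc k) stream"
    unfolding C_k.simps(2) eq
    using stream_has_derivative C_k_bounded_linear[OF bounded_linear_cross2(2) C_k_W]
    by (auto simp: differentiable_def)
  then show ?thesis by (rule C_k_Suc_imp)
qed

lemma stream_flow_map: "stream (flow_map t x) = stream x"
proof -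
  have D: "((\<lambda>t. stream (flow_map t x)) has_real_derivative 0) (at t)" for t
  proof -
    have "((\<lambda>t. stream (flow_map t x)) has_derivative
        (\<lambda>h. cross2 (h *\<^sub>R V (abs_torus (flow_map t x))) (V (abs_torus (flow_map t x))))) (at t)"
      using has_derivative_compose[OF _ stream_has_derivative] flow_map_derivative[of x t]
      by (simp add: has_vector_derivative_def)
    then show ?thesis
      unfolding has_field_derivative_def
      by (rule has_derivative_eq_rhs) (simp add: fun_eq_iff cross2_def)
  qed
  have "stream (flow_map t x) = stream (flow_map 0 x)"
    by (rule DERIV_isconst_all[where f = "\<lambda>t. stream (flow_map t x)"]) (use D in blast)
  then show ?thesis by (simp add: flow_map_0)
qed

section \<open>Flow boxes and periodicity of the Hamiltonian\<close>

lemma stream_mean_value: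
  obtains s where "0 < s" "s < 1" "stream y - stream x = cross2 (y - x) (V (abs_torus (x + s *\<^sub>R (y - x))))"
  using MVT2[of 0 1 "\<lambda>s. stream (x + s *\<^sub>R (y - x))", OF _ stream_directional] by auto

text \<open>Near \<open>z\<close> the field keeps a definite component along its value v at
  \<open>z\<close>. Following the orbit, the v-component of the displacement increases, so some time
  matches that of \<open>y\<close>. The chord from this point to \<open>y\<close> is orthogonal to v
  and, the levels being equal, parallel to a nearby field vector; hence it is zero. The radius
  depends only on \<epsilon>.\<close>

lemma flow_box:
  assumes "\<epsilon> > 0"
  obtains r where "r > 0"
    "\<And>z y. \<epsilon> \<le> norm (V (abs_torus z)) \<Longrightarrow> norm (y - z) < r \<Longrightarrow> stream y = stream z \<Longrightarrow>
      \<exists>s. \<bar>s\<bar> \<le> 1 / 2 \<and> y = flow_map s z"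
proof -
  \<comment> \<open>Within \<rho> the field varies by at most \<epsilon> / 2; in time
    \<open>s0\<close> the orbit stays within \<rho>; and \<open>r\<close> is so small that the
    v-component of any admissible \<open>y\<close> is at most s0 \<epsilon>^2 / 2, which the orbit
    attains by then in either direction.\<close>
  define \<rho> where "\<rho> = \<epsilon> / (2 * L)"
  define s0 where "s0 = min (1 / 2) (\<rho> / C)"
  define r where "r = min \<rho> (s0 * \<epsilon>\<^sup>2 / (2 * C))"
  have "\<rho> > 0" using assms L_pos by (simp add: \<rho>_def)
  then have "s0 > 0" using C_pos by (simp add: s0_def)
  have s0: "s0 \<le> 1 / 2" "C * s0 \<le> \<rho>"
    using C_pos by (auto simp: s0_def min_def field_simps)
  have "r > 0" using \<open>\<rho> > 0\<close> \<open>s0 > 0\<close> C_pos assms by (simp add: r_def)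
  have Cr: "C * r \<le> s0 * (\<epsilon>\<^sup>2 / 2)" "r \<le> \<rho>"
    using C_pos by (auto simp: r_def min_def field_simps)
  have "\<exists>s. \<bar>s\<bar> \<le> 1 / 2 \<and> y = flow_map s z"
    if z: "\<epsilon> \<le> norm (V (abs_torus z))" and y: "norm (y - z) < r" and eq: "stream y = stream z" for z y
  proof -
    define v where "v = V (abs_torus z)"
    have v: "\<epsilon> \<le> norm v" "norm v \<le> C" using z lift_bounded by (auto simp: v_def)
    have vW: "v \<bullet> V (abs_torus \<zeta>) \<ge> \<epsilon>\<^sup>2 / 2" if "norm (\<zeta> - z) \<le> \<rho>" for \<zeta>
    proof -
      have "norm (V (abs_torus \<zeta>) - v) \<le> L * \<rho>"
        using order_trans[OF lift_lipschitz mult_left_mono[OF that less_imp_le[OF L_pos]]] by (simp add: v_def)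
      also have "\<dots> = \<epsilon> / 2" using L_pos by (simp add: \<rho>_def)
      finally have n: "norm (V (abs_torus \<zeta>) - v) \<le> norm v / 2" using v by simp
      have "\<bar>v \<bullet> (V (abs_torus \<zeta>) - v)\<bar> \<le> norm v * (norm v / 2)"
        using order_trans[OF Cauchy_Schwarz_ineq2 mult_left_mono[OF n norm_ge_zero]] .
      moreover have "v \<bullet> (V (abs_torus \<zeta>) - v) = v \<bullet> V (abs_torus \<zeta>) - (norm v)\<^sup>2"
        by (simp add: inner_diff_right dot_square_norm)
      moreover have "norm v * (norm v / 2) = (norm v)\<^sup>2 / 2"
        by (simp add: power2_eq_square)
      ultimately have "v \<bullet> V (abs_torus \<zeta>) \<ge> (norm v)\<^sup>2 / 2"
        by linarith
      moreover have "\<epsilon>\<^sup>2 \<le> (norm v)\<^sup>2" using v assms by (intro power_mono) auto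
      ultimately show ?thesis by simp
    qed
    define g where "g s = v \<bullet> (flow_map s z - z)" for s
    have dg: "(g has_real_derivative v \<bullet> V (abs_torus (flow_map s z))) (at s)" for s
    proof -
      have "((\<lambda>s. flow_map s z - z) has_derivative (\<lambda>h. h *\<^sub>R V (abs_torus (flow_map s z)))) (at s)"
        using flow_map_derivative[of z s] by (auto simp: has_vector_derivative_def intro!: derivative_eq_intros)
      from bounded_linear.has_derivative[OF bounded_linear_inner_right this, of v]
      show ?thesis
        unfolding has_field_derivative_def g_def
        by (rule has_derivative_eq_rhs) (simp add: fun_eq_iff mult.commute)
    qed
    have near: "norm (flow_map s z - z) \<le> \<rho>" if "\<bar>s\<bar> \<le> s0" for s
      using flow_map_speed[of s z] mult_left_mono[OF that less_imp_le[OF C_pos]] s0(2) by linarith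
    have dg': "((\<lambda>s. g s - s * (\<epsilon>\<^sup>2 / 2)) has_real_derivative
        (v \<bullet> V (abs_torus (flow_map s z)) - \<epsilon>\<^sup>2 / 2)) (at s)" for s
      by (rule DERIV_cong[OF DERIV_diff[OF dg DERIV_cmult_right[OF DERIV_ident]]]) simp
    have mono: "g a - a * (\<epsilon>\<^sup>2 / 2) \<le> g b - b * (\<epsilon>\<^sup>2 / 2)" if "- s0 \<le> a" "a \<le> b" "b \<le> s0" for a b
    proof (rule DERIV_nonneg_imp_nondecreasing[where f = "\<lambda>s. g s - s * (\<epsilon>\<^sup>2 / 2)", OF that(2)])
      fix s assume "a \<le> s" "s \<le> b"
      then have "\<bar>s\<bar> \<le> s0" using that by auto
      then show "\<exists>d. ((\<lambda>s. g s - s * (\<epsilon>\<^sup>2 / 2)) has_real_derivative d) (at s) \<and> 0 \<le> d"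
        using dg'[of s] vW[OF near, of s] by (intro exI[of _ "v \<bullet> V (abs_torus (flow_map s z)) - \<epsilon>\<^sup>2 / 2"]) simp
    qed
    have g0: "g 0 = 0" by (simp add: g_def flow_map_0)
    define c where "c = v \<bullet> (y - z)"
    have "\<bar>c\<bar> \<le> C * r"
      unfolding c_def using order_trans[OF Cauchy_Schwarz_ineq2 mult_mono[OF v(2) less_imp_le[OF y]]] C_pos by simp
    then have c: "\<bar>c\<bar> \<le> s0 * (\<epsilon>\<^sup>2 / 2)" using Cr by simp
    have "\<exists>s\<ge>- s0. s \<le> s0 \<and> g s = c"
    proof (rule IVT')
      show "g (- s0) \<le> c" using mono[of "- s0" 0] \<open>s0 > 0\<close> g0 c by simp
      show "c \<le> g s0" using mono[of 0 s0] \<open>s0 > 0\<close> g0 c by simp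
      show "continuous_on {- s0..s0} g"
        by (intro continuous_at_imp_continuous_on ballI DERIV_isCont[OF dg])
    qed (use \<open>s0 > 0\<close> in simp)
    then obtain s where "- s0 \<le> s" "s \<le> s0" "g s = c" by blast
    then have s: "\<bar>s\<bar> \<le> s0" "g s = c" by auto
    let ?q = "flow_map s z"
    obtain \<theta> where \<theta>: "0 < \<theta>" "\<theta> < 1"
      "stream y - stream ?q = cross2 (y - ?q) (V (abs_torus (?q + \<theta> *\<^sub>R (y - ?q))))"
      by (rule stream_mean_value)
    let ?\<zeta> = "?q + \<theta> *\<^sub>R (y - ?q)"
    have "?\<zeta> \<in> cball z \<rho>"
    proof -
      have "?q \<in> cball z \<rho>" "y \<in> cball z \<rho>"
        using near[OF s(1)] y Cr(2) by (auto simp: dist_norm norm_minus_commute)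
      then have "(1 - \<theta>) *\<^sub>R ?q + \<theta> *\<^sub>R y \<in> cball z \<rho>"
        using \<theta> by (intro convexD[OF convex_cball]) auto
      then show ?thesis by (simp add: algebra_simps)
    qed
    then have "norm (?\<zeta> - z) \<le> \<rho>"
      by (simp only: mem_cball dist_norm norm_minus_commute)
    then have "\<epsilon>\<^sup>2 / 2 \<le> v \<bullet> V (abs_torus ?\<zeta>)" by (rule vW)
    moreover have "\<epsilon>\<^sup>2 / 2 > 0" using assms by simp
    ultimately have "v \<bullet> V (abs_torus ?\<zeta>) > 0" by linarith
    moreover have "(y - ?q) \<bullet> v = 0"
      using s(2) by (simp add: g_def c_def inner_diff_right inner_commute)
    moreover have "cross2 (y - ?q) (V (abs_torus ?\<zeta>)) = 0"
      using \<theta>(3) eq by (simp add: stream_flow_map)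
    ultimately have "y - ?q = 0" by (intro zero_of_orthogonal_parallel)
    with s s0 show ?thesis by (intro exI[of _ s]) auto
  qed
  with \<open>r > 0\<close> that show thesis by blast
qed

end

locale hamiltonian_field = torus_field +
  assumes mean_zero: "(\<integral>X. V X \<partial>torus_measure) = 0"
begin

text \<open>The increment of the Hamiltonian along a lattice vector is the flux of the field, hence zero.\<close>

lemma periodic_stream: "periodic stream"
proof -
  have per: "stream (x + u) = stream x" if u: "\<And>i. u $ i \<in> \<int>" for x u
  proof -
    have shift: "stream (x + v) - stream x = stream (y + v) - stream y" if v: "\<And>i. v $ i \<in> \<int>" for v x y
    proof -
      have D: "((\<lambda>x. stream (x + v) - stream x) has_derivative (\<lambda>v. 0)) (at x)" for x
      proof -
        have "((\<lambda>x. stream (x + v)) has_derivative (\<lambda>w. cross2 w (V (abs_torus (x + v))))) (at x)"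
          by (rule has_derivative_compose[OF _ stream_has_derivative]) (auto intro!: derivative_eq_intros)
        moreover have "abs_torus (x + v) = abs_torus x"
          using v by (simp add: abs_torus_eq_iff lattice_rel_def)
        ultimately show ?thesis
          using has_derivative_diff[OF _ stream_has_derivative[of x],
              of "\<lambda>x. stream (x + v)" "\<lambda>w. cross2 w (V (abs_torus (x + v)))"] by simp
      qed
      have "\<exists>k. \<forall>x\<in>UNIV. stream (x + v) - stream x = k"
        by (rule has_derivative_zero_constant) (auto intro: D)
      then show ?thesis by auto
    qed
    \<comment> \<open>A homotopy from 0 at s = 0 to the increment along \<open>u\<close> at s = 1.
      Its mean over the torus has s-derivative \<open>cross2 u\<close> of the mean field, which is
      zero; at s = 1 the function is constant, so its mean is its value.\<close>
    define F where "F s y = stream (y + s *\<^sub>R u) - stream y" for s y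
    have perF: "periodic (F s)" for s
      unfolding periodic_def
    proof (intro allI impI)
      fix y z :: "real^2" assume "lattice_rel y z"
      then have "stream (z + (y - z)) - stream z = stream ((z + s *\<^sub>R u) + (y - z)) - stream (z + s *\<^sub>R u)"
        by (intro shift) (simp add: lattice_rel_def)
      then show "F s y = F s z" by (simp add: F_def algebra_simps)
    qed
    have cont: "continuous_on UNIV stream" by (rule C_k_continuous[OF C_k_stream])
    have contF: "continuous_on UNIV (F s)" for s
      unfolding F_def
      by (intro continuous_on_diff cont continuous_on_compose2[OF cont, of _ "\<lambda>y. y + s *\<^sub>R u"]) (auto intro: continuous_intros)
    define W' where "W' s y = cross2 u (V (abs_torus (y + s *\<^sub>R u)))" for s y
    have perW: "periodic (W' s)" for s
      unfolding W'_def by (intro periodic_comp[OF periodic_translate[OF periodic_W]])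
    have contVs: "continuous_on UNIV (\<lambda>y. V (abs_torus (y + s *\<^sub>R u)))" for s
      by (rule continuous_on_compose2[OF continuous_W[of UNIV]]) (auto intro: continuous_intros)
    have contW: "continuous_on UNIV (W' s)" for s
      unfolding W'_def by (rule bounded_linear.continuous_on[OF bounded_linear_cross2(2) contVs])
    have int: "integrable torus_measure (\<lambda>X. f (rep_torus X))" if "periodic f" "continuous_on UNIV f" for f :: "real^2 \<Rightarrow> real"
      by (rule integrable_torus_continuous[OF that torus.finite_measure_axioms]) simp
    have zero: "(\<integral>X. W' s (rep_torus X) \<partial>torus_measure) = 0" for s
    proof -
      have "(\<integral>X. W' s (rep_torus X) \<partial>torus_measure)
          = cross2 u (\<integral>X. V (abs_torus (rep_torus X + s *\<^sub>R u)) \<partial>torus_measure)"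
        unfolding W'_def
        by (rule integral_bounded_linear[OF bounded_linear_cross2(2)],
            rule integrable_torus_continuous[OF periodic_translate[OF periodic_W] contVs torus.finite_measure_axioms]) simp
      also have "(\<integral>X. V (abs_torus (rep_torus X + s *\<^sub>R u)) \<partial>torus_measure) = 0"
        using integral_torus_translate[OF periodic_W continuous_W, of "s *\<^sub>R u"] mean_zero by simp
      finally show ?thesis by (simp add: cross2_def)
    qed
    define a where "a s = (\<integral>X. F s (rep_torus X) \<partial>torus_measure)" for s
    have "\<bar>a (s + h) - a s\<bar> \<le> (2 * norm u * (L * norm u)) * h\<^sup>2" for s h
    proof -
      have b: "\<bar>F (s + h) y - F s y - h * W' s y\<bar> \<le> (2 * norm u * (L * norm u)) * h\<^sup>2" for y
      proof -
        let ?y = "y + s *\<^sub>R u"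
        obtain \<theta> where \<theta>: "0 < \<theta>" "\<theta> < 1"
          "stream (?y + h *\<^sub>R u) - stream ?y = cross2 (?y + h *\<^sub>R u - ?y) (V (abs_torus (?y + \<theta> *\<^sub>R (?y + h *\<^sub>R u - ?y))))"
          by (rule stream_mean_value)
        let ?d = "V (abs_torus (?y + \<theta> *\<^sub>R (h *\<^sub>R u))) - V (abs_torus ?y)"
        have "F (s + h) y - F s y - h * W' s y = h * cross2 u ?d"
          using \<theta>(3) by (simp add: F_def W'_def cross2_def algebra_simps)
        then have "\<bar>F (s + h) y - F s y - h * W' s y\<bar> \<le> \<bar>h\<bar> * (2 * norm u * norm ?d)"
          using mult_left_mono[OF abs_cross2_le, of "\<bar>h\<bar>" u ?d] by (simp add: abs_mult)
        also have "\<dots> \<le> \<bar>h\<bar> * (2 * norm u * (L * norm (\<theta> *\<^sub>R (h *\<^sub>R u))))"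
          using lift_lipschitz[of "?y + \<theta> *\<^sub>R (h *\<^sub>R u)" ?y] by (intro mult_left_mono) auto
        also have "\<dots> \<le> \<bar>h\<bar> * (2 * norm u * (L * (\<bar>h\<bar> * norm u)))"
        proof -
          have "norm (\<theta> *\<^sub>R (h *\<^sub>R u)) \<le> \<bar>h\<bar> * norm u"
            using \<theta> mult_left_le_one_le[of "\<bar>h\<bar> * norm u" \<theta>] by (simp add: abs_mult mult.assoc)
          then show ?thesis using L_pos by (intro mult_left_mono) auto
        qed
        also have "\<dots> = (2 * norm u * (L * norm u)) * h\<^sup>2"
          by (simp add: power2_eq_square)
        finally show ?thesis .
      qed
      have "a (s + h) - a s = a (s + h) - a s - h * 0" by simp
      also have "\<dots> = (\<integral>X. F (s + h) (rep_torus X) - F s (rep_torus X) - h * W' s (rep_torus X) \<partial>torus_measure)"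
        unfolding zero[of s, symmetric] a_def
        using int[OF perF contF] int[OF perW contW] by simp
      finally have "\<bar>a (s + h) - a s\<bar>
          \<le> (\<integral>X. \<bar>F (s + h) (rep_torus X) - F s (rep_torus X) - h * W' s (rep_torus X)\<bar> \<partial>torus_measure)"
        by (simp only: integral_abs_bound)
      also have "\<dots> \<le> (\<integral>X. (2 * norm u * (L * norm u)) * h\<^sup>2 \<partial>torus_measure)"
        using int[OF perF contF] int[OF perW contW] by (intro integral_mono b) auto
      also have "\<dots> = (2 * norm u * (L * norm u)) * h\<^sup>2"
        using torus.prob_space by simp
      finally show ?thesis .
    qed
    then have "a 1 = a 0" by (rule quadratic_increment_const)
    moreover have "F 1 y = stream (x + u) - stream x" "F 0 y = 0" for y
      using shift[OF u, of y x] by (simp_all add: F_def)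
    ultimately show ?thesis using torus.prob_space by (simp add: a_def)
  qed
  show ?thesis
    unfolding periodic_def lattice_rel_def
  proof (intro allI impI)
    fix x y :: "real^2" assume "\<forall>i. x $ i - y $ i \<in> \<int>"
    then show "stream x = stream y"
      using per[of "x - y" y] by simp
  qed
qed

end

section \<open>Drift and periodic orbits\<close>

context hamiltonian_field
begin

definition drift :: "real^2 \<Rightarrow> real \<Rightarrow> real^2 \<Rightarrow> real" where
  "drift p t x = p \<bullet> (flow_map t x - x)"

lemma periodic_drift: "periodic (drift p t)"
  unfolding periodic_def drift_def using flow_map_lattice[of _ _ t] by simp

lemma continuous_drift: "continuous_on S (drift p t)"
  unfolding drift_def by (intro continuous_intros continuous_flow_map)

lemma drift_add: "drift p (s + t) x = drift p s (flow_map t x) + drift p t x"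
  by (simp add: drift_def flow_map_add inner_diff_right)

lemma drift_0: "drift p 0 x = 0"
  by (simp add: drift_def flow_map_0)

lemma abs_drift_le: "\<bar>drift p t x\<bar> \<le> norm p * C * \<bar>t\<bar>"
  unfolding drift_def
  using order_trans[OF Cauchy_Schwarz_ineq2 mult_left_mono[OF flow_map_speed norm_ge_zero]] by (simp add: mult.assoc)

lemma drift_lipschitz: "\<bar>drift p t x - drift p t y\<bar> \<le> norm p * (exp (L * \<bar>t\<bar>) + 1) * norm (x - y)"
proof -
  have "drift p t x - drift p t y = p \<bullet> ((flow_map t x - flow_map t y) - (x - y))"
    by (simp add: drift_def inner_diff_right)
  then have "\<bar>drift p t x - drift p t y\<bar> \<le> norm p * norm ((flow_map t x - flow_map t y) - (x - y))"
    by (simp only: Cauchy_Schwarz_ineq2)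
  also have "\<dots> \<le> norm p * (exp (L * \<bar>t\<bar>) * norm (x - y) + norm (x - y))"
    using norm_triangle_ineq4[of "flow_map t x - flow_map t y" "x - y"] flow_map_lipschitz[of t x y]
    by (intro mult_left_mono) auto
  finally show ?thesis by (simp add: algebra_simps)
qed

text \<open>Invariance makes the mean drift additive in time by the cocycle rule
  \<open>drift_add\<close>, and the linearised flow identifies its slope. After subtracting the
  linear function the increments are quadratic.\<close>

lemma invariant_integral_drift:
  assumes "\<sigma> \<in> invariant_measures V"
  shows "(\<integral>X. drift p t (rep_torus X) \<partial>\<sigma>) = t * (\<integral>X. p \<bullet> V X \<partial>\<sigma>)"
proof -
  interpret \<sigma>: prob_space \<sigma> using assms by (simp add: invariant_measures_def)
  have sets: "sets \<sigma> = sets borel" and inv: "\<And>t. distr \<sigma> borel (flow V t) = \<sigma>"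
    using assms by (auto simp: invariant_measures_def)
  have int: "integrable \<sigma> (\<lambda>X. f (rep_torus X))" if "periodic f" "continuous_on UNIV f" for f :: "real^2 \<Rightarrow> real"
    by (rule integrable_torus_continuous[OF that \<sigma>.finite_measure_axioms sets])
  define d where "d t = (\<integral>X. drift p t (rep_torus X) \<partial>\<sigma>)" for t
  define m where "m = (\<integral>X. p \<bullet> V X \<partial>\<sigma>)"
  have per_f: "periodic (\<lambda>x. p \<bullet> V (abs_torus x))" and cont_f: "continuous_on UNIV (\<lambda>x. p \<bullet> V (abs_torus x))"
    by (rule periodic_comp[OF periodic_W], intro continuous_intros continuous_W)
  have d_add: "d (s + t) = d s + d t" for s t
  proof -
    have "d s = (\<integral>X. drift p s (rep_torus X) \<partial>distr \<sigma> borel (flow V t))"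
      by (simp add: inv d_def)
    also have "\<dots> = (\<integral>X. drift p s (rep_torus (flow V t X)) \<partial>\<sigma>)"
    proof (rule integral_distr)
      show "flow V t \<in> measurable \<sigma> borel"
        using measurable_flow sets by (simp cong: measurable_cong_sets)
      show "(\<lambda>X. drift p s (rep_torus X)) \<in> borel_measurable borel"
        by (rule borel_measurable_rep_torus[OF periodic_drift continuous_drift])
    qed
    also have "\<dots> = (\<integral>X. drift p s (flow_map t (rep_torus X)) \<partial>\<sigma>)"
      by (simp add: lift_flow[OF periodic_drift])
    finally have "d s = (\<integral>X. drift p s (flow_map t (rep_torus X)) \<partial>\<sigma>)" .
    moreover have "integrable \<sigma> (\<lambda>X. drift p s (flow_map t (rep_torus X)))"
      by (rule int[OF periodic_flow_map[OF periodic_drift]])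
        (rule continuous_on_compose2[OF continuous_drift[of UNIV] continuous_flow_map], simp)
    ultimately show ?thesis
      using int[OF periodic_drift continuous_drift, of p t] by (simp add: d_def drift_add)
  qed
  have "\<bar>(d (s + h) - (s + h) * m) - (d s - s * m)\<bar> \<le> (norm p * (L * C)) * h\<^sup>2" for s h
  proof -
    have "(d (s + h) - (s + h) * m) - (d s - s * m) = d h - h * m"
      by (simp add: d_add algebra_simps)
    also have "\<dots> = (\<integral>X. drift p h (rep_torus X) - h * (p \<bullet> V X) \<partial>\<sigma>)"
      using int[OF periodic_drift continuous_drift, of p h] int[OF per_f cont_f] by (simp add: d_def m_def)
    finally have "\<bar>(d (s + h) - (s + h) * m) - (d s - s * m)\<bar> \<le> (\<integral>X. \<bar>drift p h (rep_torus X) - h * (p \<bullet> V X)\<bar> \<partial>\<sigma>)"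
      by (simp only: integral_abs_bound)
    also have "\<dots> \<le> (\<integral>X. (norm p * (L * C)) * h\<^sup>2 \<partial>\<sigma>)"
    proof (rule integral_mono)
      fix X
      let ?x = "rep_torus X"
      have "drift p h ?x - h * (p \<bullet> V X) = p \<bullet> (flow_map h ?x - ?x - h *\<^sub>R V (abs_torus ?x))"
        by (simp add: drift_def inner_diff_right)
      then have "\<bar>drift p h ?x - h * (p \<bullet> V X)\<bar> \<le> norm p * norm (flow_map h ?x - ?x - h *\<^sub>R V (abs_torus ?x))"
        by (simp only: Cauchy_Schwarz_ineq2)
      also have "\<dots> \<le> norm p * (L * C * h\<^sup>2)"
        by (intro mult_left_mono flow_map_linearization) simp
      finally show "\<bar>drift p h ?x - h * (p \<bullet> V X)\<bar> \<le> (norm p * (L * C)) * h\<^sup>2"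
        by (simp add: mult.assoc)
    qed (use int[OF periodic_drift continuous_drift, of p h] int[OF per_f cont_f] in auto)
    finally show ?thesis using \<sigma>.prob_space by simp
  qed
  then have "d t - t * m = d 0 - 0 * m"
    by (rule quadratic_increment_const[where a = "\<lambda>s. d s - s * m"])
  then show ?thesis by (simp add: d_def m_def drift_0)
qed

text \<open>Each time horizon separately bounds the means of all invariant measures, so the infimum
  is the sharpest bound of this kind. Using \<open>Suc n\<close> keeps the divisor positive.\<close>

definition max_drift :: "real^2 \<Rightarrow> real" where
  "max_drift p = (INF n::nat. (SUP x. drift p (real (Suc n)) x) / real (Suc n))"

lemma drift_bdd_above: "bdd_above (range (drift p t))"
  using abs_drift_le[of p t] by (intro bdd_aboveI[of _ "norm p * C * \<bar>t\<bar>"]) (auto simp: abs_le_iff)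

lemma max_drift_bdd_below: "bdd_below (range (\<lambda>n::nat. (SUP x. drift p (real (Suc n)) x) / real (Suc n)))"
proof (rule bdd_belowI2)
  fix n
  have "- (norm p * C * \<bar>real (Suc n)\<bar>) \<le> drift p (real (Suc n)) 0"
    using abs_drift_le[of p "real (Suc n)" 0] by (simp add: abs_le_iff)
  also have "\<dots> \<le> (SUP x. drift p (real (Suc n)) x)"
    by (rule cSUP_upper[OF UNIV_I drift_bdd_above])
  finally show "- (norm p * C) \<le> (SUP x. drift p (real (Suc n)) x) / real (Suc n)"
    by (simp add: le_divide_eq)
qed

lemma invariant_integral_le_max_drift:
  assumes "\<sigma> \<in> invariant_measures V"
  shows "(\<integral>X. p \<bullet> V X \<partial>\<sigma>) \<le> max_drift p"
  unfolding max_drift_def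
proof (rule cINF_greatest)
  fix n :: nat
  interpret \<sigma>: prob_space \<sigma> using assms by (simp add: invariant_measures_def)
  have sets: "sets \<sigma> = sets borel" using assms by (auto simp: invariant_measures_def)
  have "real (Suc n) * (\<integral>X. p \<bullet> V X \<partial>\<sigma>) = (\<integral>X. drift p (real (Suc n)) (rep_torus X) \<partial>\<sigma>)"
    by (rule invariant_integral_drift[OF assms, symmetric])
  also have "\<dots> \<le> (\<integral>X. (SUP x. drift p (real (Suc n)) x) \<partial>\<sigma>)"
    by (intro integral_mono cSUP_upper[OF UNIV_I drift_bdd_above]
        integrable_torus_continuous[OF periodic_drift continuous_drift \<sigma>.finite_measure_axioms sets]) simp
  also have "\<dots> = (SUP x. drift p (real (Suc n)) x)"
    using \<sigma>.prob_space by simp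
  finally show "(\<integral>X. p \<bullet> V X \<partial>\<sigma>) \<le> (SUP x. drift p (real (Suc n)) x) / real (Suc n)"
    by (simp add: le_divide_eq mult.commute)
qed simp

lemma max_drift_attained: "\<exists>x. max_drift p * real n \<le> drift p (real n) x"
proof (cases n)
  case 0
  then show ?thesis by (simp add: drift_0)
next
  case (Suc m)
  have "cbox 0 (1::real^2) \<noteq> {}" by (simp add: interval_eq_empty_cart)
  from continuous_attains_sup[OF compact_cbox this continuous_drift[of _ p "real n"]]
  obtain x where x: "\<And>y. y \<in> cbox 0 1 \<Longrightarrow> drift p (real n) y \<le> drift p (real n) x"
    by blast
  have "drift p (real n) y \<le> drift p (real n) x" for y
  proof -
    obtain z where "z \<in> unit_cell" "lattice_rel y z" by (rule lattice_rel_unit_cell)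
    then show ?thesis
      using x[of z] periodicD[OF periodic_drift] unit_cell_subset by (metis subsetD)
  qed
  then have "(SUP y. drift p (real n) y) \<le> drift p (real n) x" by (intro cSUP_least) auto
  moreover have "max_drift p \<le> (SUP y. drift p (real n) y) / real n"
    unfolding max_drift_def Suc by (rule cINF_lower[OF max_drift_bdd_below]) simp
  ultimately have "max_drift p * real n \<le> drift p (real n) x"
    using Suc by (simp add: le_divide_eq)
  then show ?thesis by blast
qed

text \<open>Peres' lemma: without such an orbit, compactness gives a uniform loss over bounded time blocks,
  which accumulates.\<close>

lemma max_drift_orbit: "\<exists>x. \<forall>n. max_drift p * real n \<le> drift p (real n) x"
proof (rule ccontr)
  let ?M = "max_drift p"
  assume "\<not> ?thesis"
  then have neg: "\<exists>n. drift p (real n) x < ?M * real n" for x by (auto simp: not_le)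
  \<comment> \<open>One index bounds both the waiting time and the size of the shortfall, so the
    sets increase with \<open>j\<close> and a finite subcover collapses to a single member.\<close>
  define U where "U j = (\<Union>n\<in>{..j}. {x. drift p (real n) x < ?M * real n - inverse (real (Suc j))})" for j :: nat
  have openU: "open (U j)" for j
    unfolding U_def by (intro open_UN ballI open_Collect_less continuous_drift continuous_on_const)
  have monoU: "U i \<subseteq> U j" if "i \<le> j" for i j
  proof -
    have le: "inverse (real (Suc j)) \<le> inverse (real (Suc i))" using that by (simp add: field_simps)
    show ?thesis
    proof
      fix x assume "x \<in> U i"
      then obtain n where "n \<le> i" and n: "drift p (real n) x < ?M * real n - inverse (real (Suc i))"
        unfolding U_def by blast
      have "drift p (real n) x < ?M * real n - inverse (real (Suc j))" using n le by linarith
      with \<open>n \<le> i\<close> that show "x \<in> U j" unfolding U_def by (intro UN_I[of n]) auto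
    qed
  qed
  have "cbox 0 1 \<subseteq> (\<Union>j. U j)"
  proof
    fix x :: "real^2"
    obtain n where n: "drift p (real n) x < ?M * real n" using neg by blast
    obtain k where k: "inverse (real (Suc k)) < ?M * real n - drift p (real n) x"
      using reals_Archimedean[of "?M * real n - drift p (real n) x"] n by auto
    have "inverse (real (Suc (max n k))) \<le> inverse (real (Suc k))" by (simp add: field_simps)
    with k have "drift p (real n) x < ?M * real n - inverse (real (Suc (max n k)))" by linarith
    then have "x \<in> U (max n k)" unfolding U_def by (intro UN_I[of n]) auto
    then show "x \<in> (\<Union>j. U j)" by blast
  qed
  then obtain D where D: "finite D" "cbox 0 1 \<subseteq> (\<Union>j\<in>D. U j)"
    using compactE_image[OF compact_cbox, of UNIV U 0 1] openU by auto
  \<comment> \<open>Inserting 1 makes \<open>Max\<close> meaningful for empty \<open>D\<close> and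
    keeps \<open>j\<close> positive for the division below.\<close>
  define j where "j = Max (insert 1 D)"
  have j: "j \<ge> 1" "\<And>i. i \<in> D \<Longrightarrow> i \<le> j" using D(1) by (auto simp: j_def)
  define \<eta> where "\<eta> = inverse (real (Suc j))"
  have "\<eta> > 0" by (simp add: \<eta>_def)
  have loss: "\<exists>n. 1 \<le> n \<and> n \<le> j \<and> drift p (real n) x \<le> ?M * real n - \<eta>" for x
  proof -
    obtain z where z: "z \<in> unit_cell" "lattice_rel x z" by (rule lattice_rel_unit_cell)
    have "z \<in> U j" using z(1) D(2) monoU j(2) unit_cell_subset by blast
    then obtain n where n: "n \<le> j" "drift p (real n) z < ?M * real n - \<eta>"
      by (auto simp: U_def \<eta>_def)
    have "n \<noteq> 0"
    proof
      assume "n = 0"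
      then show False using n(2) \<open>\<eta> > 0\<close> by (simp add: drift_0)
    qed
    moreover have "drift p (real n) x = drift p (real n) z" by (rule periodicD[OF periodic_drift z(2)])
    ultimately show ?thesis using n by (intro exI[of _ n]) auto
  qed
  \<comment> \<open>Each block of at most \<open>j\<close> steps loses at least \<eta>, that is at
    least \<open>c\<close> per step; the constant \<open>B\<close> below pays for a final stretch
    shorter than a block.\<close>
  define c where "c = \<eta> / real j"
  have c: "c > 0" "c * real j = \<eta>" using j(1) \<open>\<eta> > 0\<close> by (auto simp: c_def)
  define B where "B = (norm p * C + \<bar>?M\<bar>) * real j + \<eta>"
  have claim: "drift p (real N) x \<le> ?M * real N - c * real N + B" for N x
  proof (induction N arbitrary: x rule: less_induct)
    case (less N)
    obtain n where n: "1 \<le> n" "n \<le> j" "drift p (real n) x \<le> ?M * real n - \<eta>" using loss by blast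
    show ?case
    proof (cases "n \<le> N")
      case True
      have "drift p (real N) x = drift p (real (N - n)) (flow_map (real n) x) + drift p (real n) x"
        using True drift_add[of p "real (N - n)" "real n" x] by (simp add: of_nat_diff)
      also have "\<dots> \<le> (?M * real (N - n) - c * real (N - n) + B) + (?M * real n - \<eta>)"
        using n True by (intro add_mono less.IH) auto
      also have "\<dots> = ?M * real N - c * real N + B + (c * real n - \<eta>)"
        using True by (simp add: of_nat_diff algebra_simps)
      also have "\<dots> \<le> ?M * real N - c * real N + B"
        using n(2) c mult_left_mono[of "real n" "real j" c] by simp
      finally show ?thesis .
    next
      case False
      then have "real N \<le> real j" using n by simp
      have "drift p (real N) x \<le> norm p * C * real N"
        using abs_drift_le[of p "real N" x] by simp
      also have "\<dots> \<le> norm p * C * real j"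
        using \<open>real N \<le> real j\<close> C_pos by (intro mult_left_mono) auto
      finally have "drift p (real N) x \<le> norm p * C * real j" .
      moreover have "- (\<bar>?M\<bar> * real j) \<le> ?M * real N"
      proof -
        have "\<bar>?M * real N\<bar> \<le> \<bar>?M\<bar> * real j"
          using \<open>real N \<le> real j\<close> by (simp add: abs_mult mult_left_mono)
        then show ?thesis by linarith
      qed
      moreover have "c * real N \<le> \<eta>"
        using mult_left_mono[OF \<open>real N \<le> real j\<close>, of c] c by simp
      ultimately show ?thesis by (simp add: B_def distrib_right)
    qed
  qed
  obtain N :: nat where N: "B / c < real N" using reals_Archimedean2 by blast
  obtain x where "?M * real N \<le> drift p (real N) x" using max_drift_attained by blast
  with claim[of N x] have "c * real N \<le> B" by simp
  with N c(1) show False by (simp add: divide_less_eq mult.commute)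
qed

text \<open>If the speed stayed below \<epsilon> from time \<open>T\<close> on, the drift would grow
  at rate at most \<epsilon> |p|, half of the required rate, while the initial stretch contributes a
  fixed amount.\<close>

lemma drifting_orbit_not_slow:
  assumes x: "\<And>n. m * real n \<le> drift p (real n) x" and "m > 0" and \<epsilon>: "\<epsilon> * norm p \<le> m / 2"
  shows "\<exists>t\<ge>T. \<epsilon> \<le> norm (V (abs_torus (flow_map t x)))"
proof (rule ccontr)
  assume neg: "\<not> ?thesis"
  have slow: "norm (V (abs_torus (flow_map t x))) < \<epsilon>" if "t \<ge> T" for t
    using neg that not_le by blast
  have "\<epsilon> > 0" using slow[of T] norm_ge_zero[of "V (abs_torus (flow_map T x))"] by linarith
  \<comment> \<open>The first bound puts \<open>n\<close> beyond |T|; the second makes the initial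
    contribution smaller than m n / 2, the remaining half of the required drift.\<close>
  obtain n :: nat where n: "max (\<bar>T\<bar> + 1) (2 * (norm p * C * \<bar>T\<bar>) / m) < real n" using reals_Archimedean2 by blast
  have "norm (flow_map (real n) x - flow_map \<bar>T\<bar> x) \<le> \<epsilon> * real n - \<epsilon> * \<bar>T\<bar>"
  proof (rule differentiable_bound_general[where f' = "\<lambda>t. V (abs_torus (flow_map t x))" and \<phi>' = "\<lambda>t. \<epsilon>" and \<phi> = "\<lambda>t. \<epsilon> * t"])
    show "((*) \<epsilon> has_vector_derivative \<epsilon>) (at t)" for t
      by (simp add: has_real_derivative_iff_has_vector_derivative[symmetric])
    show "norm (V (abs_torus (flow_map t x))) \<le> \<epsilon>" if "\<bar>T\<bar> < t" for t
    proof -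
      have "T \<le> t" using that by linarith
      from less_imp_le[OF slow[OF this]] show ?thesis .
    qed
  qed (use n in \<open>auto intro!: continuous_flow_map_time flow_map_derivative continuous_intros\<close>)
  also have "\<dots> \<le> \<epsilon> * real n" using \<open>\<epsilon> > 0\<close> by simp
  finally have "norm (flow_map (real n) x - flow_map \<bar>T\<bar> x) \<le> \<epsilon> * real n" .
  then have "norm (flow_map (real n) x - x) \<le> \<epsilon> * real n + C * \<bar>T\<bar>"
    using flow_map_speed[of "\<bar>T\<bar>" x] norm_triangle_ineq[of "flow_map (real n) x - flow_map \<bar>T\<bar> x" "flow_map \<bar>T\<bar> x - x"]
    by simp
  then have "drift p (real n) x \<le> norm p * (\<epsilon> * real n + C * \<bar>T\<bar>)"
    unfolding drift_def
    using order_trans[OF norm_cauchy_schwarz mult_left_mono[OF _ norm_ge_zero]] by blast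
  also have "\<dots> = (\<epsilon> * norm p) * real n + norm p * C * \<bar>T\<bar>" by (simp add: algebra_simps)
  also have "\<dots> \<le> (m / 2) * real n + norm p * C * \<bar>T\<bar>"
    using \<epsilon> by (intro add_right_mono mult_right_mono) auto
  also have "\<dots> < m * real n"
    using n \<open>m > 0\<close> by (simp add: divide_less_eq mult.commute)
  finally show False using x[of n] by simp
qed

text \<open>A drifting orbit does not slow down, so it returns close to itself at a point where the field is
  bounded away from zero; since the Hamiltonian is conserved, the flow box then closes it up.\<close>

lemma drifting_orbit_periodic:
  assumes x: "\<And>n. m * real n \<le> drift p (real n) x" and "m > 0"
  obtains \<tau> where "\<tau> > 0" "lattice_rel (flow_map \<tau> x) x"
proof -
  define q where "q = norm p + 1"
  define \<epsilon> where "\<epsilon> = m / (2 * q)"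
  have q: "q > 0" "norm p \<le> q" by (simp_all add: q_def add_nonneg_pos)
  have "\<epsilon> > 0" using \<open>m > 0\<close> q by (simp add: \<epsilon>_def)
  have "\<epsilon> * norm p \<le> \<epsilon> * q" using \<open>\<epsilon> > 0\<close> q(2) by simp
  also have "\<dots> = m / 2" using q(1) by (simp add: \<epsilon>_def)
  finally have \<epsilon>p: "\<epsilon> * norm p \<le> m / 2" .
  obtain r where "r > 0" and box: "\<And>z y. \<epsilon> \<le> norm (V (abs_torus z)) \<Longrightarrow> norm (y - z) < r \<Longrightarrow> stream y = stream z \<Longrightarrow>
      \<exists>s. \<bar>s\<bar> \<le> 1 / 2 \<and> y = flow_map s z"
    by (rule flow_box[OF \<open>\<epsilon> > 0\<close>]) (rule that)
  define Q where "Q t \<longleftrightarrow> \<epsilon> \<le> norm (V (abs_torus (flow_map t x)))" for t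
  have "\<exists>t\<ge>T. Q t" for T
    unfolding Q_def by (rule drifting_orbit_not_slow[OF x \<open>m > 0\<close> \<epsilon>p])
  \<comment> \<open>Consecutive times are at least 1 apart because the flow box shifts time by up to
    1 / 2; the period obtained at the end is then positive.\<close>
  then obtain t where t: "\<And>n::nat. Q (t n)" "\<And>n. t n + 1 \<le> t (Suc n)"
    using dependent_nat_choice[of "\<lambda>n. Q" "\<lambda>n a b. a + 1 \<le> b"] by metis
  have t_less: "t i + 1 \<le> t j" if "i < j" for i j
    using that
  proof (induction j)
    case (Suc j)
    then show ?case using t(2)[of j] by (cases "i = j") auto
  qed simp
  have "\<exists>y. y \<in> cbox 0 1 \<and> lattice_rel (flow_map (t n) x) y" for n
    using lattice_rel_unit_cell unit_cell_subset by (metis subsetD)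
  then obtain y where y: "\<And>n. y n \<in> cbox 0 1" "\<And>n. lattice_rel (flow_map (t n) x) (y n)" by metis
  obtain l and \<rho> :: "nat \<Rightarrow> nat" where \<rho>: "strict_mono \<rho>" "(y \<circ> \<rho>) \<longlonglongrightarrow> l"
    using compact_cbox[of 0 "1::real^2"] y(1) unfolding compact_def by metis
  from LIMSEQ_imp_Cauchy[OF \<rho>(2)] \<open>r > 0\<close> obtain N where "\<And>i j. i \<ge> N \<Longrightarrow> j \<ge> N \<Longrightarrow> dist (y (\<rho> i)) (y (\<rho> j)) < r"
    unfolding Cauchy_def o_def by blast
  then have close: "norm (y (\<rho> (Suc N)) - y (\<rho> N)) < r" by (simp add: dist_norm)
  define a b where "a = flow_map (t (\<rho> N)) x" and "b = flow_map (t (\<rho> (Suc N))) x"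
  \<comment> \<open>The returns are close only after reduction to the cell. This is the lattice
    translate of \<open>b\<close> that lies next to \<open>a\<close> in the plane, where the flow
    box applies.\<close>
  define b' where "b' = y (\<rho> (Suc N)) + (a - y (\<rho> N))"
  have "lattice_rel b b'"
  proof -
    have "b $ i - b' $ i = (b $ i - y (\<rho> (Suc N)) $ i) - (a $ i - y (\<rho> N) $ i)" for i
      by (simp add: b'_def)
    moreover have "b $ i - y (\<rho> (Suc N)) $ i \<in> \<int>" "a $ i - y (\<rho> N) $ i \<in> \<int>" for i
      using y(2) by (auto simp: lattice_rel_def a_def b_def)
    ultimately show ?thesis unfolding lattice_rel_def by (metis Ints_diff)
  qed
  have "stream b' = stream a"
    using periodicD[OF periodic_stream \<open>lattice_rel b b'\<close>] by (simp add: a_def b_def stream_flow_map)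
  moreover have "norm (b' - a) < r" using close by (simp add: b'_def)
  moreover have "\<epsilon> \<le> norm (V (abs_torus a))" using t(1)[of "\<rho> N"] by (simp add: a_def Q_def)
  ultimately obtain s where s: "\<bar>s\<bar> \<le> 1 / 2" "b' = flow_map s a" using box by blast
  define \<tau> where "\<tau> = t (\<rho> (Suc N)) - (s + t (\<rho> N))"
  have "\<rho> N < \<rho> (Suc N)" using \<rho>(1) by (simp add: strict_mono_def)
  then have "\<tau> > 0" using t_less[of "\<rho> N" "\<rho> (Suc N)"] s(1) by (simp add: \<tau>_def abs_le_iff)
  moreover have "lattice_rel (flow_map \<tau> x) x"
  proof -
    have "lattice_rel (flow_map (- (s + t (\<rho> N))) b) (flow_map (- (s + t (\<rho> N))) b')"
      by (rule flow_map_lattice_rel[OF \<open>lattice_rel b b'\<close>])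
    moreover have "flow_map (- (s + t (\<rho> N))) b = flow_map \<tau> x"
      by (simp add: b_def \<tau>_def algebra_simps flip: flow_map_add)
    moreover have "flow_map (- (s + t (\<rho> N))) b' = x"
      by (simp add: s(2) a_def flow_map_0 flip: flow_map_add)
    ultimately show ?thesis by simp
  qed
  ultimately show thesis by (rule that)
qed

text \<open>Integer times need not be multiples of the period. After n periods the drift is exactly
  n times that of one period, and rounding n \<tau> down to an integer costs at most a constant,
  which is negligible for large n.\<close>

lemma periodic_orbit_drift:
  assumes x: "\<And>n. m * real n \<le> drift p (real n) x" and "\<tau> > 0" "lattice_rel (flow_map \<tau> x) x"
  shows "m * \<tau> \<le> drift p \<tau> x"
proof (rule ccontr)
  assume neg: "\<not> m * \<tau> \<le> drift p \<tau> x"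
  have mult: "lattice_rel (flow_map (real n * \<tau>) x) x \<and> drift p (real n * \<tau>) x = real n * drift p \<tau> x" for n
  proof (induction n)
    case (Suc n)
    have eq: "real (Suc n) * \<tau> = \<tau> + real n * \<tau>" by (simp add: algebra_simps)
    have "lattice_rel (flow_map \<tau> (flow_map (real n * \<tau>) x)) (flow_map \<tau> x)"
      using Suc by (intro flow_map_lattice_rel) simp
    moreover have "drift p \<tau> (flow_map (real n * \<tau>) x) = drift p \<tau> x"
      using Suc by (intro periodicD[OF periodic_drift]) simp
    ultimately show ?case
      unfolding eq using Suc assms(3) lattice_rel_trans
      by (auto simp: flow_map_add drift_add algebra_simps)
  qed (simp add: flow_map_0 drift_0)
  \<comment> \<open>Rounding changes time by at most 1, which costs at most norm p * C in drift and
    |m| in the lower bound.\<close>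
  define B where "B = norm p * C + \<bar>m\<bar>"
  have B: "m * (real n * \<tau>) \<le> real n * drift p \<tau> x + B" for n
  proof -
    define k where "k = nat \<lfloor>real n * \<tau>\<rfloor>"
    have "real k \<le> real n * \<tau>" "real n * \<tau> \<le> real k + 1"
      using \<open>\<tau> > 0\<close> by (auto simp: k_def)
    define s where "s = real n * \<tau> - real k"
    have s: "0 \<le> s" "s \<le> 1" using \<open>real k \<le> real n * \<tau>\<close> \<open>real n * \<tau> \<le> real k + 1\<close> by (auto simp: s_def)
    have "drift p (real n * \<tau>) x = drift p s (flow_map (real k) x) + drift p (real k) x"
      using drift_add[of p s "real k" x] by (simp add: s_def)
    moreover have "- (norm p * C) \<le> drift p s (flow_map (real k) x)"
    proof -
      have "norm p * C * \<bar>s\<bar> \<le> norm p * C * 1" using s C_pos by (intro mult_left_mono) auto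
      then show ?thesis using abs_drift_le[of p s "flow_map (real k) x"] by (simp add: abs_le_iff)
    qed
    moreover have "m * real k \<le> drift p (real k) x" by (rule x)
    moreover have "m * (real n * \<tau>) - m * real k \<le> \<bar>m\<bar>"
    proof -
      have "m * (real n * \<tau>) - m * real k = m * s" by (simp add: s_def algebra_simps)
      also have "\<dots> \<le> \<bar>m\<bar> * s" using s by (intro mult_right_mono) auto
      also have "\<dots> \<le> \<bar>m\<bar>" using s by (intro mult_left_le) auto
      finally show ?thesis .
    qed
    ultimately show ?thesis using mult[of n] by (simp add: B_def)
  qed
  have pos: "m * \<tau> - drift p \<tau> x > 0" using neg by simp
  obtain n :: nat where "B / (m * \<tau> - drift p \<tau> x) < real n" using reals_Archimedean2 by blast
  then have "B < real n * (m * \<tau> - drift p \<tau> x)" using pos by (simp add: divide_less_eq)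
  with B[of n] show False by (simp add: algebra_simps)
qed

end

section \<open>Optimal measures\<close>

text \<open>A bump supported in [- \<delta>, \<delta>] for positive \<delta>. Squaring the positive
  part makes it continuously differentiable, which is enough regularity for an H1 function of the
  Hamiltonian.\<close>

definition cutoff :: "real \<Rightarrow> real \<Rightarrow> real" where
  "cutoff \<delta> s = (max 0 (\<delta>\<^sup>2 - s\<^sup>2))\<^sup>2"

definition cutoff' :: "real \<Rightarrow> real \<Rightarrow> real" where
  "cutoff' \<delta> s = - 4 * s * max 0 (\<delta>\<^sup>2 - s\<^sup>2)"

text \<open>Only the squared positive part needs care: whichever signs its argument has before and
  after a step h, its first-order remainder is at most h^2.\<close>

lemma DERIV_cutoff: "(cutoff \<delta> has_real_derivative cutoff' \<delta> s) (at s)"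
proof -
  have "((\<lambda>u. (max 0 u)\<^sup>2) has_real_derivative 2 * max 0 u) (at u)" for u :: real
  proof (rule DERIV_quadratic_remainder)
    fix h
    show "\<bar>(max 0 (u + h))\<^sup>2 - (max 0 u)\<^sup>2 - 2 * max 0 u * h\<bar> \<le> 1 * h\<^sup>2"
    proof -
      consider "0 \<le> u" "0 \<le> u + h" | "0 \<le> u" "u + h \<le> 0" | "u \<le> 0" "0 \<le> u + h" | "u \<le> 0" "u + h \<le> 0"
        by linarith
      then show ?thesis
      proof cases
        case 1
        then show ?thesis by (simp add: power2_sum)
      next
        case 2
        have "\<bar>- u\<^sup>2 - 2 * u * h\<bar> \<le> h\<^sup>2"
        proof -
          have "h\<^sup>2 - (- u\<^sup>2 - 2 * u * h) = (u + h)\<^sup>2" by (simp add: power2_sum)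
          moreover have "h\<^sup>2 + (- u\<^sup>2 - 2 * u * h) = (h + u) * (h + u) - 2 * u * (u + h) - 2 * u * h"
            by (simp add: power2_eq_square algebra_simps)
          moreover have "u * (u + h) \<le> 0" "u * h \<le> 0"
            using 2 by (auto intro: mult_nonneg_nonpos)
          moreover have "0 \<le> (h + u) * (h + u)" "0 \<le> (u + h)\<^sup>2" by simp_all
          ultimately show ?thesis by linarith
        qed
        then show ?thesis using 2 by (simp add: max_def)
      next
        case 3
        have "(u + h)\<^sup>2 \<le> h\<^sup>2" using 3 by (intro power_mono) auto
        then show ?thesis using 3 by (simp add: max_def)
      next
        case 4
        then show ?thesis by (simp add: max_def)
      qed
    qed
  qed
  moreover have "((\<lambda>s. \<delta>\<^sup>2 - s\<^sup>2) has_real_derivative - (2 * s)) (at s)"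
    by (auto intro!: derivative_eq_intros)
  ultimately have "((\<lambda>s. (max 0 (\<delta>\<^sup>2 - s\<^sup>2))\<^sup>2) has_real_derivative (2 * max 0 (\<delta>\<^sup>2 - s\<^sup>2)) * (- (2 * s))) (at s)"
    by (rule DERIV_chain2)
  then show ?thesis
    unfolding cutoff_def[abs_def] cutoff'_def by (rule DERIV_cong) simp
qed

lemma continuous_cutoff': "continuous_on S (cutoff' \<delta>)"
  unfolding cutoff'_def[abs_def] by (intro continuous_intros)

lemma cutoff_outside:
  assumes "\<delta> \<le> \<bar>s\<bar>" "\<delta> \<ge> 0"
  shows "cutoff \<delta> s = 0" "cutoff' \<delta> s = 0"
proof -
  have "\<delta>\<^sup>2 \<le> s\<^sup>2" using assms power_mono[of \<delta> "\<bar>s\<bar>" 2] by simp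
  then show "cutoff \<delta> s = 0" "cutoff' \<delta> s = 0" by (simp_all add: cutoff_def cutoff'_def)
qed

section \<open>Measures on closed orbits and densities concentrated near them\<close>

context hamiltonian_field
begin

text \<open>The normalised occupation measure of the orbit over the time interval from 0 to
  \<tau>.\<close>

definition orbit_measure :: "real \<Rightarrow> real^2 \<Rightarrow> torus measure" where
  "orbit_measure \<tau> x = distr (uniform_measure lborel {0..\<tau>}) borel (\<lambda>t. abs_torus (flow_map t x))"

lemma measurable_orbit [measurable]: "(\<lambda>t. abs_torus (flow_map t x)) \<in> measurable borel borel"
  by (rule borel_measurable_continuous_onI)
    (rule continuous_on_compose2[OF continuous_on_abs_torus continuous_flow_map_time], simp)

lemma integral_uniform_interval:
  fixes F f :: "real \<Rightarrow> real"
  assumes "\<tau> > 0" "\<And>t. (F has_real_derivative f t) (at t)" "continuous_on UNIV f"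
  shows "(\<integral>t. f t \<partial>uniform_measure lborel {0..\<tau>}) = (F \<tau> - F 0) / \<tau>"
proof -
  have [measurable]: "f \<in> borel_measurable borel"
    using assms(3) by (rule borel_measurable_continuous_onI)
  have "(\<integral>t. f t \<partial>uniform_measure lborel {0..\<tau>})
      = (\<integral>t. f t \<partial>density lborel (\<lambda>t. ennreal (indicator {0..\<tau>} t / \<tau>)))"
  proof -
    have "uniform_measure lborel {0..\<tau>} = density lborel (\<lambda>t. ennreal (indicator {0..\<tau>} t / \<tau>))"
      unfolding uniform_measure_def using assms(1)
      using divide_ennreal[of 1 \<tau>] by (intro density_cong) (auto simp: indicator_def)
    then show ?thesis by simp
  qed
  also have "\<dots> = (\<integral>t. (indicator {0..\<tau>} t / \<tau>) *\<^sub>R f t \<partial>lborel)"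
    using assms(1) by (intro integral_density) auto
  also have "\<dots> = (\<integral>t. (indicator {0..\<tau>} t *\<^sub>R f t) / \<tau> \<partial>lborel)"
    by simp
  also have "\<dots> = (\<integral>t. indicator {0..\<tau>} t *\<^sub>R f t \<partial>lborel) / \<tau>"
    by (rule integral_divide_zero)
  also have "(\<integral>t. indicator {0..\<tau>} t *\<^sub>R f t \<partial>lborel) = F \<tau> - F 0"
  proof (rule integral_FTC_atLeastAtMost)
    show "0 \<le> \<tau>" using assms(1) by simp
    show "continuous_on {0..\<tau>} f" by (rule continuous_on_subset[OF assms(3)]) simp
    show "(F has_vector_derivative f t) (at t within {0..\<tau>})" for t
      using assms(2)[of t] by (simp add: has_real_derivative_iff_has_vector_derivative has_vector_derivative_at_within)
  qed
  finally show ?thesis .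
qed

text \<open>Invariance says that a periodic function has the same integral over every full period:
  the increment of its primitive over one period has zero derivative in the starting time. The mean
  of p . V is the displacement over a period by the fundamental theorem.\<close>

lemma
  assumes "\<tau> > 0" "lattice_rel (flow_map \<tau> x) x"
  shows orbit_measure_invariant: "orbit_measure \<tau> x \<in> invariant_measures V"
    and integral_orbit_measure: "(\<integral>X. p \<bullet> V X \<partial>orbit_measure \<tau> x) = drift p \<tau> x / \<tau>"
proof -
  let ?U = "uniform_measure lborel {0..\<tau>}" and ?\<gamma> = "\<lambda>t. abs_torus (flow_map t x)"
  have m: "?\<gamma> \<in> measurable ?U borel" by measurable
  interpret U: prob_space ?U
    using assms(1) by (intro prob_space_uniform_measure) auto
  have prob: "prob_space (orbit_measure \<tau> x)"
    unfolding orbit_measure_def by (rule U.prob_space_distr[OF m])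
  then interpret OM: prob_space "orbit_measure \<tau> x" .
  have sets: "sets (orbit_measure \<tau> x) = sets borel" by (simp add: orbit_measure_def)
  have "distr (orbit_measure \<tau> x) borel (flow V s) = orbit_measure \<tau> x" for s
  proof (rule torus_measure_eqI_smooth)
    have mf: "flow V s \<in> measurable (orbit_measure \<tau> x) borel"
      using measurable_flow sets by (simp cong: measurable_cong_sets)
    show "finite_measure (distr (orbit_measure \<tau> x) borel (flow V s))"
      by (rule OM.finite_measure_distr[OF mf])
    show "finite_measure (orbit_measure \<tau> x)" by (rule OM.finite_measure_axioms)
    fix \<phi> :: "torus \<Rightarrow> real" assume \<phi>: "torus_smooth \<phi>"
    let ?f = "\<lambda>t. \<phi> (abs_torus (flow_map t x))"
    have [measurable]: "\<phi> \<in> borel_measurable borel"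
      using borel_measurable_rep_torus[OF periodic_abs C_k_continuous[OF torus_smooth_lift[OF \<phi>]]] by simp
    have contf: "continuous_on UNIV ?f"
      by (rule continuous_on_compose2[OF C_k_continuous[OF torus_smooth_lift[OF \<phi>]] continuous_flow_map_time]) simp
    obtain A where A: "\<And>t. (A has_vector_derivative ?f t) (at t)"
      by (rule continuous_antiderivative[OF contf]) (rule that)
    have int: "(\<integral>t. ?f (t + s) \<partial>?U) = (A (\<tau> + s) - A (0 + s)) / \<tau>" for s
    proof (rule integral_uniform_interval[OF assms(1), where F = "\<lambda>t. A (t + s)"])
      show "((\<lambda>t. A (t + s)) has_real_derivative ?f (t + s)) (at t)" for t
        using has_vector_derivative_affine[of A "?f (t + s)" 1 t s] A
        by (simp add: has_real_derivative_iff_has_vector_derivative)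
      show "continuous_on UNIV (\<lambda>t. ?f (t + s))"
        by (rule continuous_on_compose2[OF contf]) (auto intro: continuous_intros)
    qed
    have const: "A (\<tau> + s) - A s = A (\<tau> + 0) - A 0"
    proof (rule DERIV_isconst_all[where f = "\<lambda>s. A (\<tau> + s) - A s"])
      have "((\<lambda>s. A (\<tau> + s) - A s) has_vector_derivative 0) (at s)" for s
      proof -
        have "((\<lambda>s. A (1 * s + \<tau>) - A s) has_vector_derivative (1 *\<^sub>R ?f (1 * s + \<tau>) - ?f s)) (at s)"
          by (intro has_vector_derivative_diff has_vector_derivative_affine A)
        moreover have "?f (1 * s + \<tau>) = ?f s"
        proof -
          have "lattice_rel (flow_map s (flow_map \<tau> x)) (flow_map s x)"
            by (rule flow_map_lattice_rel[OF assms(2)])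
          then have "abs_torus (flow_map (1 * s + \<tau>) x) = abs_torus (flow_map s x)"
            by (simp add: abs_torus_eq_iff flow_map_add)
          then show ?thesis by simp
        qed
        ultimately show ?thesis by (simp add: add.commute)
      qed
      then show "\<forall>s. ((\<lambda>s. A (\<tau> + s) - A s) has_real_derivative 0) (at s)"
        by (simp add: has_real_derivative_iff_has_vector_derivative)
    qed
    have "(\<integral>X. \<phi> X \<partial>distr (orbit_measure \<tau> x) borel (flow V s)) = (\<integral>X. \<phi> (flow V s X) \<partial>orbit_measure \<tau> x)"
      by (rule integral_distr[OF mf]) simp
    also have "\<dots> = (\<integral>t. \<phi> (flow V s (?\<gamma> t)) \<partial>?U)"
      unfolding orbit_measure_def by (rule integral_distr[OF m]) measurable
    also have "\<dots> = (\<integral>t. ?f (t + s) \<partial>?U)"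
      by (simp add: flow_abs_torus add.commute flip: flow_map_add)
    also have "\<dots> = (\<integral>t. ?f (t + 0) \<partial>?U)"
      unfolding int using const by simp
    also have "\<dots> = (\<integral>X. \<phi> X \<partial>orbit_measure \<tau> x)"
      unfolding orbit_measure_def by (subst integral_distr[OF m]) auto
    finally show "(\<integral>X. \<phi> X \<partial>distr (orbit_measure \<tau> x) borel (flow V s)) = (\<integral>X. \<phi> X \<partial>orbit_measure \<tau> x)" .
  qed (simp_all add: sets)
  with prob sets show "orbit_measure \<tau> x \<in> invariant_measures V"
    by (simp add: invariant_measures_def)
  have cont: "continuous_on UNIV (\<lambda>x. p \<bullet> V (abs_torus x))" by (intro continuous_intros continuous_W)
  have meas: "(\<lambda>X. p \<bullet> V X) \<in> borel_measurable borel"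
    using borel_measurable_rep_torus[OF periodic_abs cont] by simp
  have "(\<integral>X. p \<bullet> V X \<partial>orbit_measure \<tau> x) = (\<integral>t. p \<bullet> V (?\<gamma> t) \<partial>?U)"
    unfolding orbit_measure_def by (rule integral_distr[OF m meas])
  also have "\<dots> = (p \<bullet> flow_map \<tau> x - p \<bullet> flow_map 0 x) / \<tau>"
  proof (rule integral_uniform_interval[OF assms(1), where F = "\<lambda>t. p \<bullet> flow_map t x"])
    show "((\<lambda>t. p \<bullet> flow_map t x) has_real_derivative p \<bullet> V (?\<gamma> t)) (at t)" for t
      using bounded_linear.has_vector_derivative[OF bounded_linear_inner_right flow_map_derivative]
      by (simp add: has_real_derivative_iff_has_vector_derivative)
    show "continuous_on UNIV (\<lambda>t. p \<bullet> V (?\<gamma> t))"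
      by (rule continuous_on_compose2[OF cont continuous_flow_map_time]) simp
  qed
  also have "\<dots> = drift p \<tau> x / \<tau>"
    by (simp add: drift_def flow_map_0 inner_diff_right)
  finally show "(\<integral>X. p \<bullet> V X \<partial>orbit_measure \<tau> x) = drift p \<tau> x / \<tau>" .
qed

text \<open>The product of the function with a test function has derivatives of integral zero, so
  the classical gradient is the weak one; continuity and periodicity make everything
  bounded.\<close>

lemma weak_gradient_C1:
  fixes f :: "real^2 \<Rightarrow> real"
  assumes "periodic f" "C_k 1 f"
  shows "H1_with_gradient (\<lambda>X. f (rep_torus X)) (\<lambda>X. \<chi> i. frechet_derivative f (at (rep_torus X)) (axis i 1))"
proof -
  have f: "C_k (Suc 0) f" using assms(2) by simp
  let ?D = "\<lambda>x. (\<chi> i. frechet_derivative f (at x) (axis i 1)) :: real^2"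
  have contf: "continuous_on UNIV f" by (rule C_k_continuous[OF f])
  have contD: "continuous_on UNIV (\<lambda>x. frechet_derivative f (at x) v)" for v
    by (rule C_k_continuous[OF C_k_frechet_derivative[OF f]])
  have perD: "periodic (\<lambda>x. frechet_derivative f (at x) v)" for v
    by (rule periodic_comp[OF periodic_frechet_derivative[OF assms(1)], where h = "\<lambda>D. D v"])
  have contG: "continuous_on UNIV ?D"
    by (intro continuous_on_vec_lambda contD)
  have perG: "periodic ?D"
    by (rule periodic_comp[OF periodic_frechet_derivative[OF assms(1)], where h = "\<lambda>D. \<chi> i. D (axis i 1)"])
  have L2: "torus_L2 (\<lambda>X. g (rep_torus X))" if "periodic g" "continuous_on UNIV g"
    for g :: "real^2 \<Rightarrow> 'b::euclidean_space"
    unfolding torus_L2_def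
  proof
    show "(\<lambda>X. g (rep_torus X)) \<in> borel_measurable torus_measure"
      using borel_measurable_rep_torus[OF that] by simp
    show "integrable torus_measure (\<lambda>X. (norm (g (rep_torus X)))\<^sup>2)"
      by (rule integrable_torus_continuous[where f = "\<lambda>x. (norm (g x))\<^sup>2", OF periodic_comp[OF that(1)] _ torus.finite_measure_axioms])
        (auto intro!: continuous_intros that)
  qed
  have "weak_gradient (\<lambda>X. f (rep_torus X)) (\<lambda>X. ?D (rep_torus X))"
    unfolding weak_gradient_def
  proof (intro allI impI)
    fix \<phi> :: "torus \<Rightarrow> real" and i assume \<phi>: "torus_smooth \<phi>"
    let ?\<phi> = "\<lambda>x. \<phi> (abs_torus x)"
    have Phi: "C_k (Suc 0) ?\<phi>" by (rule torus_smooth_lift[OF \<phi>])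
    have per\<phi>: "periodic ?\<phi>" by (rule periodic_abs)
    note p\<phi> = torus_partial_periodic[OF \<phi>, of "axis i 1", unfolded o_def]
    have i1: "integrable torus_measure (\<lambda>X. f (rep_torus X) * frechet_derivative ?\<phi> (at (rep_torus X)) (axis i 1))"
      by (rule integrable_torus_continuous[where f = "\<lambda>x. f x * frechet_derivative ?\<phi> (at x) (axis i 1)",
            OF periodic_comp2[OF assms(1) p\<phi>(1)] _ torus.finite_measure_axioms])
        (auto intro!: continuous_intros contf p\<phi>(2))
    have i2: "integrable torus_measure (\<lambda>X. frechet_derivative f (at (rep_torus X)) (axis i 1) * ?\<phi> (rep_torus X))"
      by (rule integrable_torus_continuous[where f = "\<lambda>x. frechet_derivative f (at x) (axis i 1) * ?\<phi> x",
            OF periodic_comp2[OF perD per\<phi>] _ torus.finite_measure_axioms])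
        (auto intro!: continuous_intros contD C_k_continuous[OF Phi])
    have "(\<integral>X. frechet_derivative (\<lambda>x. f x * ?\<phi> x) (at (rep_torus X)) (axis i 1) \<partial>torus_measure) = 0"
      using C_k_mult[OF f Phi] by (intro integral_derivative_zero periodic_comp2[OF assms(1) per\<phi>]) simp
    then have "(\<integral>X. f (rep_torus X) * frechet_derivative ?\<phi> (at (rep_torus X)) (axis i 1) \<partial>torus_measure)
       + (\<integral>X. frechet_derivative f (at (rep_torus X)) (axis i 1) * ?\<phi> (rep_torus X) \<partial>torus_measure) = 0"
      unfolding frechet_derivative_lift_mult[OF f Phi] using i1 i2 by simp
    then show "(\<integral>X. f (rep_torus X) * torus_partial i \<phi> X \<partial>torus_measure)
       = - (\<integral>X. ?D (rep_torus X) $ i * \<phi> X \<partial>torus_measure)"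
      by (simp add: torus_partial_def o_def)
  qed
  then show ?thesis
    unfolding H1_with_gradient_def using L2[OF assms(1) contf] L2[OF perG contG] by blast
qed

lemma H1_density_of_C1:
  fixes f :: "real^2 \<Rightarrow> real"
  assumes "periodic f" "C_k 1 f" and orth: "\<And>x. frechet_derivative f (at x) (V (abs_torus x)) = 0"
    and "f x0 \<noteq> 0"
  obtains a where "a > 0" "density torus_measure (\<lambda>X. ennreal (a * (f (rep_torus X))\<^sup>2)) \<in> invariant_H1_densities V"
    "(\<integral>X. a * (f (rep_torus X))\<^sup>2 \<partial>torus_measure) = 1"
proof -
  have f: "C_k (Suc 0) f" using assms(2) by simp
  have per2: "periodic (\<lambda>x. (f x)\<^sup>2)" by (rule periodic_comp[OF assms(1)])
  have cont2: "continuous_on UNIV (\<lambda>x. (f x)\<^sup>2)" by (intro continuous_intros C_k_continuous[OF f])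
  define m where "m = (\<integral>X. (f (rep_torus X))\<^sup>2 \<partial>torus_measure)"
  have "m > 0"
    unfolding m_def using \<open>f x0 \<noteq> 0\<close> by (intro integral_torus_pos[OF per2 cont2, of x0]) auto
  define c where "c = sqrt (1 / m)"
  have c2: "c\<^sup>2 = 1 / m" using \<open>m > 0\<close> by (simp add: c_def)
  let ?w = "\<lambda>x. c * f x"
  have w: "periodic ?w" "C_k 1 ?w"
    using periodic_comp[OF assms(1), of "(*) c"] C_k_mult[OF C_k_const f, of c] by auto
  have Dw: "frechet_derivative ?w (at x) v = c * frechet_derivative f (at x) v" for x v
  proof -
    have "(?w has_derivative (\<lambda>v. c * frechet_derivative f (at x) v)) (at x)"
      by (intro has_derivative_mult_right C_k_has_derivative[OF f])
    from frechet_derivative_at[OF this] show ?thesis by (simp add: fun_eq_iff)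
  qed
  have one: "(\<integral>X. (?w (rep_torus X))\<^sup>2 \<partial>torus_measure) = 1"
    using \<open>m > 0\<close> by (simp add: power_mult_distrib c2 m_def[symmetric])
  have "V X \<bullet> (\<chi> i. frechet_derivative ?w (at (rep_torus X)) (axis i 1)) = 0" for X
  proof -
    have "V X \<bullet> (\<chi> i. frechet_derivative ?w (at (rep_torus X)) (axis i 1))
        = (\<Sum>i\<in>UNIV. V X $ i *\<^sub>R frechet_derivative ?w (at (rep_torus X)) (axis i 1))"
      by (simp add: inner_vec_def)
    also have "\<dots> = frechet_derivative ?w (at (rep_torus X)) (V X)"
      using w(2) by (intro frechet_derivative_expand[where k = 0, symmetric]) simp
    also have "\<dots> = 0" using orth[of "rep_torus X"] by (simp add: Dw)
    finally show ?thesis .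
  qed
  then have "density torus_measure (\<lambda>X. ennreal ((?w (rep_torus X))\<^sup>2)) \<in> invariant_H1_densities V"
    unfolding invariant_H1_densities_def using one weak_gradient_C1[OF w]
    by (intro CollectI exI[of _ "\<lambda>X. ?w (rep_torus X)"] conjI refl exI) auto
  then show thesis
    using one \<open>m > 0\<close> by (intro that[of "1 / m"]) (simp_all add: power_mult_distrib c2)
qed

text \<open>A periodic orbit with positive drift is isolated in its level set of the Hamiltonian, so a cutoff
  of the Hamiltonian restricted to a neighbourhood of the orbit is a first integral.\<close>

lemma periodic_orbit_H1_density:
  assumes "\<tau> > 0" "lattice_rel (flow_map \<tau> x) x" "drift p \<tau> x > 0" "e > 0"
  obtains \<sigma> where "\<sigma> \<in> invariant_H1_densities V" "drift p \<tau> x / \<tau> - e \<le> (\<integral>X. p \<bullet> V X \<partial>\<sigma>)"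
proof -
  \<comment> \<open>All lattice translates are included, so this is the full preimage of the closed
    orbit on the torus and the distance to it is periodic.\<close>
  define Orb where "Orb = {y. \<exists>t. lattice_rel (flow_map t x) y}"
  have Orb_lattice: "z \<in> Orb" if "y \<in> Orb" "lattice_rel y z" for y z
    using that lattice_rel_trans unfolding Orb_def by blast
  have "x \<in> Orb" unfolding Orb_def using flow_map_0[of x] by (auto intro!: exI[of _ 0])
  then have "Orb \<noteq> {}" by blast
  have Orb_flow: "flow_map s y \<in> Orb" if "y \<in> Orb" for s y
  proof -
    obtain t where "lattice_rel (flow_map t x) y" using \<open>y \<in> Orb\<close> by (auto simp: Orb_def)
    from flow_map_lattice_rel[OF this, of s] show ?thesis
      unfolding Orb_def by (auto simp flip: flow_map_add)
  qed
  \<comment> \<open>Over one period the lifted orbit moves by a fixed lattice vector, wherever on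
    the orbit it starts.\<close>
  have Orb_drift: "drift p \<tau> y = drift p \<tau> x" if "y \<in> Orb" for y
  proof -
    obtain t where t: "lattice_rel (flow_map t x) y" using \<open>y \<in> Orb\<close> by (auto simp: Orb_def)
    have "drift p \<tau> y = drift p \<tau> (flow_map t x)" using periodicD[OF periodic_drift t] by simp
    also have "flow_map \<tau> (flow_map t x) = flow_map t (flow_map \<tau> x)"
      by (simp add: add.commute flip: flow_map_add)
    then have "drift p \<tau> (flow_map t x) = p \<bullet> (flow_map t (flow_map \<tau> x) - flow_map t x)"
      by (simp add: drift_def)
    also have "\<dots> = drift p \<tau> x"
      using flow_map_lattice[OF lattice_rel_sym[OF assms(2)], of t] by (simp add: drift_def)
    finally show ?thesis .
  qed
  have Orb_stream: "stream y = stream x" if "y \<in> Orb" for y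
  proof -
    obtain t where t: "lattice_rel (flow_map t x) y" using \<open>y \<in> Orb\<close> by (auto simp: Orb_def)
    then show ?thesis using periodicD[OF periodic_stream t] by (simp add: stream_flow_map)
  qed
  \<comment> \<open>A zero of the field on the orbit would be a rest point with drift 0, contrary to
    the positive drift over a period. Reducing times modulo \<tau> leaves a compact interval, on
    which the speed has a positive minimum.\<close>
  obtain v where "v > 0" and v: "\<And>y. y \<in> Orb \<Longrightarrow> v \<le> norm (V (abs_torus y))"
  proof -
    have "continuous_on {0..\<tau>} (\<lambda>t. norm (V (abs_torus (flow_map t x))))"
      by (intro continuous_on_norm continuous_on_compose2[OF continuous_W[of UNIV] continuous_flow_map_time]) simp
    moreover have "{0..\<tau>} \<noteq> {}" using assms(1) by simp
    ultimately obtain t0 where t0: "\<And>t. t \<in> {0..\<tau>} \<Longrightarrow> norm (V (abs_torus (flow_map t0 x))) \<le> norm (V (abs_torus (flow_map t x)))"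
      using continuous_attains_inf[OF compact_Icc] by blast
    have "V (abs_torus (flow_map t0 x)) \<noteq> 0"
    proof
      let ?q = "flow_map t0 x"
      assume "V (abs_torus ?q) = 0"
      then have "solution (\<lambda>s. ?q)" by (simp add: solution_def)
      from flow_map_unique[OF this, of \<tau>] have "drift p \<tau> ?q = 0" by (simp add: drift_def)
      moreover have "?q \<in> Orb" using Orb_flow[OF \<open>x \<in> Orb\<close>] .
      ultimately show False using Orb_drift assms(3) by simp
    qed
    moreover have "norm (V (abs_torus (flow_map t0 x))) \<le> norm (V (abs_torus y))" if "y \<in> Orb" for y
    proof -
      obtain t where t: "lattice_rel (flow_map t x) y" using \<open>y \<in> Orb\<close> by (auto simp: Orb_def)
      have mult: "lattice_rel (flow_map (real n * \<tau>) x) x" for n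
      proof (induction n)
        case (Suc n)
        have "lattice_rel (flow_map \<tau> (flow_map (real n * \<tau>) x)) (flow_map \<tau> x)"
          by (rule flow_map_lattice_rel[OF Suc])
        then have "lattice_rel (flow_map (\<tau> + real n * \<tau>) x) x"
          using lattice_rel_trans[OF _ assms(2)] by (simp add: flow_map_add)
        then show ?case by (simp add: algebra_simps)
      qed (simp add: flow_map_0)
      have mult': "lattice_rel (flow_map (of_int k * \<tau>) x) x" for k
      proof (cases "k \<ge> 0")
        case True
        then show ?thesis using mult[of "nat k"] by simp
      next
        case False
        have "lattice_rel (flow_map (of_int k * \<tau>) (flow_map (real (nat (- k)) * \<tau>) x)) (flow_map (of_int k * \<tau>) x)"
          by (rule flow_map_lattice_rel[OF mult])
        moreover have "of_int k * \<tau> + real (nat (- k)) * \<tau> = 0" using False by simp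
        ultimately show ?thesis
          using flow_map_add[of "of_int k * \<tau>" "real (nat (- k)) * \<tau>" x] by (simp add: flow_map_0 lattice_rel_sym)
      qed
      define s where "s = t - of_int \<lfloor>t / \<tau>\<rfloor> * \<tau>"
      have "of_int \<lfloor>t / \<tau>\<rfloor> * \<tau> \<le> t" "t < (of_int \<lfloor>t / \<tau>\<rfloor> + 1) * \<tau>"
        using of_int_floor_le[of "t / \<tau>"] real_of_int_floor_add_one_gt[of "t / \<tau>"]
        by (simp_all only: pos_le_divide_eq[OF assms(1)] pos_divide_less_eq[OF assms(1)])
      then have s: "s \<in> {0..\<tau>}" by (simp add: s_def algebra_simps)
      have "lattice_rel (flow_map s (flow_map (of_int \<lfloor>t / \<tau>\<rfloor> * \<tau>) x)) (flow_map s x)"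
        by (rule flow_map_lattice_rel[OF mult'])
      then have "lattice_rel (flow_map t x) (flow_map s x)"
        by (simp add: s_def flip: flow_map_add)
      then have "abs_torus y = abs_torus (flow_map s x)"
        using t lattice_rel_sym lattice_rel_trans unfolding abs_torus_eq_iff by blast
      then show ?thesis using t0[OF s] by simp
    qed
    ultimately show thesis by (intro that[of "norm (V (abs_torus (flow_map t0 x)))"]) auto
  qed
  obtain r0 where "r0 > 0" and box: "\<And>z y. v \<le> norm (V (abs_torus z)) \<Longrightarrow> norm (y - z) < r0 \<Longrightarrow> stream y = stream z \<Longrightarrow>
      \<exists>s. \<bar>s\<bar> \<le> 1 / 2 \<and> y = flow_map s z"
    by (rule flow_box[OF \<open>v > 0\<close>]) (rule that)
  define K where "K = norm p * (exp (L * \<bar>\<tau>\<bar>) + 1) + 1"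
  have "K > 0" by (simp add: K_def add_nonneg_pos)
  \<comment> \<open>The bound \<open>r0\<close> keeps the neighbourhood inside flow boxes around the
    orbit; the other one lets the drift over time \<tau> change by at most e \<tau> there.\<close>
  define r where "r = min r0 (e * \<tau> / K)"
  have "r > 0" using \<open>r0 > 0\<close> \<open>K > 0\<close> assms by (simp add: r_def)
  define d where "d y = infdist y Orb" for y
  have per_d: "periodic d" unfolding d_def by (rule infdist_lattice) (rule Orb_lattice)
  have cont_d: "continuous_on S d" for S unfolding d_def by (intro continuous_intros)
  have near: "\<exists>q\<in>Orb. norm (y - q) < r" if "d y < r" for y
  proof -
    have "bdd_below (dist y ` Orb)" by (intro bdd_belowI[of _ 0]) auto
    then have "\<exists>q\<in>Orb. dist y q < r"
      using that \<open>Orb \<noteq> {}\<close> by (simp add: d_def infdist_notempty cINF_less_iff)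
    then show ?thesis by (simp add: dist_norm)
  qed
  have near_drift: "drift p \<tau> x - e * \<tau> \<le> drift p \<tau> y" if "d y < r" for y
  proof -
    obtain q where q: "q \<in> Orb" "norm (y - q) < r" using near[OF \<open>d y < r\<close>] by blast
    have "\<bar>drift p \<tau> y - drift p \<tau> q\<bar> \<le> (K - 1) * norm (y - q)"
      using drift_lipschitz[of p \<tau> y q] by (simp add: K_def)
    also have "\<dots> \<le> K * norm (y - q)" by (simp add: mult_right_mono)
    also have "\<dots> \<le> K * (e * \<tau> / K)"
      using q(2) \<open>K > 0\<close> by (intro mult_left_mono) (auto simp: r_def)
    also have "\<dots> = e * \<tau>" using \<open>K > 0\<close> by simp
    finally show ?thesis using Orb_drift[OF q(1)] by (simp add: abs_le_iff)
  qed
  have isolated: "y \<in> Orb" if "d y < r" "stream y = stream x" for y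
  proof -
    obtain q where q: "q \<in> Orb" "norm (y - q) < r" using near[OF \<open>d y < r\<close>] by blast
    then have "norm (y - q) < r0" by (simp add: r_def)
    then obtain s where "y = flow_map s q"
      using box[OF v[OF q(1)], of y] \<open>stream y = stream x\<close> Orb_stream[OF q(1)] by auto
    then show ?thesis using Orb_flow[OF q(1)] by simp
  qed
  have cont_s: "continuous_on S stream" for S
    using C_k_continuous[OF C_k_stream] continuous_on_subset by blast
  \<comment> \<open>On the closed shell between distances r / 2 and 3 r / 4 the level of the orbit
    is not attained, since the orbit is isolated within distance r. Compactness modulo the lattice
    turns this into a gap, the width of the cutoff; an empty shell allows any width.\<close>
  obtain \<delta> where "\<delta> > 0" and \<delta>: "\<And>y. r / 2 \<le> d y \<Longrightarrow> d y \<le> 3 * r / 4 \<Longrightarrow> \<delta> \<le> \<bar>stream y - stream x\<bar>"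
  proof -
    define S where "S = cbox 0 1 \<inter> {y. r / 2 \<le> d y} \<inter> {y. d y \<le> 3 * r / 4}"
    have "compact S"
      unfolding S_def
      by (intro compact_Int_closed compact_cbox closed_Collect_le continuous_intros cont_d)
    have contS: "continuous_on S (\<lambda>y. \<bar>stream y - stream x\<bar>)" by (intro continuous_intros cont_s)
    have to_S: "\<exists>z\<in>S. d y = d z \<and> stream y = stream z" if "r / 2 \<le> d y" "d y \<le> 3 * r / 4" for y
    proof -
      obtain z where z: "z \<in> unit_cell" "lattice_rel y z" by (rule lattice_rel_unit_cell)
      have "d y = d z" "stream y = stream z"
        using periodicD[OF per_d z(2)] periodicD[OF periodic_stream z(2)] by auto
      moreover have "z \<in> S" using that z(1) unit_cell_subset \<open>d y = d z\<close> by (auto simp: S_def)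
      ultimately show ?thesis by blast
    qed
    show thesis
    proof (cases "S = {}")
      case True
      then show thesis using to_S by (intro that[of 1]) auto
    next
      case False
      obtain z where z: "z \<in> S" "\<And>y. y \<in> S \<Longrightarrow> \<bar>stream z - stream x\<bar> \<le> \<bar>stream y - stream x\<bar>"
        using continuous_attains_inf[OF \<open>compact S\<close> False contS] by blast
      have "stream z \<noteq> stream x"
      proof
        assume "stream z = stream x"
        moreover have "d z < r" "r / 2 \<le> d z" using z(1) \<open>r > 0\<close> by (auto simp: S_def)
        ultimately have "z \<in> Orb" by (intro isolated)
        then have "d z = 0" by (simp add: d_def)
        with \<open>r / 2 \<le> d z\<close> \<open>r > 0\<close> show False by simp
      qed
      then show thesis using z(2) to_S by (intro that[of "\<bar>stream z - stream x\<bar>"]) (auto, metis)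
    qed
  qed
  define w where "w y = (if d y < 3 * r / 4 then cutoff \<delta> (stream y - stream x) else 0)" for y
  define w' where "w' y v = (if d y < 3 * r / 4 then cutoff' \<delta> (stream y - stream x) * cross2 v (V (abs_torus y)) else 0)" for y v
  \<comment> \<open>The two open sets overlap in the shell, where the cutoff already vanishes. On
    \<open>A\<close> the function is the cutoff of the Hamiltonian and on \<open>B\<close> it is
    zero, so truncating by the distance introduces no jump.\<close>
  define A B where "A = {y. d y < 3 * r / 4}" and "B = {y. r / 2 < d y}"
  have opens: "open A" "open B"
    unfolding A_def B_def by (intro open_Collect_less cont_d continuous_on_const)+
  have AB: "A \<union> B = UNIV"
  proof -
    have "d y < 3 * r / 4 \<or> r / 2 < d y" for y using \<open>r > 0\<close> by linarith
    then show ?thesis unfolding A_def B_def by blast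
  qed
  have zero_B: "w y = 0" "w' y v = 0" if "y \<in> B" for y v
    using that \<delta>[of y] cutoff_outside[of \<delta> "stream y - stream x"] \<open>\<delta> > 0\<close>
    by (auto simp: w_def w'_def B_def)
  have Dw: "(w has_derivative w' y) (at y)" for y
  proof (cases "y \<in> A")
    case True
    have "((\<lambda>y. cutoff \<delta> (stream y - stream x)) has_derivative
        (\<lambda>v. cross2 v (V (abs_torus y)) * cutoff' \<delta> (stream y - stream x))) (at y)"
    proof (rule has_derivative_compose[where g = "cutoff \<delta>" and f = "\<lambda>y. stream y - stream x"
          and f' = "\<lambda>v. cross2 v (V (abs_torus y))" and g' = "\<lambda>h. h * cutoff' \<delta> (stream y - stream x)"])
      show "((\<lambda>y. stream y - stream x) has_derivative (\<lambda>v. cross2 v (V (abs_torus y)))) (at y)"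
        using has_derivative_diff[OF stream_has_derivative has_derivative_const] by simp
      show "(cutoff \<delta> has_derivative (\<lambda>h. h * cutoff' \<delta> (stream y - stream x))) (at (stream y - stream x))"
        using DERIV_cutoff[of \<delta> "stream y - stream x"] by (simp add: has_field_derivative_def mult.commute[of _ "cutoff' \<delta> (stream y - stream x)"])
    qed
    then have "(w has_derivative (\<lambda>v. cross2 v (V (abs_torus y)) * cutoff' \<delta> (stream y - stream x))) (at y)"
      by (rule has_derivative_transform_within_open[OF _ opens(1) True]) (simp add: w_def A_def)
    moreover have "w' y = (\<lambda>v. cross2 v (V (abs_torus y)) * cutoff' \<delta> (stream y - stream x))"
      using True by (simp add: fun_eq_iff w'_def A_def mult.commute)
    ultimately show ?thesis by simp
  next
    case False
    then have "y \<in> B" using AB by blast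
    have "((\<lambda>y. 0) has_derivative (\<lambda>v. 0)) (at y)" by simp
    then have "(w has_derivative (\<lambda>v. 0)) (at y)"
      by (rule has_derivative_transform_within_open[OF _ opens(2) \<open>y \<in> B\<close>]) (simp add: zero_B)
    moreover have "w' y = (\<lambda>v. 0)" using zero_B(2)[OF \<open>y \<in> B\<close>] by (simp add: fun_eq_iff)
    ultimately show ?thesis by simp
  qed
  have cont_w': "continuous_on UNIV (\<lambda>y. w' y v)" for v
    unfolding AB[symmetric]
  proof (rule continuous_on_open_Un[OF opens])
    have "continuous_on A (\<lambda>y. cutoff' \<delta> (stream y - stream x) * cross2 v (V (abs_torus y)))"
      by (intro continuous_on_mult continuous_on_compose2[OF continuous_cutoff'[of UNIV]]
          bounded_linear.continuous_on[OF bounded_linear_cross2(2)] continuous_W continuous_intros cont_s) auto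
    then show "continuous_on A (\<lambda>y. w' y v)"
      by (rule continuous_on_eq) (simp add: w'_def A_def)
    have "continuous_on B (\<lambda>y. 0 :: real)" by simp
    then show "continuous_on B (\<lambda>y. w' y v)"
      by (rule continuous_on_eq) (simp add: zero_B)
  qed
  have fr: "frechet_derivative w (at y) v = w' y v" for y v
    using frechet_derivative_at[OF Dw, of y] by (simp add: fun_eq_iff)
  have "C_k (Suc 0) w"
    unfolding C_k.simps fr using Dw cont_w' by (auto simp: differentiable_def)
  then have C1_w: "C_k 1 w" by simp
  have per_w: "periodic w"
    unfolding w_def by (rule periodic_comp2[OF per_d periodic_stream, where h = "\<lambda>d s. if d < 3 * r / 4 then cutoff \<delta> (s - stream x) else 0"])
  have "w x \<noteq> 0"
    using \<open>x \<in> Orb\<close> \<open>r > 0\<close> \<open>\<delta> > 0\<close> by (simp add: w_def d_def cutoff_def)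
  obtain a where "a > 0" and \<sigma>: "density torus_measure (\<lambda>X. ennreal (a * (w (rep_torus X))\<^sup>2)) \<in> invariant_H1_densities V"
    and one: "(\<integral>X. a * (w (rep_torus X))\<^sup>2 \<partial>torus_measure) = 1"
    by (rule H1_density_of_C1[OF per_w C1_w _ \<open>w x \<noteq> 0\<close>]) (auto simp: fr w'_def intro: that)
  let ?\<sigma> = "density torus_measure (\<lambda>X. ennreal (a * (w (rep_torus X))\<^sup>2))"
  have per_w2: "periodic (\<lambda>y. a * (w y)\<^sup>2)" by (rule periodic_comp[OF per_w])
  have cont_w2: "continuous_on UNIV (\<lambda>y. a * (w y)\<^sup>2)"
    by (intro continuous_intros C_k_continuous[OF C1_w])
  have [measurable]: "(\<lambda>X. a * (w (rep_torus X))\<^sup>2) \<in> borel_measurable borel"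
    by (rule borel_measurable_rep_torus[OF per_w2 cont_w2])
  have [measurable]: "(\<lambda>X. drift p \<tau> (rep_torus X)) \<in> borel_measurable borel"
    by (rule borel_measurable_rep_torus[OF periodic_drift continuous_drift])
  have int1: "integrable torus_measure (\<lambda>X. a * (w (rep_torus X))\<^sup>2)"
    by (rule integrable_torus_continuous[OF per_w2 cont_w2 torus.finite_measure_axioms]) simp
  have int2: "integrable torus_measure (\<lambda>X. a * (w (rep_torus X))\<^sup>2 * drift p \<tau> (rep_torus X))"
    by (rule integrable_mult_periodic[OF int1 periodic_drift continuous_drift])
  \<comment> \<open>The estimate compares drifts over time \<tau>, since p . V itself may vary
    strongly along the orbit. Nearby drifts differ little, and invariance of the density converts
    the mean drift into \<tau> times the mean of p . V.\<close>
  have "drift p \<tau> x - e * \<tau> = (\<integral>X. a * (w (rep_torus X))\<^sup>2 * (drift p \<tau> x - e * \<tau>) \<partial>torus_measure)"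
    using one by simp
  also have "\<dots> \<le> (\<integral>X. a * (w (rep_torus X))\<^sup>2 * drift p \<tau> (rep_torus X) \<partial>torus_measure)"
  proof (rule integral_mono)
    fix X
    show "a * (w (rep_torus X))\<^sup>2 * (drift p \<tau> x - e * \<tau>) \<le> a * (w (rep_torus X))\<^sup>2 * drift p \<tau> (rep_torus X)"
    proof (cases "d (rep_torus X) < 3 * r / 4")
      case True
      then have "drift p \<tau> x - e * \<tau> \<le> drift p \<tau> (rep_torus X)"
        using \<open>r > 0\<close> by (intro near_drift) simp
      then show ?thesis using \<open>a > 0\<close> by (intro mult_left_mono) auto
    next
      case False
      then show ?thesis by (simp add: w_def)
    qed
  qed (use int1 int2 in auto)
  also have "\<dots> = (\<integral>X. drift p \<tau> (rep_torus X) \<partial>?\<sigma>)"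
    using \<open>a > 0\<close> by (subst integral_density) auto
  also have "\<dots> = \<tau> * (\<integral>X. p \<bullet> V X \<partial>?\<sigma>)"
    by (rule invariant_integral_drift) (use \<sigma> H1_densities_invariant in blast)
  finally have "(drift p \<tau> x - e * \<tau>) / \<tau> \<le> (\<integral>X. p \<bullet> V X \<partial>?\<sigma>)"
    using assms(1) by (simp add: divide_le_eq mult.commute)
  then have "drift p \<tau> x / \<tau> - e \<le> (\<integral>X. p \<bullet> V X \<partial>?\<sigma>)"
    using assms(1) by (simp add: diff_divide_distrib)
  with \<sigma> show thesis by (rule that)
qed

section \<open>Equality of the two optimal values\<close>

lemma torus_measure_H1_density: "torus_measure \<in> invariant_H1_densities V"
proof -
  have "frechet_derivative (\<lambda>x::real^2. 1::real) (at x) v = 0" for x v by simp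
  then obtain a where "density torus_measure (\<lambda>X. ennreal (a * 1\<^sup>2)) \<in> invariant_H1_densities V"
    "(\<integral>X. a * 1\<^sup>2 \<partial>torus_measure) = 1"
    using H1_density_of_C1[of "\<lambda>x. 1" 0] C_k_const[of 1 "1::real"] by (auto simp del: C_k.simps)
  moreover have "density torus_measure (\<lambda>X. 1) = torus_measure"
    by (rule density_1)
  ultimately show ?thesis using torus.prob_space by simp
qed

lemma integral_torus_measure_zero: "(\<integral>X. p \<bullet> V X \<partial>torus_measure) = 0"
proof -
  have "integrable torus_measure (\<lambda>X. V (abs_torus (rep_torus X)))"
    by (rule integrable_torus_continuous[OF periodic_W continuous_W torus.finite_measure_axioms]) simp
  then show ?thesis by (simp add: mean_zero)
qed

lemma sup_eq_max:
  "\<exists>\<sigma>\<^sub>0 \<in> invariant_measures V.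
     (\<forall>\<sigma> \<in> invariant_measures V. (\<integral>x. p \<bullet> V x \<partial>\<sigma>) \<le> (\<integral>x. p \<bullet> V x \<partial>\<sigma>\<^sub>0)) \<and>
     (SUP \<sigma> \<in> invariant_H1_densities V. ereal (\<integral>x. p \<bullet> V x \<partial>\<sigma>)) = ereal (\<integral>x. p \<bullet> V x \<partial>\<sigma>\<^sub>0)"
proof -
  let ?I = "\<lambda>\<sigma>. \<integral>x. p \<bullet> V x \<partial>\<sigma>"
  \<comment> \<open>Both signs of \<open>max_drift\<close> reduce to this: the inclusion of the H1
    densities in the invariant measures bounds the supremum above, and approximation within every e
    bounds it below. The approximation also shows that the supremum is not over an empty
    set.\<close>
  have suff: ?thesis
    if \<sigma>0: "\<sigma>0 \<in> invariant_measures V" and max: "\<And>\<sigma>. \<sigma> \<in> invariant_measures V \<Longrightarrow> ?I \<sigma> \<le> ?I \<sigma>0"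
      and approx: "\<And>e. e > 0 \<Longrightarrow> \<exists>\<sigma>\<in>invariant_H1_densities V. ?I \<sigma>0 - e \<le> ?I \<sigma>" for \<sigma>0
  proof (intro bexI[OF _ \<sigma>0] conjI ballI max antisym)
    show "(SUP \<sigma> \<in> invariant_H1_densities V. ereal (?I \<sigma>)) \<le> ereal (?I \<sigma>0)"
      using max H1_densities_invariant by (intro SUP_least) auto
    show "ereal (?I \<sigma>0) \<le> (SUP \<sigma> \<in> invariant_H1_densities V. ereal (?I \<sigma>))"
    proof (rule ereal_le_epsilon2)
      fix e :: real assume "0 < e"
      then obtain \<sigma> where \<sigma>: "\<sigma> \<in> invariant_H1_densities V" "?I \<sigma>0 - e \<le> ?I \<sigma>" using approx by blast
      have "ereal (?I \<sigma>0) \<le> ereal (?I \<sigma>) + ereal e" using \<sigma>(2) by simp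
      also have "\<dots> \<le> (SUP \<sigma> \<in> invariant_H1_densities V. ereal (?I \<sigma>)) + ereal e"
        by (intro add_right_mono SUP_upper \<sigma>(1))
      finally show "ereal (?I \<sigma>0) \<le> (SUP \<sigma> \<in> invariant_H1_densities V. ereal (?I \<sigma>)) + ereal e" .
    qed
  qed
  show ?thesis
  proof (cases "max_drift p \<le> 0")
    case True
    show ?thesis
    proof (rule suff)
      show "torus_measure \<in> invariant_measures V"
        using torus_measure_H1_density H1_densities_invariant by blast
      show "?I \<sigma> \<le> ?I torus_measure" if "\<sigma> \<in> invariant_measures V" for \<sigma>
        using invariant_integral_le_max_drift[OF that, of p] True by (simp add: integral_torus_measure_zero)
      show "\<exists>\<sigma>\<in>invariant_H1_densities V. ?I torus_measure - e \<le> ?I \<sigma>" if "e > 0" for e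
        using torus_measure_H1_density that by (intro bexI[of _ torus_measure]) auto
    qed
  next
    case False
    then have pos: "max_drift p > 0" by simp
    obtain x where x: "\<And>n. max_drift p * real n \<le> drift p (real n) x" using max_drift_orbit by blast
    obtain \<tau> where \<tau>: "\<tau> > 0" "lattice_rel (flow_map \<tau> x) x"
      by (rule drifting_orbit_periodic[OF x pos]) (rule that)
    have le: "max_drift p * \<tau> \<le> drift p \<tau> x" by (rule periodic_orbit_drift[OF x \<tau>])
    then have dpos: "drift p \<tau> x > 0" using pos \<tau>(1) mult_pos_pos[of "max_drift p" \<tau>] by linarith
    have I: "?I (orbit_measure \<tau> x) = drift p \<tau> x / \<tau>" by (rule integral_orbit_measure[OF \<tau>])
    have max: "max_drift p \<le> drift p \<tau> x / \<tau>" using le \<tau>(1) by (simp add: le_divide_eq)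
    show ?thesis
    proof (rule suff[OF orbit_measure_invariant[OF \<tau>]])
      show "?I \<sigma> \<le> ?I (orbit_measure \<tau> x)" if "\<sigma> \<in> invariant_measures V" for \<sigma>
        using invariant_integral_le_max_drift[OF that, of p] max unfolding I by linarith
      show "\<exists>\<sigma>\<in>invariant_H1_densities V. ?I (orbit_measure \<tau> x) - e \<le> ?I \<sigma>" if "e > 0" for e
      proof -
        obtain \<sigma> where "\<sigma> \<in> invariant_H1_densities V" "drift p \<tau> x / \<tau> - e \<le> ?I \<sigma>"
          by (rule periodic_orbit_H1_density[OF \<tau> dpos \<open>e > 0\<close>]) (rule that)
        then show ?thesis unfolding I by blast
      qed
    qed
  qed
qed

end

theorem lemma4p3:
  fixes V :: "torus \<Rightarrow> real^2" and p :: "real^2"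
  assumes "torus_smooth V"
    and "\<forall>x. divergence V x = 0"
    and "(\<integral>x. V x \<partial>torus_measure) = 0"
  shows "\<exists>\<sigma>\<^sub>0 \<in> invariant_measures V.
           (\<forall>\<sigma> \<in> invariant_measures V. (\<integral>x. p \<bullet> V x \<partial>\<sigma>) \<le> (\<integral>x. p \<bullet> V x \<partial>\<sigma>\<^sub>0)) \<and>
           (SUP \<sigma> \<in> invariant_H1_densities V. ereal (\<integral>x. p \<bullet> V x \<partial>\<sigma>))
             = ereal (\<integral>x. p \<bullet> V x \<partial>\<sigma>\<^sub>0)"
proof -
  have smooth: "C_k k (\<lambda>x. V (abs_torus x))" for k by (rule torus_smooth_lift[OF assms(1)])
  \<comment> \<open>Periodicity and smoothness of the lift furnish the two constants of the
    locale.\<close>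
  obtain L where "L > 0" "\<And>x y. norm (V (abs_torus x) - V (abs_torus y)) \<le> L * norm (x - y)"
    by (rule C1_periodic_lipschitz[OF periodic_abs smooth]) (rule that)
  moreover obtain C where "C > 0" "\<And>x. norm (V (abs_torus x)) \<le> C"
    by (rule periodic_bounded[OF periodic_abs C_k_continuous[OF smooth]]) (rule that)
  ultimately interpret hamiltonian_field V L C
    using assms by unfold_locales auto
  show ?thesis by (rule sup_eq_max)
qed

end
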